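(* Let $(M,\mathcal{F})$ be a foliated manifold (a manifold with a singular foliation). Then the triple $(T^*M,\{\cdot,\cdot\}_{T^*M},\mathcal{I}_{\mathcal{F}})$ is an $\mathcal{I}$-Poisson manifold.
   Context: A singular foliation (SF) on a smooth manifold $M$ is a $C^\infty(M)$-submodule $\mathcal{F}$ of the compactly supported vector fields $\mathfrak{X}_c(M)$ that is closed under the Lie bracket and locally finitely generated: every $q\in M$ has an open neighborhood $U$ such that $\{X\in\mathcal{F}:\mathrm{supp}(X)\subset U\}=\langle X_1,\dots,X_N\rangle_{C_c^\infty(U)}$ for finitely many $X_a\in\mathfrak{X}(U)$. Let $\{\cdot,\cdot\}_{T^*M}$ be the canonical Poisson bracket on $T^*M$ (with $\{p_i,q^j\}=\delta_i^j$). For $X\in\mathfrak{X}(M)$ let $\overline{X}\in C^\infty(T^*M)$, $\overline{X}(q,p)=\langle p,X|_q\rangle$. Put $\mathcal{J}_{\mathcal{F}}:=\langle\overline{X}:X\in\mathcal{F}\rangle_{C_c^\infty(T^*M)}$ and, for $U\subset T^*M$ open, $\mathcal{I}_{\mathcal{F}}(U):=\{f\in C^\infty(U):\rho f\in\mathcal{J}_{\mathcal{F}}\ \forall\rho\in C_c^\infty(U)\}$ (with $\rho f$ extended by zero). An $\mathcal{I}$-Poisson manifold is a triple $(P,\{\cdot,\cdot\},\mathcal{I})$ where $P$ is a manifold, $\{\cdot,\cdot\}$ is an $\mathbb{R}$-bilinear skew-symmetric bracket on $C^\infty(P)$ satisfying the Leibniz rule (restricted to open subsets via the associated bivector field), and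 $\mathcal{I}$ is a subsheaf of the sheaf of smooth functions on $P$ which is locally finitely generated (every point has an open neighborhood $U$ and $g_1,\dots,g_N\in C^\infty(U)$ with $\mathcal{I}(V)=\langle g_1|_V,\dots,g_N|_V\rangle_{C^\infty(V)}$ for every open $V\subset U$), such that for every open $U\subset P$: (1) $\mathcal{I}(U)$ is a $C^\infty(U)$-module; (2) $\{\mathcal{I}(U),\mathcal{I}(U)\}\subset\mathcal{I}(U)$; (3) $\{\{f,g\},h\}+\{\{g,h\},f\}+\{\{h,f\},g\}\in\mathcal{I}(P)$ for all $f,g,h\in N(\mathcal{I})$, where $N(\mathcal{I}):=\{f\in C^\infty(P):\{f|_U,\mathcal{I}(U)\}\subset\mathcal{I}(U)\text{ for every open }U\}$. *)

theory Defs
  imports "HOL-Analysis.Analysis"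
begin

section \<open>Smooth functions on open subsets of Euclidean n-space\<close>

text \<open>
  The model space is \<^term>\<open>Euclidean_space n\<close>, whose points are the sequences of reals vanishing
  from index \<open>n\<close> on. The dimension is thus a number, \<open>n = 0\<close> is allowed, and the cotangent bundle
  of an \<open>n\<close>-manifold can be modelled on dimension \<open>2 * n\<close>.
\<close>

definition partial :: "nat \<Rightarrow> ((nat \<Rightarrow> real) \<Rightarrow> real) \<Rightarrow> (nat \<Rightarrow> real) \<Rightarrow> real" where
  "partial i f x = deriv (\<lambda>t. f (x(i := t))) (x i)"

primrec Ck_on :: "nat \<Rightarrow> nat \<Rightarrow> (nat \<Rightarrow> real) set \<Rightarrow> ((nat \<Rightarrow> real) \<Rightarrow> real) \<Rightarrow> bool" where
  "Ck_on 0 n S f \<longleftrightarrow> continuous_map (subtopology (Euclidean_space n) S) euclideanreal f"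
| "Ck_on (Suc k) n S f \<longleftrightarrow>
     continuous_map (subtopology (Euclidean_space n) S) euclideanreal f \<and>
     (\<forall>i<n. (\<forall>x\<in>S. (\<lambda>t. f (x(i := t))) differentiable (at (x i))) \<and> Ck_on k n S (partial i f))"

definition Cinf_on :: "nat \<Rightarrow> (nat \<Rightarrow> real) set \<Rightarrow> ((nat \<Rightarrow> real) \<Rightarrow> real) \<Rightarrow> bool" where
  "Cinf_on n S f \<longleftrightarrow> (\<forall>k. Ck_on k n S f)"

section \<open>Smooth manifolds\<close>

text \<open>A chart is a pair of its domain and the coordinate map, which is irrelevant off the domain.\<close>

type_synonym 'a chart = "'a set \<times> ('a \<Rightarrow> nat \<Rightarrow> real)"

record 'a manifold =
  mtop :: "'a topology"
  mdim :: nat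
  atlas :: "'a chart set"

abbreviation carr :: "'a manifold \<Rightarrow> 'a set" where
  "carr M \<equiv> topspace (mtop M)"

definition is_chart :: "'a topology \<Rightarrow> nat \<Rightarrow> 'a chart \<Rightarrow> bool" where
  "is_chart T n c \<longleftrightarrow> (case c of (U, \<phi>) \<Rightarrow>
     openin T U \<and> openin (Euclidean_space n) (\<phi> ` U) \<and>
     homeomorphic_map (subtopology T U) (subtopology (Euclidean_space n) (\<phi> ` U)) \<phi>)"

text \<open>The condition is imposed on all ordered pairs of charts, so that transition maps are
  diffeomorphisms. The atlas need not be maximal; all notions below depend only on the smooth
  structure it generates.\<close>

definition compatible_charts :: "nat \<Rightarrow> 'a chart \<Rightarrow> 'a chart \<Rightarrow> bool" where
  "compatible_charts n c d \<longleftrightarrow> (case c of (U, \<phi>) \<Rightarrow> case d of (V, \<psi>) \<Rightarrow>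
     (\<forall>j<n. Cinf_on n (\<phi> ` (U \<inter> V)) (\<lambda>x. \<psi> (inv_into U \<phi> x) j)))"

definition smooth_manifold :: "'a manifold \<Rightarrow> bool" where
  "smooth_manifold M \<longleftrightarrow>
     Hausdorff_space (mtop M) \<and> second_countable (mtop M) \<and>
     (\<forall>c\<in>atlas M. is_chart (mtop M) (mdim M) c) \<and>
     (\<Union>c\<in>atlas M. fst c) = carr M \<and>
     (\<forall>c\<in>atlas M. \<forall>d\<in>atlas M. compatible_charts (mdim M) c d)"

section \<open>The sheaf of smooth functions\<close>

definition smooth_on :: "'a manifold \<Rightarrow> 'a set \<Rightarrow> ('a \<Rightarrow> real) \<Rightarrow> bool" where
  "smooth_on M W f \<longleftrightarrow>
     (\<forall>(U, \<phi>)\<in>atlas M. Cinf_on (mdim M) (\<phi> ` (U \<inter> W)) (f \<circ> inv_into U \<phi>))"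

text \<open>
  A function on an open set \<open>U\<close> is represented by the total function that is \<open>0\<close> off \<open>U\<close>, so that
  equality of functions on \<open>U\<close> is equality in HOL, and algebraic operations are pointwise.
  The value \<open>0\<close> off \<open>U\<close> is only a convention: an element of \<open>C\<^sup>\<infinity>(U)\<close> need not be smooth, or even
  continuous, at the boundary of \<open>U\<close>. For \<open>f\<close> in \<open>C\<^sup>\<infinity>(U)\<close> and \<open>\<rho>\<close> compactly supported in \<open>U\<close> the
  pointwise product is the product extended by zero. The same convention is used for vector fields.
\<close>

definition Cinf :: "'a manifold \<Rightarrow> 'a set \<Rightarrow> ('a \<Rightarrow> real) set" where
  "Cinf M U = {f. smooth_on M U f \<and> (\<forall>x. x \<notin> U \<longrightarrow> f x = 0)}"

definition restr :: "'a set \<Rightarrow> ('a \<Rightarrow> real) \<Rightarrow> 'a \<Rightarrow> real" where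
  "restr V f = (\<lambda>x. if x \<in> V then f x else 0)"

definition supp :: "'a manifold \<Rightarrow> ('a \<Rightarrow> real) \<Rightarrow> 'a set" where
  "supp M f = mtop M closure_of {x \<in> carr M. f x \<noteq> 0}"

definition Cc :: "'a manifold \<Rightarrow> 'a set \<Rightarrow> ('a \<Rightarrow> real) set" where
  "Cc M U = {f \<in> Cinf M (carr M). compactin (mtop M) (supp M f) \<and> supp M f \<subseteq> U}"

definition is_submodule :: "'a manifold \<Rightarrow> 'a set \<Rightarrow> ('a \<Rightarrow> real) set \<Rightarrow> bool" where
  "is_submodule M U A \<longleftrightarrow> A \<subseteq> Cinf M U \<and> (\<lambda>_. 0) \<in> A \<and>
     (\<forall>f\<in>A. \<forall>g\<in>A. (\<lambda>x. f x + g x) \<in> A) \<and>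
     (\<forall>h\<in>Cinf M U. \<forall>f\<in>A. (\<lambda>x. h x * f x) \<in> A)"

section \<open>Tangent and cotangent vectors\<close>

text \<open>
  A tangent vector at \<open>q\<close> is a derivation at \<open>q\<close> of the algebra of germs of smooth functions.
  It is represented as a function on all real functions that depends on the germ only, and is \<open>0\<close>
  on functions that are not smooth near \<open>q\<close>.
\<close>

type_synonym 'a tvec = "('a \<Rightarrow> real) \<Rightarrow> real"

definition smooth_near :: "'a manifold \<Rightarrow> 'a \<Rightarrow> ('a \<Rightarrow> real) \<Rightarrow> bool" where
  "smooth_near M q f \<longleftrightarrow> (\<exists>W. openin (mtop M) W \<and> q \<in> W \<and> smooth_on M W f)"

definition tangent_space :: "'a manifold \<Rightarrow> 'a \<Rightarrow> 'a tvec set" where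
  "tangent_space M q = {v.
     (\<forall>f. \<not> smooth_near M q f \<longrightarrow> v f = 0) \<and>
     (\<forall>f g W. openin (mtop M) W \<and> q \<in> W \<and> (\<forall>x\<in>W. f x = g x) \<longrightarrow> v f = v g) \<and>
     (\<forall>f g. smooth_near M q f \<and> smooth_near M q g \<longrightarrow>
        v (\<lambda>x. f x + g x) = v f + v g \<and>
        v (\<lambda>x. f x * g x) = f q * v g + g q * v f) \<and>
     (\<forall>f c. smooth_near M q f \<longrightarrow> v (\<lambda>x. c * f x) = c * v f)}"

definition coord_vec :: "'a manifold \<Rightarrow> 'a chart \<Rightarrow> nat \<Rightarrow> 'a \<Rightarrow> 'a tvec" where
  "coord_vec M c i q = (case c of (U, \<phi>) \<Rightarrow>
     \<lambda>f. if smooth_near M q f then partial i (f \<circ> inv_into U \<phi>) (\<phi> q) else 0)"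

text \<open>A cotangent vector is a linear form on the tangent space, set to \<open>0\<close> off that space.\<close>

type_synonym 'a cvec = "'a tvec \<Rightarrow> real"

definition cotangent_space :: "'a manifold \<Rightarrow> 'a \<Rightarrow> 'a cvec set" where
  "cotangent_space M q = {p.
     (\<forall>v. v \<notin> tangent_space M q \<longrightarrow> p v = 0) \<and>
     (\<forall>u\<in>tangent_space M q. \<forall>v\<in>tangent_space M q. p (\<lambda>f. u f + v f) = p u + p v) \<and>
     (\<forall>c. \<forall>v\<in>tangent_space M q. p (\<lambda>f. c * v f) = c * p v)}"

definition differential :: "'a manifold \<Rightarrow> ('a \<Rightarrow> real) \<Rightarrow> 'a \<Rightarrow> 'a cvec" where
  "differential M f q = (\<lambda>v. if v \<in> tangent_space M q then v f else 0)"

section \<open>Vector fields and singular foliations\<close>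

type_synonym 'a vfield = "'a \<Rightarrow> 'a tvec"

definition vector_fields :: "'a manifold \<Rightarrow> 'a set \<Rightarrow> 'a vfield set" where
  "vector_fields M U = {X.
     (\<forall>q\<in>U. X q \<in> tangent_space M q) \<and> (\<forall>q. q \<notin> U \<longrightarrow> X q = (\<lambda>_. 0)) \<and>
     (\<forall>V f. openin (mtop M) V \<and> V \<subseteq> U \<and> f \<in> Cinf M V \<longrightarrow> smooth_on M V (\<lambda>q. X q f))}"

definition vsupp :: "'a manifold \<Rightarrow> 'a vfield \<Rightarrow> 'a set" where
  "vsupp M X = mtop M closure_of {q \<in> carr M. X q \<noteq> (\<lambda>_. 0)}"

definition vector_fields_c :: "'a manifold \<Rightarrow> 'a vfield set" where
  "vector_fields_c M = {X \<in> vector_fields M (carr M). compactin (mtop M) (vsupp M X)}"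

definition lie_bracket :: "'a manifold \<Rightarrow> 'a vfield \<Rightarrow> 'a vfield \<Rightarrow> 'a vfield" where
  "lie_bracket M X Y = (\<lambda>q f. if smooth_near M q f
     then X q (\<lambda>r. Y r f) - Y q (\<lambda>r. X r f) else 0)"

definition singular_foliation :: "'a manifold \<Rightarrow> 'a vfield set \<Rightarrow> bool" where
  "singular_foliation M F \<longleftrightarrow>
     F \<subseteq> vector_fields_c M \<and>
     (\<lambda>_ _. 0) \<in> F \<and>
     (\<forall>X\<in>F. \<forall>Y\<in>F. (\<lambda>q f. X q f + Y q f) \<in> F) \<and>
     (\<forall>h\<in>Cinf M (carr M). \<forall>X\<in>F. (\<lambda>q f. h q * X q f) \<in> F) \<and>
     (\<forall>X\<in>F. \<forall>Y\<in>F. lie_bracket M X Y \<in> F) \<and>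
     (\<forall>q\<in>carr M. \<exists>U (N::nat) X. openin (mtop M) U \<and> q \<in> U \<and>
        (\<forall>a<N. X a \<in> vector_fields M U) \<and>
        {Y \<in> F. vsupp M Y \<subseteq> U} =
          {(\<lambda>r f. \<Sum>a<N. h a r * X a r f) | h. \<forall>a<N. h a \<in> Cc M U})"

section \<open>The cotangent bundle and its canonical Poisson bracket\<close>

definition cotangent_carrier :: "'a manifold \<Rightarrow> ('a \<times> 'a cvec) set" where
  "cotangent_carrier M = {(q, p). q \<in> carr M \<and> p \<in> cotangent_space M q}"

text \<open>The coordinates \<open>(q\<^sup>1, \<dots>, q\<^sup>n, p\<^sub>1, \<dots>, p\<^sub>n)\<close> induced by a chart of the base.\<close>

definition cotangent_chart :: "'a manifold \<Rightarrow> 'a chart \<Rightarrow> ('a \<times> 'a cvec) chart" where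
  "cotangent_chart M c =
     ({z \<in> cotangent_carrier M. fst z \<in> fst c},
      \<lambda>(q, p) i. if i < mdim M then snd c q i
                 else if i < 2 * mdim M then p (coord_vec M c (i - mdim M) q) else 0)"

definition cotangent_bundle :: "'a manifold \<Rightarrow> ('a \<times> 'a cvec) manifold" where
  "cotangent_bundle M =
     \<lparr>mtop = topology_generated_by
        {{z \<in> D. \<Phi> z \<in> V} | D \<Phi> V.
           (D, \<Phi>) \<in> cotangent_chart M ` atlas M \<and> openin (Euclidean_space (2 * mdim M)) V},
      mdim = 2 * mdim M,
      atlas = cotangent_chart M ` atlas M\<rparr>"

text \<open>In induced coordinates the bracket is
  \<open>\<Sum>\<^sub>i (\<partial>f/\<partial>p\<^sub>i) (\<partial>g/\<partial>q\<^sup>i) - (\<partial>f/\<partial>q\<^sup>i) (\<partial>g/\<partial>p\<^sub>i)\<close>, so that \<open>{p\<^sub>i, q\<^sup>j} = \<delta>\<^sub>i\<^sup>j\<close>.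
  The description picks the common value over all charts of \<open>M\<close> around the base point.\<close>

definition coord_bracket ::
  "nat \<Rightarrow> 'b chart \<Rightarrow> ('b \<Rightarrow> real) \<Rightarrow> ('b \<Rightarrow> real) \<Rightarrow> 'b \<Rightarrow> real" where
  "coord_bracket n c f g z = (case c of (D, \<Phi>) \<Rightarrow>
     let f' = f \<circ> inv_into D \<Phi>; g' = g \<circ> inv_into D \<Phi>; x = \<Phi> z in
     (\<Sum>i<n. partial (n + i) f' x * partial i g' x - partial i f' x * partial (n + i) g' x))"

definition canonical_bracket :: "'a manifold \<Rightarrow>
    ('a \<times> 'a cvec \<Rightarrow> real) \<Rightarrow> ('a \<times> 'a cvec \<Rightarrow> real) \<Rightarrow> 'a \<times> 'a cvec \<Rightarrow> real" where
  "canonical_bracket M f g = (\<lambda>z.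
     if z \<in> cotangent_carrier M
     then (THE b. \<forall>c\<in>atlas M. fst z \<in> fst c \<longrightarrow>
             b = coord_bracket (mdim M) (cotangent_chart M c) f g z)
     else 0)"

section \<open>The sheaf associated with a singular foliation\<close>

definition lift_vf :: "'a manifold \<Rightarrow> 'a vfield \<Rightarrow> 'a \<times> 'a cvec \<Rightarrow> real" where
  "lift_vf M X = (\<lambda>(q, p). if (q, p) \<in> cotangent_carrier M then p (X q) else 0)"

definition J_foliation :: "'a manifold \<Rightarrow> 'a vfield set \<Rightarrow> ('a \<times> 'a cvec \<Rightarrow> real) set" where
  "J_foliation M F =
     {(\<lambda>z. \<Sum>a<N. h a z * lift_vf M (X a) z) | (N::nat) h X.
        \<forall>a<N. h a \<in> Cc (cotangent_bundle M) (carr (cotangent_bundle M)) \<and> X a \<in> F}"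

definition I_foliation ::
  "'a manifold \<Rightarrow> 'a vfield set \<Rightarrow> ('a \<times> 'a cvec) set \<Rightarrow> ('a \<times> 'a cvec \<Rightarrow> real) set" where
  "I_foliation M F U =
     {f \<in> Cinf (cotangent_bundle M) U.
        \<forall>\<rho>\<in>Cc (cotangent_bundle M) U. (\<lambda>z. \<rho> z * f z) \<in> J_foliation M F}"

section \<open>I-Poisson manifolds\<close>

definition biderivation ::
  "'b manifold \<Rightarrow> (('b \<Rightarrow> real) \<Rightarrow> ('b \<Rightarrow> real) \<Rightarrow> 'b \<Rightarrow> real) \<Rightarrow> bool" where
  "biderivation P br \<longleftrightarrow> (let C = Cinf P (carr P) in
     (\<forall>f\<in>C. \<forall>g\<in>C. br f g \<in> C) \<and>
     (\<forall>f\<in>C. \<forall>g\<in>C. \<forall>h\<in>C. \<forall>a b.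
        br (\<lambda>x. a * f x + b * g x) h = (\<lambda>x. a * br f h x + b * br g h x) \<and>
        br h (\<lambda>x. a * f x + b * g x) = (\<lambda>x. a * br h f x + b * br h g x)) \<and>
     (\<forall>f\<in>C. \<forall>g\<in>C. br f g = (\<lambda>x. - br g f x)) \<and>
     (\<forall>f\<in>C. \<forall>g\<in>C. \<forall>h\<in>C.
        br f (\<lambda>x. g x * h x) = (\<lambda>x. br f g x * h x + g x * br f h x)))"

text \<open>The bivector field \<open>\<pi>\<close> of a bracket, given by \<open>\<pi>\<^sub>x(d\<^sub>xf, d\<^sub>xg) = {f, g}(x)\<close>, and the
  resulting brackets on open subsets.\<close>

definition bivector :: "'b manifold \<Rightarrow> (('b \<Rightarrow> real) \<Rightarrow> ('b \<Rightarrow> real) \<Rightarrow> 'b \<Rightarrow> real) \<Rightarrow>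
    'b \<Rightarrow> 'b cvec \<Rightarrow> 'b cvec \<Rightarrow> real" where
  "bivector P br x \<alpha> \<beta> = (THE b. \<exists>f\<in>Cinf P (carr P). \<exists>g\<in>Cinf P (carr P).
     differential P f x = \<alpha> \<and> differential P g x = \<beta> \<and> b = br f g x)"

definition local_bracket :: "'b manifold \<Rightarrow> (('b \<Rightarrow> real) \<Rightarrow> ('b \<Rightarrow> real) \<Rightarrow> 'b \<Rightarrow> real) \<Rightarrow>
    'b set \<Rightarrow> ('b \<Rightarrow> real) \<Rightarrow> ('b \<Rightarrow> real) \<Rightarrow> 'b \<Rightarrow> real" where
  "local_bracket P br U f g =
     restr U (\<lambda>x. bivector P br x (differential P f x) (differential P g x))"

definition subsheaf :: "'b manifold \<Rightarrow> ('b set \<Rightarrow> ('b \<Rightarrow> real) set) \<Rightarrow> bool" where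
  "subsheaf P I \<longleftrightarrow>
     (\<forall>U. openin (mtop P) U \<longrightarrow> I U \<subseteq> Cinf P U) \<and>
     (\<forall>U V. openin (mtop P) U \<and> openin (mtop P) V \<and> V \<subseteq> U \<longrightarrow> restr V ` I U \<subseteq> I V) \<and>
     (\<forall>\<U> s. (\<forall>U\<in>\<U>. openin (mtop P) U \<and> s U \<in> I U) \<and>
        (\<forall>U\<in>\<U>. \<forall>V\<in>\<U>. restr (U \<inter> V) (s U) = restr (U \<inter> V) (s V)) \<longrightarrow>
        (\<exists>!f. f \<in> I (\<Union>\<U>) \<and> (\<forall>U\<in>\<U>. restr U f = s U)))"

definition locally_finitely_generated ::
  "'b manifold \<Rightarrow> ('b set \<Rightarrow> ('b \<Rightarrow> real) set) \<Rightarrow> bool" where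
  "locally_finitely_generated P I \<longleftrightarrow>
     (\<forall>x\<in>carr P. \<exists>U (N::nat) g. openin (mtop P) U \<and> x \<in> U \<and> (\<forall>a<N. g a \<in> Cinf P U) \<and>
        (\<forall>V. openin (mtop P) V \<and> V \<subseteq> U \<longrightarrow>
           I V = {(\<lambda>y. \<Sum>a<N. h a y * restr V (g a) y) | h. \<forall>a<N. h a \<in> Cinf P V}))"

definition normalizer :: "'b manifold \<Rightarrow> (('b \<Rightarrow> real) \<Rightarrow> ('b \<Rightarrow> real) \<Rightarrow> 'b \<Rightarrow> real) \<Rightarrow>
    ('b set \<Rightarrow> ('b \<Rightarrow> real) set) \<Rightarrow> ('b \<Rightarrow> real) set" where
  "normalizer P br I = {f \<in> Cinf P (carr P).
     \<forall>U. openin (mtop P) U \<longrightarrow> (\<forall>g\<in>I U. local_bracket P br U (restr U f) g \<in> I U)}"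

definition I_Poisson_manifold :: "'b manifold \<Rightarrow>
    (('b \<Rightarrow> real) \<Rightarrow> ('b \<Rightarrow> real) \<Rightarrow> 'b \<Rightarrow> real) \<Rightarrow> ('b set \<Rightarrow> ('b \<Rightarrow> real) set) \<Rightarrow> bool" where
  "I_Poisson_manifold P br I \<longleftrightarrow>
     smooth_manifold P \<and> biderivation P br \<and> subsheaf P I \<and> locally_finitely_generated P I \<and>
     (\<forall>U. openin (mtop P) U \<longrightarrow> is_submodule P U (I U)) \<and>
     (\<forall>U. openin (mtop P) U \<longrightarrow> (\<forall>f\<in>I U. \<forall>g\<in>I U. local_bracket P br U f g \<in> I U)) \<and>
     (\<forall>f\<in>normalizer P br I. \<forall>g\<in>normalizer P br I. \<forall>h\<in>normalizer P br I.
        (\<lambda>x. br (br f g) h x + br (br g h) f x + br (br h f) g x) \<in> I (carr P))"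

end

theory Submission
  imports Defs
begin

text \<open>
  In induced coordinates the canonical bracket has constant coefficients, and coordinate changes of
  the base lift to canonical transformations, so the bracket is globally defined and satisfies the
  Jacobi identity by the symmetry of second derivatives. Hence condition (3) holds with left-hand
  side 0. The bracket of the lifts of \<open>X\<close> and \<open>Y\<close> is the lift of \<open>[X, Y]\<close>, so by the Leibniz rule
  \<open>\<rho> {f, g}\<close> lies in \<open>J\<close> for \<open>f\<close>, \<open>g\<close> in \<open>J\<close> and \<open>\<rho>\<close> compactly supported; replacing \<open>f\<close> and \<open>g\<close> by
  their products with a bump that is 1 near the support of \<open>\<rho>\<close>, one gets condition (2). If vector
  fields \<open>X\<^sub>a\<close> generate \<open>F\<close> over \<open>U\<close>, their lifts generate the sheaf over the preimage of \<open>U\<close>: compactly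
  supported multiples of a section have coefficients by definition, and these are summed with the
  help of a sequence of bumps. That induced charts are injective rests on Hadamard's lemma, by which
  a derivation of germs is a combination of partial derivatives.
\<close>

section \<open>Calculus on open subsets of Euclidean space\<close>

text \<open>The definitions shape the work. Smoothness means that all iterated partial derivatives
  exist and are continuous, so the chain rule, the symmetry of mixed derivatives and Hadamard's
  lemma are derived from one-variable calculus. Tangent vectors are derivations of germs and
  cotangent vectors are forms on them, so even the inverse of an induced chart has to be
  constructed. The bracket and the bivector are definite descriptions, of use only after chart
  independence and dependence on differentials alone are known.

  On the side of the foliation the obstacle is a mismatch of supports. Members of \<open>F\<close>
  have compact support in \<open>M\<close>, coefficients in \<open>J_foliation\<close> have compact
  support in the bundle, the local generators live over \<open>U\<close> only, and sections over
  \<open>V\<close> may be wild at its boundary. The passage between them uses a bump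
  \<open>\<psi>\<close> on the base: the compact support of a function on the bundle projects to a
  compact set, \<open>\<psi>\<close> is 1 near it, and \<open>\<psi>\<close> times a vector field
  falls under the generation property.\<close>

lemma Euclidean_space_eq: "Euclidean_space n = top_of_set {x. \<forall>i\<ge>n. x i = 0}"
  by (simp add: Euclidean_space_def euclidean_product_topology)

lemma openin_Euclidean_zero: "openin (Euclidean_space n) S \<Longrightarrow> x \<in> S \<Longrightarrow> i \<ge> n \<Longrightarrow> x i = 0"
  by (auto simp: Euclidean_space_eq openin_open)

lemma continuous_map_Euclidean_iff:
  assumes "openin (Euclidean_space n) S"
  shows "continuous_map (subtopology (Euclidean_space n) S) euclideanreal f \<longleftrightarrow> continuous_on S f"
proof -
  have "S \<subseteq> {x. \<forall>i\<ge>n. x i = 0}"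
    using openin_Euclidean_zero[OF assms] by auto
  then have "subtopology (Euclidean_space n) S = top_of_set S"
    by (simp add: Euclidean_space_eq subtopology_subtopology Int_absorb1)
  then show ?thesis
    by simp
qed

lemma tendsto_funI:
  fixes f :: "'a \<Rightarrow> 'i \<Rightarrow> 'b::topological_space"
  assumes "\<And>i. ((\<lambda>t. f t i) \<longlongrightarrow> a i) F"
  shows "(f \<longlongrightarrow> a) F"
proof -
  have "limitin (product_topology (\<lambda>i. euclidean) UNIV) f a F"
    unfolding limitin_componentwise using assms by auto
  then show ?thesis
    by (simp add: euclidean_product_topology)
qed

text \<open>Coordinates from \<open>n\<close> on are forced to be 0, so the cube is open in the
  model space though not in the space of all sequences. For \<open>n = 0\<close> it is the single
  point 0, whatever \<open>r\<close> is.\<close>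

definition obox :: "nat \<Rightarrow> (nat \<Rightarrow> real) \<Rightarrow> real \<Rightarrow> (nat \<Rightarrow> real) set" where
  "obox n a r = {x. (\<forall>i<n. \<bar>x i - a i\<bar> < r) \<and> (\<forall>i\<ge>n. x i = 0)}"

lemma openin_obox [simp]: "openin (Euclidean_space n) (obox n a r)"
proof -
  have "open (PiE UNIV (\<lambda>i. if i < n then {a i - r<..<a i + r} else UNIV))"
    by (rule open_PiE) (auto simp: finite_subset[of _ "{..<n}"])
  moreover have "obox n a r = {x. \<forall>i\<ge>n. x i = 0} \<inter> PiE UNIV (\<lambda>i. if i < n then {a i - r<..<a i + r} else UNIV)"
  proof (intro set_eqI iffI)
    fix x assume "x \<in> obox n a r"
    then show "x \<in> {x. \<forall>i\<ge>n. x i = 0} \<inter> PiE UNIV (\<lambda>i. if i < n then {a i - r<..<a i + r} else UNIV)"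
      by (auto simp: obox_def PiE_UNIV_domain abs_less_iff)
  next
    fix x assume x: "x \<in> {x. \<forall>i\<ge>n. x i = 0} \<inter> PiE UNIV (\<lambda>i. if i < n then {a i - r<..<a i + r} else UNIV)"
    then have "x i \<in> (if i < n then {a i - r<..<a i + r} else UNIV)" for i
      by (auto simp: PiE_iff)
    from this[of i for i] have "\<bar>x i - a i\<bar> < r" if "i < n" for i
      using that by (metis abs_diff_less_iff greaterThanLessThan_iff)
    then show "x \<in> obox n a r"
      using x by (simp add: obox_def)
  qed
  ultimately show ?thesis
    by (simp add: Euclidean_space_eq openin_open_Int)
qed

text \<open>If no box fitted, points outside \<open>S\<close> in the boxes of radius 1/(k+1) would
  converge to \<open>a\<close> coordinate by coordinate, hence in the product topology, and would
  eventually enter \<open>S\<close>.\<close>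

lemma obox_subset:
  assumes "openin (Euclidean_space n) S" "a \<in> S"
  obtains r where "r > 0" "obox n a r \<subseteq> S"
proof -
  have "\<exists>r>0. obox n a r \<subseteq> S"
  proof (rule ccontr)
    assume "\<not> ?thesis"
    then have "\<not> obox n a (1 / real (Suc k)) \<subseteq> S" for k
      by auto
    then have "\<forall>k. \<exists>x. x \<in> obox n a (1 / real (Suc k)) \<and> x \<notin> S"
      by blast
    then obtain x where x: "\<And>k. x k \<in> obox n a (1 / real (Suc k))" "\<And>k. x k \<notin> S"
      by metis
    have a0: "a i = 0" if "i \<ge> n" for i
      using openin_Euclidean_zero[OF assms that] .
    have lim: "x \<longlonglongrightarrow> a"
    proof (rule tendsto_funI)
      fix i
      show "(\<lambda>k. x k i) \<longlonglongrightarrow> a i"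
      proof (rule LIM_zero_cancel)
        show "((\<lambda>k. x k i - a i) \<longlongrightarrow> 0) sequentially"
        proof (rule LIMSEQ_norm_0)
          fix k
          show "norm (x k i - a i) < 1 / real (Suc k)"
            using x(1)[of k] a0[of i] by (cases "i < n") (auto simp: obox_def)
        qed
      qed
    qed
    obtain T where T: "open T" "S = {x. \<forall>i\<ge>n. x i = 0} \<inter> T"
      using assms(1) by (auto simp: Euclidean_space_eq openin_open)
    have "\<forall>\<^sub>F k in sequentially. x k \<in> T"
      using lim T assms(2) by (auto simp: tendsto_def)
    then obtain k where "x k \<in> T"
      using eventually_happens'[OF sequentially_bot] by blast
    then have "x k \<in> S"
      using T x(1)[of k] by (auto simp: obox_def)
    with x(2) show False by blast
  qed
  then show thesis using that by blast
qed

lemma obox_center [simp]: "r > 0 \<Longrightarrow> (\<And>i. i \<ge> n \<Longrightarrow> a i = 0) \<Longrightarrow> a \<in> obox n a r"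
  by (auto simp: obox_def)

text \<open>Moving one coordinate slightly does not leave an open set; this is why partial
  derivatives at a point of \<open>S\<close> depend only on the values on \<open>S\<close>.\<close>

lemma eventually_fun_upd_in:
  assumes "openin (Euclidean_space n) S" "x \<in> S" "i < n"
  shows "\<forall>\<^sub>F t in nhds (x i). x(i := t) \<in> S"
proof -
  obtain r where r: "r > 0" "obox n x r \<subseteq> S"
    using obox_subset[OF assms(1,2)] .
  have "\<forall>\<^sub>F t in nhds (x i). dist t (x i) < r"
    using r(1) by (auto simp: eventually_nhds_metric)
  then show ?thesis
    by (rule eventually_mono)
       (use r openin_Euclidean_zero[OF assms(1,2)] \<open>i < n\<close> in \<open>auto simp: obox_def dist_real_def intro!: subsetD[OF r(2)]\<close>)
qed

lemma DERIV_cong_on: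
  fixes f g :: "(nat \<Rightarrow> real) \<Rightarrow> real"
  assumes "openin (Euclidean_space n) S" "x \<in> S" "i < n" "\<forall>y\<in>S. f y = g y"
  shows "((\<lambda>t. f (x(i := t))) has_real_derivative D) (at (x i)) \<longleftrightarrow>
         ((\<lambda>t. g (x(i := t))) has_real_derivative D) (at (x i))"
proof (rule DERIV_cong_ev)
  show "\<forall>\<^sub>F t in nhds (x i). f (x(i := t)) = g (x(i := t))"
    by (rule eventually_mono[OF eventually_fun_upd_in[OF assms(1-3)]]) (use assms(4) in auto)
qed auto

lemma partial_cong:
  fixes f g :: "(nat \<Rightarrow> real) \<Rightarrow> real"
  assumes "openin (Euclidean_space n) S" "x \<in> S" "i < n" "\<forall>y\<in>S. f y = g y"
  shows "partial i f x = partial i g x"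
  unfolding partial_def deriv_def using DERIV_cong_on[OF assms] by simp

lemma partialI: "((\<lambda>t. f (x(i := t))) has_real_derivative D) (at (x i)) \<Longrightarrow> partial i f x = D"
  unfolding partial_def by (rule DERIV_imp_deriv)

lemma Ck_on_0:
  "openin (Euclidean_space n) S \<Longrightarrow> Ck_on 0 n S f \<longleftrightarrow> continuous_on S f"
  by (simp add: continuous_map_Euclidean_iff)

lemma Ck_on_Suc:
  "openin (Euclidean_space n) S \<Longrightarrow> Ck_on (Suc k) n S f \<longleftrightarrow> continuous_on S f \<and>
     (\<forall>i<n. (\<forall>x\<in>S. ((\<lambda>t. f (x(i := t))) has_real_derivative partial i f x) (at (x i))) \<and>
        Ck_on k n S (partial i f))"
  by (auto simp: continuous_map_Euclidean_iff partial_def DERIV_deriv_iff_real_differentiable)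

declare Ck_on.simps [simp del]

section \<open>Congruence, restriction and locality of smoothness\<close>

lemma Ck_on_cong:
  fixes f g :: "(nat \<Rightarrow> real) \<Rightarrow> real"
  assumes "openin (Euclidean_space n) S" "\<forall>y\<in>S. f y = g y"
  shows "Ck_on k n S f = Ck_on k n S g"
  using assms(2)
proof (induction k arbitrary: f g)
  case 0
  then show ?case
    unfolding Ck_on_0[OF assms(1)] by (intro continuous_on_cong) auto
next
  case (Suc k)
  have p: "partial i f x = partial i g x" if "i < n" "x \<in> S" for i x
    using partial_cong[OF assms(1) that(2,1) Suc.prems] .
  have "continuous_on S f = continuous_on S g"
    using Suc.prems by (intro continuous_on_cong) auto
  moreover have "Ck_on k n S (partial i f) = Ck_on k n S (partial i g)" if "i < n" for i
    by (rule Suc.IH) (use p that in auto)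
  moreover have "((\<lambda>t. f (x(i := t))) has_real_derivative partial i f x) (at (x i)) =
        ((\<lambda>t. g (x(i := t))) has_real_derivative partial i g x) (at (x i))" if "i < n" "x \<in> S" for i x
    unfolding p[OF that] by (rule DERIV_cong_on[OF assms(1) that(2,1) Suc.prems])
  ultimately show ?case
    unfolding Ck_on_Suc[OF assms(1)] by auto
qed

lemma Cinf_on_cong:
  fixes f g :: "(nat \<Rightarrow> real) \<Rightarrow> real"
  assumes "openin (Euclidean_space n) S" "\<forall>y\<in>S. f y = g y"
  shows "Cinf_on n S f = Cinf_on n S g"
  unfolding Cinf_on_def using Ck_on_cong[of n S f g] assms by blast

lemma Ck_on_subset:
  assumes "openin (Euclidean_space n) S" "openin (Euclidean_space n) T" "T \<subseteq> S"
  shows "Ck_on k n S f \<Longrightarrow> Ck_on k n T f"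
  by (induction k arbitrary: f)
     (use assms in \<open>auto simp: Ck_on_0 Ck_on_Suc intro: continuous_on_subset\<close>)

lemma Cinf_on_subset:
  "\<lbrakk>Cinf_on n S f; openin (Euclidean_space n) S; openin (Euclidean_space n) T; T \<subseteq> S\<rbrakk> \<Longrightarrow> Cinf_on n T f"
  unfolding Cinf_on_def using Ck_on_subset by blast

lemma continuous_on_open_locally:
  assumes "openin (Euclidean_space n) S"
    and "\<And>x. x \<in> S \<Longrightarrow> \<exists>T. openin (Euclidean_space n) T \<and> x \<in> T \<and> T \<subseteq> S \<and> continuous_on T f"
  shows "continuous_on S f"
  unfolding continuous_on_eq_continuous_within
proof
  fix x assume "x \<in> S"
  then obtain T where T: "openin (Euclidean_space n) T" "x \<in> T" "T \<subseteq> S" "continuous_on T f"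
    using assms(2) by blast
  then obtain W where W: "open W" "T = {x. \<forall>i\<ge>n. x i = 0} \<inter> W"
    by (auto simp: Euclidean_space_eq openin_open)
  have "S \<inter> W = T \<inter> W"
    using W T openin_Euclidean_zero[OF assms(1)] by auto
  then have "at x within S = at x within T"
    using W T by (intro at_within_nhd[of x W]) auto
  then show "continuous (at x within S) f"
    using T by (simp add: continuous_on_eq_continuous_within)
qed

lemma Ck_on_locally:
  assumes "openin (Euclidean_space n) S"
    and "\<And>x. x \<in> S \<Longrightarrow> \<exists>T. openin (Euclidean_space n) T \<and> x \<in> T \<and> T \<subseteq> S \<and> Ck_on k n T f"
  shows "Ck_on k n S f"
  using assms(2)
proof (induction k arbitrary: f)
  case 0
  then show ?case
    using Ck_on_0 continuous_on_open_locally[OF assms(1)] by (metis assms(1))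
next
  case (Suc k)
  have "continuous_on S f"
    by (rule continuous_on_open_locally[OF assms(1)]) (metis Suc.prems Ck_on_Suc)
  moreover have "((\<lambda>t. f (x(i := t))) has_real_derivative partial i f x) (at (x i))" if "i < n" "x \<in> S" for i x
    using Suc.prems[OF that(2)] that by (auto simp: Ck_on_Suc)
  moreover have "Ck_on k n S (partial i f)" if "i < n" for i
    by (rule Suc.IH) (metis Suc.prems Ck_on_Suc that)
  ultimately show ?case
    by (simp add: Ck_on_Suc assms(1))
qed

lemma Cinf_on_locally:
  assumes "openin (Euclidean_space n) S"
    and "\<And>x. x \<in> S \<Longrightarrow> \<exists>T. openin (Euclidean_space n) T \<and> x \<in> T \<and> T \<subseteq> S \<and> Cinf_on n T f"
  shows "Cinf_on n S f"
  unfolding Cinf_on_def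
proof
  fix k
  show "Ck_on k n S f"
    by (rule Ck_on_locally[OF assms(1)]) (metis assms(2) Cinf_on_def)
qed

lemma Cinf_on_continuous:
  assumes "Cinf_on n S f" "openin (Euclidean_space n) S"
  shows "continuous_on S f"
proof -
  have "Ck_on 0 n S f"
    using assms(1) by (simp add: Cinf_on_def)
  then show ?thesis
    by (simp add: Ck_on_0[OF assms(2)])
qed

lemma Cinf_on_has_partial:
  assumes "Cinf_on n S f" "openin (Euclidean_space n) S" "x \<in> S" "i < n"
  shows "((\<lambda>t. f (x(i := t))) has_real_derivative partial i f x) (at (x i))"
proof -
  have "Ck_on (Suc 0) n S f"
    using assms(1) unfolding Cinf_on_def by blast
  then show ?thesis
    unfolding Ck_on_Suc[OF assms(2)] using assms(3,4) by blast
qed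

lemma Cinf_on_partial:
  assumes "Cinf_on n S f" "openin (Euclidean_space n) S" "i < n"
  shows "Cinf_on n S (partial i f)"
  unfolding Cinf_on_def
proof
  fix k
  have "Ck_on (Suc k) n S f"
    using assms(1) unfolding Cinf_on_def by blast
  then show "Ck_on k n S (partial i f)"
    unfolding Ck_on_Suc[OF assms(2)] using assms(3) by blast
qed

subsection \<open>Algebras of functions closed under partial derivatives\<close>

text \<open>The real algebra generated by the functions satisfying \<open>P\<close>. Derivatives are
  thereby allowed to be polynomials in the generators, so the generators themselves need not be
  closed under differentiation.\<close>

inductive alg :: "(('a \<Rightarrow> real) \<Rightarrow> bool) \<Rightarrow> ('a \<Rightarrow> real) \<Rightarrow> bool" for P where
  alg_base: "P f \<Longrightarrow> alg P f"
| alg_const: "alg P (\<lambda>_. c)"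
| alg_add: "alg P f \<Longrightarrow> alg P g \<Longrightarrow> alg P (\<lambda>x. f x + g x)"
| alg_mult: "alg P f \<Longrightarrow> alg P g \<Longrightarrow> alg P (\<lambda>x. f x * g x)"

lemma alg_sum: "(\<And>i. i \<in> I \<Longrightarrow> alg P (f i)) \<Longrightarrow> alg P (\<lambda>x. \<Sum>i\<in>I. f i x)"
  by (induction I rule: infinite_finite_induct) (auto intro: alg.intros)

text \<open>Smoothness by coinduction: no bound on the order of differentiation has to be tracked.\<close>

lemma Cinf_on_alg:
  assumes S: "openin (Euclidean_space n) S"
    and P: "\<And>f. P f \<Longrightarrow> continuous_on S f"
      "\<And>f i. P f \<Longrightarrow> i < n \<Longrightarrow> \<exists>g. alg P g \<and>
        (\<forall>x\<in>S. ((\<lambda>t. f (x(i := t))) has_real_derivative g x) (at (x i)))"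
    and "alg P f"
  shows "Cinf_on n S f"
proof -
  \<comment> \<open>The coinduction invariant: members of the algebra are continuous on
    \<open>S\<close>, and their partial derivatives agree on \<open>S\<close> with members again.
    Products are handled by the Leibniz rule.\<close>
  have closed: "continuous_on S f \<and> (\<forall>i<n. \<exists>g. alg P g \<and>
        (\<forall>x\<in>S. ((\<lambda>t. f (x(i := t))) has_real_derivative g x) (at (x i))))" if "alg P f" for f
    using that
  proof induction
    case (alg_base f)
    then show ?case using P by blast
  next
    case (alg_const c)
    then show ?case by (auto intro!: exI[of _ "\<lambda>_. 0"] alg.alg_const)
  next
    case (alg_add f g)
    have "\<exists>h. alg P h \<and> (\<forall>x\<in>S. ((\<lambda>t. f (x(i := t)) + g (x(i := t))) has_real_derivative h x) (at (x i)))"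
      if "i < n" for i
    proof -
      obtain f' g' where "alg P f'" "alg P g'"
        "\<forall>x\<in>S. ((\<lambda>t. f (x(i := t))) has_real_derivative f' x) (at (x i))"
        "\<forall>x\<in>S. ((\<lambda>t. g (x(i := t))) has_real_derivative g' x) (at (x i))"
        using alg_add.IH \<open>i < n\<close> by blast
      then show ?thesis
        by (intro exI[of _ "\<lambda>x. f' x + g' x"]) (auto intro: alg.intros DERIV_add)
    qed
    moreover have "continuous_on S (\<lambda>x. f x + g x)"
      using alg_add.IH by (intro continuous_on_add) blast+
    ultimately show ?case by blast
  next
    case (alg_mult f g)
    have "\<exists>h. alg P h \<and> (\<forall>x\<in>S. ((\<lambda>t. f (x(i := t)) * g (x(i := t))) has_real_derivative h x) (at (x i)))"
      if "i < n" for i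
    proof -
      obtain f' g' where fg: "alg P f'" "alg P g'"
        "\<forall>x\<in>S. ((\<lambda>t. f (x(i := t))) has_real_derivative f' x) (at (x i))"
        "\<forall>x\<in>S. ((\<lambda>t. g (x(i := t))) has_real_derivative g' x) (at (x i))"
        using alg_mult.IH \<open>i < n\<close> by blast
      have "((\<lambda>t. f (x(i := t)) * g (x(i := t))) has_real_derivative f' x * g x + g' x * f x) (at (x i))"
        if "x \<in> S" for x
        using DERIV_mult[OF fg(3)[rule_format, OF that] fg(4)[rule_format, OF that]] by simp
      then show ?thesis
        using fg alg_mult.hyps by (intro exI[of _ "\<lambda>x. f' x * g x + g' x * f x"]) (auto intro: alg.intros)
    qed
    moreover have "continuous_on S (\<lambda>x. f x * g x)"
      using alg_mult.IH by (intro continuous_on_mult) blast+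
    ultimately show ?case by blast
  qed
  have "Ck_on k n S f" if "alg P f" for k f
    using that
  proof (induction k arbitrary: f)
    case 0
    then show ?case using closed by (simp add: Ck_on_0 S)
  next
    case (Suc k)
    show ?case
      unfolding Ck_on_Suc[OF S]
    proof (intro conjI allI impI)
      show "continuous_on S f" using closed Suc.prems by blast
      fix i assume "i < n"
      then obtain g where g: "alg P g" "\<forall>x\<in>S. ((\<lambda>t. f (x(i := t))) has_real_derivative g x) (at (x i))"
        using closed Suc.prems by blast
      then have eq: "\<forall>x\<in>S. partial i f x = g x"
        by (simp add: partialI)
      show "\<forall>x\<in>S. ((\<lambda>t. f (x(i := t))) has_real_derivative partial i f x) (at (x i))"
        using g eq by simp
      show "Ck_on k n S (partial i f)"
        using Suc.IH[OF g(1)] Ck_on_cong[OF S eq] by blast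
    qed
  qed
  then show ?thesis using \<open>alg P f\<close> by (simp add: Cinf_on_def)
qed

text \<open>With all functions smooth on \<open>S\<close> as generators the algebra contains nothing
  new, which yields closure under constants, sums and products at once.\<close>

lemma Cinf_on_alg_Cinf:
  assumes "openin (Euclidean_space n) S" "alg (Cinf_on n S) f"
  shows "Cinf_on n S f"
  by (rule Cinf_on_alg[OF assms(1) _ _ assms(2)])
     (use assms(1) in \<open>auto intro: Cinf_on_continuous Cinf_on_has_partial alg_base Cinf_on_partial\<close>)

lemma Cinf_on_const: "openin (Euclidean_space n) S \<Longrightarrow> Cinf_on n S (\<lambda>_. c)"
  by (rule Cinf_on_alg_Cinf) (auto intro: alg.intros)

lemma Cinf_on_add:
  "\<lbrakk>openin (Euclidean_space n) S; Cinf_on n S f; Cinf_on n S g\<rbrakk> \<Longrightarrow> Cinf_on n S (\<lambda>x. f x + g x)"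
  by (rule Cinf_on_alg_Cinf) (auto intro: alg.intros)

lemma Cinf_on_mult:
  "\<lbrakk>openin (Euclidean_space n) S; Cinf_on n S f; Cinf_on n S g\<rbrakk> \<Longrightarrow> Cinf_on n S (\<lambda>x. f x * g x)"
  by (rule Cinf_on_alg_Cinf) (auto intro: alg.intros)

lemma Cinf_on_sum:
  "\<lbrakk>openin (Euclidean_space n) S; \<And>i. i \<in> I \<Longrightarrow> Cinf_on n S (f i)\<rbrakk> \<Longrightarrow> Cinf_on n S (\<lambda>x. \<Sum>i\<in>I. f i x)"
  by (rule Cinf_on_alg_Cinf) (auto intro: alg.intros alg_sum)

lemma DERIV_coord: "((\<lambda>t. (x(i := t)) j) has_real_derivative (if i = j then 1 else 0)) (at (x i))"
  by (auto intro: DERIV_ident)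

lemma partial_coord: "partial i (\<lambda>x. x j) x = (if i = j then 1 else 0)"
  by (rule partialI[OF DERIV_coord])

lemma Cinf_on_coord: "openin (Euclidean_space n) S \<Longrightarrow> Cinf_on n S (\<lambda>x. x j)"
proof (rule Cinf_on_alg[where P="\<lambda>f. f = (\<lambda>x. x j)"])
  fix f i assume "f = (\<lambda>x::nat \<Rightarrow> real. x j)"
  then show "\<exists>g. alg (\<lambda>f. f = (\<lambda>x. x j)) g \<and>
        (\<forall>x\<in>S. ((\<lambda>t. f (x(i := t))) has_real_derivative g x) (at (x i)))"
    using DERIV_coord by (intro exI[of _ "\<lambda>_. if i = j then 1 else 0"]) (auto intro: alg_const)
qed (auto intro: alg_base continuous_on_subset[OF continuous_on_product_coordinates])

subsection \<open>The chain rule\<close>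

text \<open>The ends may lie in either order or coincide, because the coordinate legs along which it
  is applied have displacements of unknown sign.\<close>

lemma mvt_segment:
  fixes g :: "real \<Rightarrow> real"
  assumes "\<And>s. s \<in> closed_segment u v \<Longrightarrow> (g has_real_derivative g' s) (at s)"
  obtains s where "s \<in> closed_segment u v" "g v - g u = g' s * (v - u)"
proof -
  consider "u < v" | "u = v" | "v < u" by linarith
  then show thesis
  proof cases
    case 1
    then obtain s where "u < s" "s < v" "g v - g u = (v - u) * g' s"
      using MVT2[of u v g g'] assms by (auto simp: closed_segment_eq_real_ivl)
    then show thesis using that[of s] 1 by (auto simp: closed_segment_eq_real_ivl)
  next
    case 2
    then show thesis using that[of u] by auto
  next
    case 3
    then obtain s where "v < s" "s < u" "g u - g v = (u - v) * g' s"
      using MVT2[of v u g g'] assms by (auto simp: closed_segment_eq_real_ivl)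
    then show thesis using that[of s] 3 by (auto simp: closed_segment_eq_real_ivl algebra_simps)
  qed
qed

text \<open>Go from \<open>a\<close> to \<open>y\<close> by changing one coordinate at a time and
  apply the mean value theorem on each leg. Every intermediate point has each coordinate between
  those of \<open>a\<close> and \<open>y\<close>, so it stays in the box, and it tends to
  \<open>a\<close> with \<open>y\<close>.\<close>

lemma mvt_obox:
  assumes der: "\<And>x i. x \<in> obox n a r \<Longrightarrow> i < n \<Longrightarrow>
      ((\<lambda>t. f (x(i := t))) has_real_derivative partial i f x) (at (x i))"
    and a: "\<And>i. i \<ge> n \<Longrightarrow> a i = 0" and y: "y \<in> obox n a r"
  obtains \<xi> where "\<And>j i. \<bar>\<xi> j i - a i\<bar> \<le> \<bar>y i - a i\<bar>"
    "f y - f a = (\<Sum>j<n. partial j f (\<xi> j) * (y j - a j))"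
proof -
  \<comment> \<open>\<open>h k\<close> is the corner that has already taken over the first
    \<open>k\<close> coordinates of \<open>y\<close>; thus \<open>h 0\<close> is \<open>a\<close>
    and \<open>h n\<close> is \<open>y\<close>.\<close>
  define h where "h k = (\<lambda>i. if i < k then y i else a i)" for k :: nat
  have hull: "x \<in> obox n a r" if "\<And>i. \<bar>x i - a i\<bar> \<le> \<bar>y i - a i\<bar>" for x
    unfolding obox_def
  proof (safe)
    fix i assume "i < n"
    then have "\<bar>y i - a i\<bar> < r" using y by (simp add: obox_def)
    then show "\<bar>x i - a i\<bar> < r" using that[of i] by linarith
  next
    fix i assume "i \<ge> n"
    then have "y i = 0" "a i = 0" using y a by (simp_all add: obox_def)
    then show "x i = 0" using that[of i] by simp
  qed
  have "\<exists>z. (\<forall>i. \<bar>z i - a i\<bar> \<le> \<bar>y i - a i\<bar>) \<and> f (h (Suc j)) - f (h j) = partial j f z * (y j - a j)"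
    if "j < n" for j
  proof -
    have seg: "\<bar>((h j)(j := s)) i - a i\<bar> \<le> \<bar>y i - a i\<bar>" if "s \<in> closed_segment (a j) (y j)" for s i
      using that by (auto simp: h_def closed_segment_eq_real_ivl split: if_splits)
    have "((\<lambda>t. f ((h j)(j := t))) has_real_derivative partial j f ((h j)(j := s))) (at s)"
      if "s \<in> closed_segment (a j) (y j)" for s
      using der[OF hull[OF seg[OF that]] \<open>j < n\<close>] by (simp add: fun_upd_upd[unfolded fun_upd_def] fun_upd_def)
    then obtain s where s: "s \<in> closed_segment (a j) (y j)"
      "f ((h j)(j := y j)) - f ((h j)(j := a j)) = partial j f ((h j)(j := s)) * (y j - a j)"
      by (rule mvt_segment)
    have "(h j)(j := y j) = h (Suc j)" "(h j)(j := a j) = h j"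
      by (auto simp: h_def fun_eq_iff)
    then have "f (h (Suc j)) - f (h j) = partial j f ((h j)(j := s)) * (y j - a j)"
      using s(2) by metis
    with seg[OF s(1)] show ?thesis by blast
  qed
  then obtain \<xi> where \<xi>: "\<And>j. j < n \<Longrightarrow> (\<forall>i. \<bar>\<xi> j i - a i\<bar> \<le> \<bar>y i - a i\<bar>) \<and>
      f (h (Suc j)) - f (h j) = partial j f (\<xi> j) * (y j - a j)"
    by metis
  have "h n = y" using y by (intro ext) (simp add: h_def obox_def a)
  moreover have "h 0 = a" by (simp add: h_def)
  ultimately have "f y - f a = (\<Sum>j<n. f (h (Suc j)) - f (h j))"
    by (simp add: sum_lessThan_telescope[of "\<lambda>k. f (h k)"])
  also have "\<dots> = (\<Sum>j<n. partial j f (if j < n then \<xi> j else a) * (y j - a j))"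
    using \<xi> by (intro sum.cong) auto
  finally show thesis
    using \<xi> by (intro that[of "\<lambda>j. if j < n then \<xi> j else a"]) auto
qed

text \<open>The increments of \<open>mvt_obox\<close> are divided by \<open>t - t0\<close>. The
  intermediate points are squeezed to \<open>\<gamma> t0\<close>, and continuity of the partial
  derivatives gives the limit.\<close>

lemma chain_rule_curve:
  assumes S: "openin (Euclidean_space n) S" and f: "Cinf_on n S f" and "\<gamma> t0 \<in> S"
    and \<gamma>: "\<And>j. j < n \<Longrightarrow> ((\<lambda>t. \<gamma> t j) has_real_derivative D j) (at t0)"
    and 0: "\<forall>\<^sub>F t in at t0. \<forall>j\<ge>n. \<gamma> t j = 0"
  shows "((\<lambda>t. f (\<gamma> t)) has_real_derivative (\<Sum>j<n. partial j f (\<gamma> t0) * D j)) (at t0)"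
proof -
  let ?a = "\<gamma> t0"
  obtain r where r: "r > 0" "obox n ?a r \<subseteq> S"
    using obox_subset[OF S \<open>?a \<in> S\<close>] .
  have a0: "?a i = 0" if "i \<ge> n" for i
    using openin_Euclidean_zero[OF S \<open>?a \<in> S\<close> that] .
  have lim: "((\<lambda>t. \<gamma> t i) \<longlongrightarrow> ?a i) (at t0)" for i
  proof (cases "i < n")
    case True
    then show ?thesis using DERIV_isCont[OF \<gamma>[OF True]] by (simp add: isCont_def)
  next
    case False
    then have "\<forall>\<^sub>F t in at t0. \<gamma> t i = ?a i"
      using 0 a0 by (auto elim: eventually_mono)
    then show ?thesis by (rule tendsto_eventually)
  qed
  have ev: "\<forall>\<^sub>F t in at t0. \<gamma> t \<in> obox n ?a r"
  proof -
    have "\<forall>\<^sub>F t in at t0. \<forall>i\<in>{..<n}. \<bar>\<gamma> t i - ?a i\<bar> < r"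
      using tendstoD[OF lim r(1)] by (intro eventually_ball_finite) (auto simp: dist_real_def)
    then show ?thesis using 0 by eventually_elim (auto simp: obox_def)
  qed
  have ex: "\<exists>\<xi>. (\<forall>j i. \<bar>\<xi> j i - ?a i\<bar> \<le> \<bar>\<gamma> t i - ?a i\<bar>) \<and>
     f (\<gamma> t) - f ?a = (\<Sum>j<n. partial j f (\<xi> j) * (\<gamma> t j - ?a j))" if "\<gamma> t \<in> obox n ?a r" for t
    by (rule mvt_obox[of n ?a r f "\<gamma> t"])
       (use that r a0 Cinf_on_has_partial[OF f S] in \<open>auto simp: subset_iff\<close>)
  \<comment> \<open>When \<open>\<gamma> t\<close> is outside the box the default is
    \<open>\<gamma> t0\<close> itself, so the bound on \<open>\<xi>\<close> and its membership in
    \<open>S\<close> hold for every \<open>t\<close> and not merely near \<open>t0\<close>.\<close>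
  define \<xi> where "\<xi> t = (if \<gamma> t \<in> obox n ?a r then SOME \<xi>. (\<forall>j i. \<bar>\<xi> j i - ?a i\<bar> \<le> \<bar>\<gamma> t i - ?a i\<bar>) \<and>
     f (\<gamma> t) - f ?a = (\<Sum>j<n. partial j f (\<xi> j) * (\<gamma> t j - ?a j)) else (\<lambda>_. ?a))" for t
  have \<xi>: "\<bar>\<xi> t j i - ?a i\<bar> \<le> \<bar>\<gamma> t i - ?a i\<bar>" for t j i
    using someI_ex[OF ex, of t] by (auto simp: \<xi>_def)
  have \<xi>_eq: "f (\<gamma> t) - f ?a = (\<Sum>j<n. partial j f (\<xi> t j) * (\<gamma> t j - ?a j))" if "\<gamma> t \<in> obox n ?a r" for t
    using someI_ex[OF ex, of t] that by (auto simp: \<xi>_def)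
  have \<xi>S: "\<xi> t j \<in> S" for t j
  proof (cases "\<gamma> t \<in> obox n ?a r")
    case True
    have "\<xi> t j \<in> obox n ?a r"
      unfolding obox_def
    proof safe
      fix i assume "i < n"
      then have "\<bar>\<gamma> t i - ?a i\<bar> < r" using True by (simp add: obox_def)
      then show "\<bar>\<xi> t j i - ?a i\<bar> < r" using \<xi>[of t j i] by linarith
    next
      fix i assume "i \<ge> n"
      then have "\<gamma> t i = 0" "?a i = 0" using True a0 by (simp_all add: obox_def)
      then show "\<xi> t j i = 0" using \<xi>[of t j i] by simp
    qed
    then show ?thesis using r by blast
  next
    case False
    then show ?thesis using \<open>?a \<in> S\<close> by (simp add: \<xi>_def)
  qed
  have \<xi>_lim: "((\<lambda>t. \<xi> t j) \<longlongrightarrow> ?a) (at t0)" for j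
  proof (rule tendsto_funI)
    fix i
    have "((\<lambda>t. \<bar>\<gamma> t i - ?a i\<bar>) \<longlongrightarrow> 0) (at t0)"
      using lim[of i] by (simp add: LIM_zero_iff tendsto_rabs_zero_iff)
    then have "((\<lambda>t. \<xi> t j i - ?a i) \<longlongrightarrow> 0) (at t0)"
      by (rule Lim_null_comparison[rotated]) (use \<xi> in auto)
    then show "((\<lambda>t. \<xi> t j i) \<longlongrightarrow> ?a i) (at t0)"
      by (rule LIM_zero_cancel)
  qed
  have "((\<lambda>t. \<Sum>j<n. partial j f (\<xi> t j) * ((\<gamma> t j - ?a j) / (t - t0))) \<longlongrightarrow>
      (\<Sum>j<n. partial j f ?a * D j)) (at t0)"
  proof (intro tendsto_sum tendsto_mult)
    fix j assume "j \<in> {..<n}"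
    then have j: "j < n" by simp
    have "continuous_on S (partial j f)"
      using Cinf_on_continuous[OF Cinf_on_partial[OF f S j] S] .
    then show "((\<lambda>t. partial j f (\<xi> t j)) \<longlongrightarrow> partial j f ?a) (at t0)"
      by (rule continuous_on_tendsto_compose[OF _ \<xi>_lim \<open>?a \<in> S\<close>]) (simp add: \<xi>S)
    show "((\<lambda>t. (\<gamma> t j - ?a j) / (t - t0)) \<longlongrightarrow> D j) (at t0)"
      using \<gamma>[OF j] by (simp add: has_field_derivative_iff)
  qed
  moreover have "\<forall>\<^sub>F t in at t0. (\<Sum>j<n. partial j f (\<xi> t j) * ((\<gamma> t j - ?a j) / (t - t0))) =
      (f (\<gamma> t) - f ?a) / (t - t0)"
    using ev by eventually_elim (simp add: \<xi>_eq sum_divide_distrib)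
  ultimately show ?thesis
    unfolding has_field_derivative_iff by (rule Lim_transform_eventually)
qed

lemma Cinf_on_compose_deriv:
  assumes S: "openin (Euclidean_space n) S" and T: "openin (Euclidean_space m) T"
    and F: "Cinf_on m T F" and G: "\<And>j. j < m \<Longrightarrow> Cinf_on n S (\<lambda>x. G x j)" and GS: "\<And>x. x \<in> S \<Longrightarrow> G x \<in> T"
    and "x \<in> S" "i < n"
  shows "((\<lambda>t. F (G (x(i := t)))) has_real_derivative
           (\<Sum>j<m. partial j F (G x) * partial i (\<lambda>x. G x j) x)) (at (x i))"
proof -
  have "\<forall>\<^sub>F t in at (x i). x(i := t) \<in> S"
    using eventually_fun_upd_in[OF S \<open>x \<in> S\<close> \<open>i < n\<close>] by (simp add: eventually_at_filter eventually_mono)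
  then have "\<forall>\<^sub>F t in at (x i). \<forall>j\<ge>m. G (x(i := t)) j = 0"
    by (rule eventually_mono) (use GS openin_Euclidean_zero[OF T] in blast)
  then show ?thesis
    using chain_rule_curve[OF T F, of "\<lambda>t. G (x(i := t))" "x i" "\<lambda>j. partial i (\<lambda>x. G x j) x"]
      GS \<open>x \<in> S\<close> Cinf_on_has_partial[OF G S \<open>x \<in> S\<close> \<open>i < n\<close>] by simp
qed

lemma partial_compose:
  assumes "openin (Euclidean_space n) S" "openin (Euclidean_space m) T"
    and "Cinf_on m T F" "\<And>j. j < m \<Longrightarrow> Cinf_on n S (\<lambda>x. G x j)" "\<And>x. x \<in> S \<Longrightarrow> G x \<in> T"
    and "x \<in> S" "i < n"
  shows "partial i (\<lambda>x. F (G x)) x = (\<Sum>j<m. partial j F (G x) * partial i (\<lambda>x. G x j) x)"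
  using partialI[OF Cinf_on_compose_deriv[OF assms]] .

lemma continuous_on_into_Euclidean:
  fixes G :: "(nat \<Rightarrow> real) \<Rightarrow> nat \<Rightarrow> real"
  assumes S: "openin (Euclidean_space n) S" and T: "openin (Euclidean_space m) T"
    and G: "\<And>j. j < m \<Longrightarrow> Cinf_on n S (\<lambda>x. G x j)" and GS: "\<And>x. x \<in> S \<Longrightarrow> G x \<in> T"
  shows "continuous_on S G"
proof (rule continuous_on_coordinatewise_then_product)
  fix j
  show "continuous_on S (\<lambda>x. G x j)"
  proof (cases "j < m")
    case True
    then show ?thesis using Cinf_on_continuous[OF G S] by blast
  next
    case False
    then have "\<And>x. x \<in> S \<Longrightarrow> G x j = 0" using GS openin_Euclidean_zero[OF T] by (meson not_less)
    then show ?thesis by (simp cong: continuous_on_cong)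
  qed
qed

text \<open>The generators are the smooth functions on \<open>S\<close> together with all pullbacks
  along \<open>G\<close>: by the chain rule a derivative of a pullback is a sum of products of
  pullbacks and smooth functions.\<close>

lemma Cinf_on_compose:
  assumes S: "openin (Euclidean_space n) S" and T: "openin (Euclidean_space m) T"
    and "Cinf_on m T F" and G: "\<And>j. j < m \<Longrightarrow> Cinf_on n S (\<lambda>x. G x j)" and GS: "\<And>x. x \<in> S \<Longrightarrow> G x \<in> T"
  shows "Cinf_on n S (\<lambda>x. F (G x))"
proof (rule Cinf_on_alg[where P="\<lambda>f. Cinf_on n S f \<or> (\<exists>F. Cinf_on m T F \<and> f = (\<lambda>x. F (G x)))"])
  let ?P = "\<lambda>f. Cinf_on n S f \<or> (\<exists>F. Cinf_on m T F \<and> f = (\<lambda>x. F (G x)))"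
  show "alg ?P (\<lambda>x. F (G x))"
    using assms by (intro alg_base) blast
  show "continuous_on S f" if "?P f" for f
    using that continuous_on_compose2[OF _ continuous_on_into_Euclidean[OF S T G GS]] GS S T
    by (metis Cinf_on_continuous image_subsetI)
  show "\<exists>g. alg ?P g \<and> (\<forall>x\<in>S. ((\<lambda>t. f (x(i := t))) has_real_derivative g x) (at (x i)))"
    if "?P f" "i < n" for f i
    using that(1)
  proof
    assume "Cinf_on n S f"
    then show ?thesis
      using S \<open>i < n\<close> by (intro exI[of _ "partial i f"])
         (auto intro!: alg_base Cinf_on_partial Cinf_on_has_partial)
  next
    assume "\<exists>F. Cinf_on m T F \<and> f = (\<lambda>x. F (G x))"
    then obtain F where F: "Cinf_on m T F" "f = (\<lambda>x. F (G x))" by blast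
    have "alg ?P (\<lambda>x. partial j F (G x))" if "j < m" for j
      using Cinf_on_partial[OF F(1) T that] by (intro alg_base) blast
    moreover have "alg ?P (partial i (\<lambda>x. G x j))" if "j < m" for j
      using Cinf_on_partial[OF G[OF that] S \<open>i < n\<close>] by (intro alg_base) blast
    ultimately show ?thesis
      using Cinf_on_compose_deriv[OF S T F(1) G GS _ \<open>i < n\<close>] F(2)
      by (intro exI[of _ "\<lambda>x. \<Sum>j<m. partial j F (G x) * partial i (\<lambda>x. G x j) x"])
         (auto intro!: alg_sum alg_mult)
  qed
qed (use S in auto)

subsection \<open>Mixed partial derivatives\<close>

text \<open>The second difference of \<open>f\<close> over a square of side \<open>s\<close> is an
  increment of an increment: the mean value theorem in the \<open>i\<close>th coordinate and then in
  the \<open>j\<close>th turns it into one mixed derivative. The second difference itself is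
  symmetric in \<open>i\<close> and \<open>j\<close>.\<close>

lemma mixed_difference:
  assumes S: "openin (Euclidean_space n) S" and f: "Cinf_on n S f" and ij: "i < n" "j < n" "i \<noteq> j"
    and r: "obox n x r \<subseteq> S" "0 < s" "s < r" and x0: "\<And>k. k \<ge> n \<Longrightarrow> x k = 0"
  obtains \<xi> where "\<xi> \<in> S" "\<And>k. \<bar>\<xi> k - x k\<bar> \<le> s"
    "f (x(i := x i + s, j := x j + s)) - f (x(i := x i + s)) - f (x(j := x j + s)) + f x
       = s * s * partial j (partial i f) \<xi>"
proof -
  have inS: "x(i := u, j := v) \<in> S" if "x i \<le> u" "u \<le> x i + s" "x j \<le> v" "v \<le> x j + s" for u v
    using that r ij x0 by (intro subsetD[OF r(1)]) (auto simp: obox_def)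
  have der: "((\<lambda>t. f (x(j := v, i := t))) has_real_derivative partial i f (x(i := u, j := v))) (at u)"
    if "x i \<le> u" "u \<le> x i + s" "x j \<le> v" "v \<le> x j + s" for u v
    using Cinf_on_has_partial[OF f S inS[OF that] \<open>i < n\<close>] ij(3)
    by (simp add: fun_upd_twist[of i j])
  \<comment> \<open>The increment of \<open>f\<close> across the square in direction
    \<open>j\<close>, as a function of the \<open>i\<close>th coordinate. The redundant update
    \<open>j := x j\<close> gives both terms the shape of \<open>der\<close>.\<close>
  let ?\<phi> = "\<lambda>t. f (x(j := x j + s, i := t)) - f (x(j := x j, i := t))"
  have "((?\<phi>) has_real_derivative partial i f (x(i := u, j := x j + s)) - partial i f (x(i := u, j := x j))) (at u)"
    if "x i \<le> u" "u \<le> x i + s" for u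
    using that r(2) by (intro DERIV_diff der) auto
  then obtain u where u: "x i < u" "u < x i + s"
    "?\<phi> (x i + s) - ?\<phi> (x i) = s * (partial i f (x(i := u, j := x j + s)) - partial i f (x(i := u, j := x j)))"
    using MVT2[of "x i" "x i + s" ?\<phi>
        "\<lambda>u. partial i f (x(i := u, j := x j + s)) - partial i f (x(i := u, j := x j))"] r(2) by auto
  have "((\<lambda>t. partial i f (x(i := u, j := t))) has_real_derivative
      partial j (partial i f) (x(i := u, j := v))) (at v)" if "x j \<le> v" "v \<le> x j + s" for v
    using Cinf_on_has_partial[OF Cinf_on_partial[OF f S \<open>i < n\<close>] S inS \<open>j < n\<close>, of u v] that u by simp
  then obtain v where v: "x j < v" "v < x j + s"
    "partial i f (x(i := u, j := x j + s)) - partial i f (x(i := u, j := x j)) =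
       s * partial j (partial i f) (x(i := u, j := v))"
    using MVT2[of "x j" "x j + s" "\<lambda>t. partial i f (x(i := u, j := t))"
        "\<lambda>v. partial j (partial i f) (x(i := u, j := v))"] r(2) by auto
  show thesis
  proof (rule that)
    show "x(i := u, j := v) \<in> S" using inS u v by simp
    show "\<bar>(x(i := u, j := v)) k - x k\<bar> \<le> s" for k using u v r(2) by auto
    have "f (x(i := x i + s, j := x j + s)) - f (x(i := x i + s)) - f (x(j := x j + s)) + f x =
        ?\<phi> (x i + s) - ?\<phi> (x i)"
      using ij(3) by (simp add: fun_upd_twist[of i j] fun_upd_idem)
    then show "f (x(i := x i + s, j := x j + s)) - f (x(i := x i + s)) - f (x(j := x j + s)) + f x
       = s * s * partial j (partial i f) (x(i := u, j := v))"
      using u(3) v(3) by simp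
  qed
qed

text \<open>Both orders of differentiation represent the same second difference, up to the choice of
  an intermediate point in a shrinking square; continuity of the second derivatives identifies the
  limits.\<close>

lemma partial_commute:
  assumes S: "openin (Euclidean_space n) S" and f: "Cinf_on n S f" and x: "x \<in> S" and ij: "i < n" "j < n"
  shows "partial i (partial j f) x = partial j (partial i f) x"
proof (cases "i = j")
  case False
  obtain r where r: "r > 0" "obox n x r \<subseteq> S"
    using obox_subset[OF S x] .
  have x0: "\<And>k. k \<ge> n \<Longrightarrow> x k = 0"
    using openin_Euclidean_zero[OF S x] .
  \<comment> \<open>With \<open>m + 2\<close> rather than \<open>m + 1\<close> the strict bound
    \<open>s m < r\<close> holds already at \<open>m = 0\<close>.\<close>
  define s where "s m = r / real (m + 2)" for m
  have s: "0 < s m" "s m < r" for m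
    using r(1) by (auto simp: s_def field_simps add_pos_nonneg)
  have s_lim: "s \<longlonglongrightarrow> 0"
  proof -
    have "(\<lambda>m. r / real m) \<longlonglongrightarrow> 0"
      by (rule lim_const_over_n)
    from LIMSEQ_ignore_initial_segment[OF this, of 2] show ?thesis
      by (simp add: s_def[abs_def])
  qed
  have "\<exists>\<xi> \<eta>. \<xi> \<in> S \<and> \<eta> \<in> S \<and> (\<forall>k. \<bar>\<xi> k - x k\<bar> \<le> s m) \<and> (\<forall>k. \<bar>\<eta> k - x k\<bar> \<le> s m) \<and>
      partial j (partial i f) \<xi> = partial i (partial j f) \<eta>" for m
  proof -
    obtain \<xi> where \<xi>: "\<xi> \<in> S" "\<And>k. \<bar>\<xi> k - x k\<bar> \<le> s m"
      "f (x(i := x i + s m, j := x j + s m)) - f (x(i := x i + s m)) - f (x(j := x j + s m)) + f x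
       = s m * s m * partial j (partial i f) \<xi>"
      using mixed_difference[OF S f ij False r(2) s x0] by metis
    obtain \<eta> where \<eta>: "\<eta> \<in> S" "\<And>k. \<bar>\<eta> k - x k\<bar> \<le> s m"
      "f (x(j := x j + s m, i := x i + s m)) - f (x(j := x j + s m)) - f (x(i := x i + s m)) + f x
       = s m * s m * partial i (partial j f) \<eta>"
      using mixed_difference[OF S f ij(2,1) False[symmetric] r(2) s x0] by metis
    have "s m * s m * partial j (partial i f) \<xi> = s m * s m * partial i (partial j f) \<eta>"
      using \<xi>(3) \<eta>(3) unfolding fun_upd_twist[OF False, of x "x i + s m" "x j + s m"] by linarith
    then have "partial j (partial i f) \<xi> = partial i (partial j f) \<eta>"
      using s(1)[of m] by simp
    then show ?thesis using \<xi> \<eta> by blast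
  qed
  then obtain \<xi> \<eta> where \<xi>: "\<And>m. \<xi> m \<in> S" "\<And>m k. \<bar>\<xi> m k - x k\<bar> \<le> s m"
    and \<eta>: "\<And>m. \<eta> m \<in> S" "\<And>m k. \<bar>\<eta> m k - x k\<bar> \<le> s m"
    and eq: "\<And>m. partial j (partial i f) (\<xi> m) = partial i (partial j f) (\<eta> m)"
    by metis
  have lim: "z \<longlonglongrightarrow> x" if "\<And>m k. \<bar>z m k - x k\<bar> \<le> s m" for z
  proof (rule tendsto_funI)
    fix k
    have "(\<lambda>m. z m k - x k) \<longlonglongrightarrow> 0"
      by (rule Lim_null_comparison[OF _ s_lim]) (use that in auto)
    then show "(\<lambda>m. z m k) \<longlonglongrightarrow> x k"
      by (rule LIM_zero_cancel)
  qed
  have "(\<lambda>m. partial j (partial i f) (\<xi> m)) \<longlonglongrightarrow> partial j (partial i f) x"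
    by (rule continuous_on_tendsto_compose[OF Cinf_on_continuous[OF Cinf_on_partial[OF Cinf_on_partial[OF f S] S] S]])
       (use \<xi> lim x ij in auto)
  moreover have "(\<lambda>m. partial i (partial j f) (\<eta> m)) \<longlonglongrightarrow> partial i (partial j f) x"
    by (rule continuous_on_tendsto_compose[OF Cinf_on_continuous[OF Cinf_on_partial[OF Cinf_on_partial[OF f S] S] S]])
       (use \<eta> lim x ij in auto)
  ultimately show ?thesis
    unfolding eq by (rule LIMSEQ_unique[rotated])
qed simp

subsection \<open>Hadamard's lemma\<close>

text \<open>The exponent \<open>m\<close> is carried along because differentiation under the
  integral brings out a factor \<open>t\<close>: the partial derivatives of a ray integral are ray
  integrals with exponent \<open>Suc m\<close>.\<close>

definition ray_integral :: "(nat \<Rightarrow> real) \<Rightarrow> ((nat \<Rightarrow> real) \<Rightarrow> real) \<Rightarrow> nat \<Rightarrow> (nat \<Rightarrow> real) \<Rightarrow> real" where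
  "ray_integral a f m y = integral (cbox 0 1) (\<lambda>t. t ^ m * f (\<lambda>i. a i + t * (y i - a i)))"

lemma ray_in_obox:
  assumes "y \<in> obox n a r" "\<And>i. i \<ge> n \<Longrightarrow> a i = 0" "0 \<le> t" "t \<le> (1::real)"
  shows "(\<lambda>i. a i + t * (y i - a i)) \<in> obox n a r"
proof -
  have "\<bar>t * (y i - a i)\<bar> < r" if "i < n" for i
  proof -
    have "\<bar>t * (y i - a i)\<bar> \<le> 1 * \<bar>y i - a i\<bar>"
      unfolding abs_mult using assms by (intro mult_right_mono) auto
    also have "\<dots> < r" using assms(1) that by (simp add: obox_def)
    finally show ?thesis .
  qed
  then show ?thesis using assms by (auto simp: obox_def)
qed

lemma continuous_on_ray:
  assumes f: "continuous_on (obox n a r) f" and a: "\<And>i. i \<ge> n \<Longrightarrow> a i = 0"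
    and y: "continuous_on T y" "\<And>p. p \<in> T \<Longrightarrow> y p \<in> obox n a r"
    and t: "continuous_on T t" "\<And>p. p \<in> T \<Longrightarrow> t p \<in> cbox 0 (1::real)"
  shows "continuous_on T (\<lambda>p. f (\<lambda>i. a i + t p * (y p i - a i)))"
proof (rule continuous_on_compose2[OF f])
  show "continuous_on T (\<lambda>p i. a i + t p * (y p i - a i))"
    by (intro continuous_on_coordinatewise_then_product continuous_intros t
        continuous_on_product_then_coordinatewise[OF y(1)])
  show "(\<lambda>p i. a i + t p * (y p i - a i)) ` T \<subseteq> obox n a r"
    using ray_in_obox[OF y(2) a] t(2) by auto
qed

lemma ray_integral_has_partial:
  assumes f: "Cinf_on n (obox n a r) f" and a: "\<And>i. i \<ge> n \<Longrightarrow> a i = 0"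
    and y: "y \<in> obox n a r" and i: "i < n"
  shows "((\<lambda>s. ray_integral a f m (y(i := s))) has_real_derivative
           ray_integral a (partial i f) (Suc m) y) (at (y i))"
proof -
  \<comment> \<open>The values of the \<open>i\<close>th coordinate inside the box: a convex set, as
    differentiation under the integral asks for, and an open one, so that the derivative within it
    is the full derivative.\<close>
  let ?U = "{a i - r<..<a i + r}"
  have yU: "y(i := s) \<in> obox n a r" if "s \<in> ?U" for s
    using y that i by (auto simp: obox_def)
  have "y i \<in> ?U" using y i by (auto simp: obox_def abs_less_iff)
  have cont: "continuous_on (obox n a r) f" "continuous_on (obox n a r) (partial i f)"
    using Cinf_on_continuous[OF f] Cinf_on_continuous[OF Cinf_on_partial[OF f _ i]] by auto
  have upd: "continuous_on T (\<lambda>p. y(i := g p))" if "continuous_on T g" for T :: "'b::topological_space set" and g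
  proof (rule continuous_on_coordinatewise_then_product)
    fix j show "continuous_on T (\<lambda>p. (y(i := g p)) j)"
      using that by (cases "j = i") auto
  qed
  have "((\<lambda>s. integral (cbox 0 1) (\<lambda>t. t ^ m * f (\<lambda>j. a j + t * ((y(i := s)) j - a j)))) has_real_derivative
      integral (cbox 0 1) (\<lambda>t. t ^ m * (partial i f (\<lambda>j. a j + t * ((y(i := y i)) j - a j)) * t))) (at (y i) within ?U)"
  proof (rule leibniz_rule_field_derivative)
    fix s t :: real assume s: "s \<in> ?U" and t: "t \<in> cbox 0 1"
    let ?z = "\<lambda>j. a j + t * ((y(i := s)) j - a j)"
    have z: "?z \<in> obox n a r"
      using ray_in_obox[OF yU[OF s] a] t by auto
    \<comment> \<open>Changing \<open>y i\<close> moves the point on the ray in the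
      \<open>i\<close>th coordinate only, so a one-variable chain rule suffices and yields the
      factor \<open>t\<close>.\<close>
    have upd_eq: "?z(i := a i + t * (u - a i)) = (\<lambda>j. a j + t * ((y(i := u)) j - a j))" for u
      by auto
    have "((\<lambda>u. f (?z(i := u))) has_real_derivative partial i f ?z) (at (a i + t * (s - a i)))"
      using Cinf_on_has_partial[OF f _ z i] by simp
    moreover have "((\<lambda>u. a i + t * (u - a i)) has_real_derivative t) (at s)"
      by (auto intro!: derivative_eq_intros)
    ultimately have "((\<lambda>u. f (?z(i := a i + t * (u - a i)))) has_real_derivative partial i f ?z * t) (at s)"
      by (rule DERIV_chain2)
    then have "((\<lambda>u. f (\<lambda>j. a j + t * ((y(i := u)) j - a j))) has_real_derivative partial i f ?z * t) (at s)"
      unfolding upd_eq .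
    then show "((\<lambda>u. t ^ m * f (\<lambda>j. a j + t * ((y(i := u)) j - a j))) has_real_derivative
        t ^ m * (partial i f ?z * t)) (at s within ?U)"
      by (rule has_field_derivative_at_within[OF DERIV_cmult])
  next
    fix s assume s: "s \<in> ?U"
    show "(\<lambda>t. t ^ m * f (\<lambda>j. a j + t * ((y(i := s)) j - a j))) integrable_on cbox 0 1"
      by (intro integrable_continuous continuous_intros continuous_on_ray[OF cont(1) a, where y="\<lambda>_. y(i := s)"])
         (use yU[OF s] in auto)
  next
    show "continuous_on (?U \<times> cbox 0 1) (\<lambda>(s, t). t ^ m * (partial i f (\<lambda>j. a j + t * ((y(i := s)) j - a j)) * t))"
      unfolding split_beta
      by (intro continuous_intros upd continuous_on_ray[OF cont(2) a, where y="\<lambda>p. y(i := fst p)"])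
         (use yU in auto)
  qed (use \<open>y i \<in> ?U\<close> in auto)
  then have "((\<lambda>s. ray_integral a f m (y(i := s))) has_real_derivative
      integral (cbox 0 1) (\<lambda>t. t ^ m * (partial i f (\<lambda>j. a j + t * ((y(i := y i)) j - a j)) * t))) (at (y i))"
    using at_within_open[OF \<open>y i \<in> ?U\<close>] by (simp add: ray_integral_def)
  then show ?thesis
    by (simp add: ray_integral_def algebra_simps)
qed

text \<open>For the coinduction both \<open>f\<close> and the exponent are left free in the family
  of generators, since differentiation changes both.\<close>

lemma Cinf_on_ray_integral:
  assumes "Cinf_on n (obox n a r) f" and a: "\<And>i. i \<ge> n \<Longrightarrow> a i = 0"
  shows "Cinf_on n (obox n a r) (ray_integral a f m)"
proof (rule Cinf_on_alg[where P="\<lambda>h. \<exists>f m. Cinf_on n (obox n a r) f \<and> h = ray_integral a f m"])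
  let ?P = "\<lambda>h. \<exists>f m. Cinf_on n (obox n a r) f \<and> h = ray_integral a f m"
  show "alg ?P (ray_integral a f m)"
    using assms(1) by (intro alg_base) blast
  show "continuous_on (obox n a r) h" if "?P h" for h
  proof -
    obtain f m where f: "Cinf_on n (obox n a r) f" "h = ray_integral a f m"
      using \<open>?P h\<close> by blast
    have "continuous_on (obox n a r \<times> cbox 0 1) (\<lambda>(y, t). t ^ m * f (\<lambda>j. a j + t * (y j - a j)))"
      unfolding split_beta
      by (intro continuous_intros continuous_on_ray[OF Cinf_on_continuous[OF f(1)] a]) auto
    then show ?thesis
      unfolding f(2) ray_integral_def by (rule integral_continuous_on_param)
  qed
  show "\<exists>g. alg ?P g \<and> (\<forall>x\<in>obox n a r. ((\<lambda>t. h (x(i := t))) has_real_derivative g x) (at (x i)))"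
    if "?P h" "i < n" for h i
  proof -
    obtain f m where f: "Cinf_on n (obox n a r) f" "h = ray_integral a f m"
      using \<open>?P h\<close> by blast
    have "alg ?P (ray_integral a (partial i f) (Suc m))"
      using Cinf_on_partial[OF f(1) _ \<open>i < n\<close>] by (intro alg_base) auto
    then show ?thesis
      unfolding f(2) using ray_integral_has_partial[OF f(1) a _ \<open>i < n\<close>]
      by (intro exI[of _ "ray_integral a (partial i f) (Suc m)"]) auto
  qed
qed simp

text \<open>Integrate the derivative of \<open>f\<close> along the segment from \<open>a\<close> to
  \<open>y\<close>: the coefficient of \<open>y j - a j\<close> is the mean of the
  \<open>j\<close>th partial derivative over the segment, and for \<open>y = a\<close> the segment
  is constant.\<close>

lemma Hadamard:
  assumes f: "Cinf_on n (obox n a r) f" and a: "a \<in> obox n a r"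
  shows "\<exists>g. (\<forall>j<n. Cinf_on n (obox n a r) (g j) \<and> g j a = partial j f a) \<and>
    (\<forall>y\<in>obox n a r. f y = f a + (\<Sum>j<n. (y j - a j) * g j y))"
proof (intro exI conjI allI impI ballI)
  let ?g = "\<lambda>j. ray_integral a (partial j f) 0"
  have a0: "a i = 0" if "i \<ge> n" for i
    using a that by (simp add: obox_def)
  show "Cinf_on n (obox n a r) (?g j)" if "j < n" for j
    using Cinf_on_ray_integral[OF Cinf_on_partial[OF f _ that] a0] by simp
  show "?g j a = partial j f a" for j
    by (simp add: ray_integral_def)
  fix y assume y: "y \<in> obox n a r"
  let ?\<gamma> = "\<lambda>t i. a i + t * (y i - a i)"
  have "((\<lambda>t. f (?\<gamma> t)) has_real_derivative (\<Sum>j<n. partial j f (?\<gamma> t) * (y j - a j))) (at t)"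
    if "t \<in> {0..1}" for t
  proof (rule chain_rule_curve[OF openin_obox f])
    show "?\<gamma> t \<in> obox n a r" using ray_in_obox[OF y a0] that by auto
    show "((\<lambda>t. ?\<gamma> t j) has_real_derivative y j - a j) (at t)" for j
      by (auto intro!: derivative_eq_intros)
    show "\<forall>\<^sub>F t in at t. \<forall>j\<ge>n. ?\<gamma> t j = 0"
      using y a0 by (intro always_eventually) (auto simp: obox_def)
  qed
  then have "((\<lambda>t. \<Sum>j<n. partial j f (?\<gamma> t) * (y j - a j)) has_integral (f (?\<gamma> 1) - f (?\<gamma> 0))) {0..1}"
    by (intro fundamental_theorem_of_calculus)
       (auto simp flip: has_real_derivative_iff_has_vector_derivative intro: has_field_derivative_at_within)
  moreover have "((\<lambda>t. \<Sum>j<n. partial j f (?\<gamma> t) * (y j - a j)) has_integral (\<Sum>j<n. ?g j y * (y j - a j))) {0..1}"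
  proof (intro has_integral_sum has_integral_mult_left)
    fix j assume "j \<in> {..<n}"
    have "continuous_on {0..1} (\<lambda>t. partial j f (?\<gamma> t))"
      by (rule continuous_on_ray[OF Cinf_on_continuous[OF Cinf_on_partial[OF f]] a0, where y="\<lambda>_. y"])
         (use y \<open>j \<in> {..<n}\<close> in auto)
    then show "((\<lambda>t. partial j f (?\<gamma> t)) has_integral ?g j y) {0..1}"
      using integrable_integral[OF integrable_continuous_interval] by (simp add: ray_integral_def)
  qed simp
  ultimately have "f (?\<gamma> 1) - f (?\<gamma> 0) = (\<Sum>j<n. ?g j y * (y j - a j))"
    by (rule has_integral_unique)
  then show "f y = f a + (\<Sum>j<n. (y j - a j) * ?g j y)"
    by (simp add: mult.commute)
qed

subsection \<open>Bump functions\<close>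

text \<open>The standard function exp(-1/x) extended by 0. Negative powers of \<open>x\<close> are
  included because differentiation creates them; derivatives are then combinations of members of the
  same family.\<close>

definition flat_exp :: "nat \<Rightarrow> real \<Rightarrow> real" where
  "flat_exp m x = (if x > 0 then exp (- (1 / x)) / x ^ m else 0)"

text \<open>In the variable 1/x the limit from the right says that the exponential outgrows every
  power.\<close>

lemma flat_exp_tendsto_0: "(flat_exp m \<longlongrightarrow> 0) (at 0)"
proof (rule filterlim_split_at)
  show "(flat_exp m \<longlongrightarrow> 0) (at_left 0)"
    by (rule tendsto_eventually) (auto simp: flat_exp_def eventually_at_filter)
  have "((\<lambda>x::real. inverse x ^ m / exp (inverse x)) \<longlongrightarrow> 0) (at_right 0)"
    by (rule filterlim_compose[OF tendsto_power_div_exp_0 filterlim_inverse_at_top_right])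
  moreover have "\<forall>\<^sub>F x in at_right 0. inverse x ^ m / exp (inverse x) = flat_exp m x"
    by (auto simp: eventually_at_filter flat_exp_def exp_minus field_simps)
  ultimately show "(flat_exp m \<longlongrightarrow> 0) (at_right 0)"
    by (rule Lim_transform_eventually)
qed

lemma DERIV_flat_exp: "(flat_exp m has_real_derivative flat_exp (m + 2) x - real m * flat_exp (m + 1) x) (at x)"
proof -
  consider "x > 0" | "x = 0" | "x < 0" by linarith
  then show ?thesis
  proof cases
    case 1
    have "((\<lambda>x. exp (- (1 / x)) / x ^ m) has_real_derivative flat_exp (m + 2) x - real m * flat_exp (m + 1) x) (at x)"
    proof (rule DERIV_cong)
      have "((\<lambda>x. exp (- (1 / x))) has_real_derivative exp (- (1 / x)) * (1 / (x * x))) (at x)"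
        using 1 by (auto simp: divide_inverse power2_eq_square intro!: derivative_eq_intros)
      then show "((\<lambda>x. exp (- (1 / x)) / x ^ m) has_real_derivative
          (exp (- (1 / x)) * (1 / (x * x)) * x ^ m - exp (- (1 / x)) * (real m * x ^ (m - 1))) / (x ^ m * x ^ m)) (at x)"
        using 1 DERIV_power[OF DERIV_ident, of m x UNIV] by (intro DERIV_divide) (auto simp: mult.commute)
      show "(exp (- (1 / x)) * (1 / (x * x)) * x ^ m - exp (- (1 / x)) * (real m * x ^ (m - 1))) / (x ^ m * x ^ m) =
          flat_exp (m + 2) x - real m * flat_exp (m + 1) x"
        using 1 by (cases m) (simp_all add: flat_exp_def field_simps)
    qed
    then show ?thesis
      by (rule has_field_derivative_transform_within_open[of _ _ _ "{0<..}"])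
         (use 1 in \<open>auto simp: flat_exp_def\<close>)
  next
    \<comment> \<open>The difference quotient at 0 is again a member of the family, with exponent
      \<open>m + 1\<close>, so its known limit gives the derivative 0.\<close>
    case 2
    have "\<forall>\<^sub>F h in at 0. flat_exp (m + 1) h = (flat_exp m (0 + h) - flat_exp m 0) / h"
      by (auto simp: eventually_at_filter flat_exp_def)
    then have "((\<lambda>h. (flat_exp m (0 + h) - flat_exp m 0) / h) \<longlongrightarrow> 0) (at 0)"
      by (rule Lim_transform_eventually[OF flat_exp_tendsto_0])
    then show ?thesis
      using 2 by (simp add: DERIV_def flat_exp_def)
  next
    case 3
    have "((\<lambda>x. 0) has_real_derivative flat_exp (m + 2) x - real m * flat_exp (m + 1) x) (at x)"
      using 3 by (auto simp: flat_exp_def)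
    then show ?thesis
      by (rule has_field_derivative_transform_within_open[of _ _ _ "{..<0}"])
         (use 3 in \<open>auto simp: flat_exp_def\<close>)
  qed
qed

lemma Cinf_on_flat_exp:
  assumes S: "openin (Euclidean_space n) S" and g: "Cinf_on n S g"
  shows "Cinf_on n S (\<lambda>x. flat_exp m (g x))"
proof (rule Cinf_on_alg[OF S, where P="\<lambda>f. Cinf_on n S f \<or> (\<exists>m. f = (\<lambda>x. flat_exp m (g x)))"])
  let ?P = "\<lambda>f. Cinf_on n S f \<or> (\<exists>m. f = (\<lambda>x. flat_exp m (g x)))"
  show "alg ?P (\<lambda>x. flat_exp m (g x))"
    by (intro alg_base) blast
  have "continuous_on UNIV (flat_exp m)" for m
    using DERIV_flat_exp by (intro continuous_at_imp_continuous_on) (auto intro: DERIV_isCont)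
  then have "continuous_on S (\<lambda>x. flat_exp m (g x))" for m
    using Cinf_on_continuous[OF g S] by (rule continuous_on_compose2) auto
  then show "continuous_on S f" if "?P f" for f
    using that Cinf_on_continuous S by blast
  show "\<exists>h. alg ?P h \<and> (\<forall>x\<in>S. ((\<lambda>t. f (x(i := t))) has_real_derivative h x) (at (x i)))"
    if "?P f" "i < n" for f i
    using that(1)
  proof
    assume "Cinf_on n S f"
    then show ?thesis
      using S \<open>i < n\<close> by (intro exI[of _ "partial i f"])
         (auto intro!: alg_base Cinf_on_partial Cinf_on_has_partial)
  next
    assume "\<exists>m. f = (\<lambda>x. flat_exp m (g x))"
    then obtain m where f: "f = (\<lambda>x. flat_exp m (g x))" by blast
    have *: "alg ?P (\<lambda>x. flat_exp m (g x))" for m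
      by (intro alg_base) blast
    have "alg ?P (partial i g)"
      using Cinf_on_partial[OF g S \<open>i < n\<close>] by (intro alg_base) blast
    then have "alg ?P (\<lambda>x. (flat_exp (m + 2) (g x) + (- real m) * flat_exp (m + 1) (g x)) * partial i g x)"
      by (intro alg_mult alg_add * alg_const)
    moreover have "((\<lambda>t. flat_exp m (g (x(i := t)))) has_real_derivative
        (flat_exp (m + 2) (g x) + (- real m) * flat_exp (m + 1) (g x)) * partial i g x) (at (x i))" if "x \<in> S" for x
      using DERIV_chain2[of "flat_exp m" _ "\<lambda>t. g (x(i := t))", OF _ Cinf_on_has_partial[OF g S that \<open>i < n\<close>]]
        DERIV_flat_exp[of m "g x"] by simp
    ultimately show ?thesis
      unfolding f by blast
  qed
qed

text \<open>The derivative of 1/g is a polynomial in 1/g and a derivative of \<open>g\<close>, so a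
  single extra generator is enough.\<close>

lemma Cinf_on_inverse:
  assumes S: "openin (Euclidean_space n) S" and g: "Cinf_on n S g" and nz: "\<And>x. x \<in> S \<Longrightarrow> g x \<noteq> 0"
  shows "Cinf_on n S (\<lambda>x. inverse (g x))"
proof (rule Cinf_on_alg[OF S, where P="\<lambda>f. Cinf_on n S f \<or> f = (\<lambda>x. inverse (g x))"])
  let ?P = "\<lambda>f. Cinf_on n S f \<or> f = (\<lambda>x. inverse (g x))"
  have base: "alg ?P (\<lambda>x. inverse (g x))"
    by (intro alg_base) blast
  show "alg ?P (\<lambda>x. inverse (g x))" by (rule base)
  have "continuous_on S (\<lambda>x. inverse (g x))"
    using Cinf_on_continuous[OF g S] nz by (intro continuous_on_inverse) auto
  then show "continuous_on S f" if "?P f" for f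
    using that Cinf_on_continuous S by blast
  show "\<exists>h. alg ?P h \<and> (\<forall>x\<in>S. ((\<lambda>t. f (x(i := t))) has_real_derivative h x) (at (x i)))"
    if "?P f" "i < n" for f i
    using that(1)
  proof
    assume "Cinf_on n S f"
    then show ?thesis
      using S \<open>i < n\<close> by (intro exI[of _ "partial i f"])
         (auto intro!: alg_base Cinf_on_partial Cinf_on_has_partial)
  next
    assume f: "f = (\<lambda>x. inverse (g x))"
    have "alg ?P (partial i g)"
      using Cinf_on_partial[OF g S \<open>i < n\<close>] by (intro alg_base) blast
    then have "alg ?P (\<lambda>x. (- 1) * (inverse (g x) * partial i g x * inverse (g x)))"
      by (intro alg_mult base alg_const)
    moreover have "((\<lambda>t. inverse (g (x(i := t)))) has_real_derivative
        (- 1) * (inverse (g x) * partial i g x * inverse (g x))) (at (x i))" if "x \<in> S" for x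
      using DERIV_inverse'[OF Cinf_on_has_partial[OF g S that \<open>i < n\<close>]] nz[OF that] by simp
    ultimately show ?thesis
      unfolding f by blast
  qed
qed

lemma Cinf_on_prod:
  assumes "openin (Euclidean_space n) S" "\<And>i. i \<in> I \<Longrightarrow> Cinf_on n S (f i)"
  shows "Cinf_on n S (\<lambda>x. \<Prod>i\<in>I. f i x)"
  using assms(2)
  by (induction I rule: infinite_finite_induct) (simp_all add: Cinf_on_const Cinf_on_mult assms(1))

text \<open>Equal to 1 up to 1 and to 0 from 2 on. The two summands of the denominator are positive
  below 2 and above 1 respectively, so the denominator never vanishes.\<close>

definition smooth_step :: "real \<Rightarrow> real" where
  "smooth_step x = flat_exp 0 (2 - x) * inverse (flat_exp 0 (2 - x) + flat_exp 0 (x - 1))"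

lemma smooth_step_1: "x \<le> 1 \<Longrightarrow> smooth_step x = 1"
  and smooth_step_0: "x \<ge> 2 \<Longrightarrow> smooth_step x = 0"
  and smooth_step_denom: "flat_exp 0 (2 - x) + flat_exp 0 (x - 1) \<noteq> 0"
proof -
  show "flat_exp 0 (2 - x) + flat_exp 0 (x - 1) \<noteq> 0"
    using exp_gt_zero[of "- (1 / (2 - x))"] exp_gt_zero[of "- (1 / (x - 1))"]
    by (auto simp: flat_exp_def simp del: exp_gt_zero)
qed (auto simp: smooth_step_def flat_exp_def)

lemma Cinf_on_smooth_step:
  assumes "openin (Euclidean_space n) S" "Cinf_on n S g"
  shows "Cinf_on n S (\<lambda>x. smooth_step (g x))"
proof -
  have "Cinf_on n S (\<lambda>x. 2 + (- 1) * g x)" "Cinf_on n S (\<lambda>x. g x + (- 1))"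
    by (intro Cinf_on_add Cinf_on_mult Cinf_on_const assms)+
  then have "Cinf_on n S (\<lambda>x. flat_exp 0 (2 - g x))" "Cinf_on n S (\<lambda>x. flat_exp 0 (g x - 1))"
    using Cinf_on_flat_exp[OF assms(1)] by fastforce+
  then show ?thesis
    unfolding smooth_step_def by (intro Cinf_on_mult Cinf_on_inverse Cinf_on_add assms smooth_step_denom)
qed

definition clbox :: "nat \<Rightarrow> (nat \<Rightarrow> real) \<Rightarrow> real \<Rightarrow> (nat \<Rightarrow> real) set" where
  "clbox n a r = {x. (\<forall>i<n. \<bar>x i - a i\<bar> \<le> r) \<and> (\<forall>i\<ge>n. x i = 0)}"

text \<open>A product of closed intervals and, from index \<open>n\<close> on, of singletons, hence
  compact by Tychonoff's theorem.\<close>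

lemma compactin_clbox: "compactin (Euclidean_space n) (clbox n a r)"
proof -
  let ?B = "\<lambda>i. if i < n then {a i - r..a i + r} else {0}"
  have "clbox n a r = PiE UNIV ?B"
  proof (intro set_eqI iffI)
    fix x assume "x \<in> clbox n a r"
    then show "x \<in> PiE UNIV ?B" by (auto simp: clbox_def PiE_iff abs_le_iff)
  next
    fix x assume "x \<in> PiE UNIV ?B"
    then have x: "x i \<in> ?B i" for i by (auto simp: PiE_iff)
    have "\<bar>x i - a i\<bar> \<le> r" if "i < n" for i
      using x[of i] that by (auto simp: abs_le_iff)
    moreover have "x i = 0" if "i \<ge> n" for i
      using x[of i] that by auto
    ultimately show "x \<in> clbox n a r"
      by (simp add: clbox_def)
  qed
  moreover have "compactin (product_topology (\<lambda>i. euclidean) UNIV) (PiE UNIV ?B)"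
    unfolding compactin_PiE by simp
  ultimately have "compact (clbox n a r)"
    by (simp add: euclidean_product_topology)
  then show ?thesis
    by (auto simp: Euclidean_space_eq compactin_subtopology clbox_def)
qed

text \<open>The bump is a product of steps in the squares of \<open>(x i - a i) / r\<close>;
  squaring avoids the absolute value, which is not smooth. A factor vanishes as soon as its square
  reaches 2, so the bound \<open>2 * r\<close> leaves some room.\<close>

lemma Euclidean_bump:
  assumes "r > 0"
  obtains b where "\<And>S. openin (Euclidean_space n) S \<Longrightarrow> Cinf_on n S b"
    "\<And>x. x \<in> obox n a r \<Longrightarrow> b x = 1"
    "\<And>x i. b x \<noteq> 0 \<Longrightarrow> i < n \<Longrightarrow> \<bar>x i - a i\<bar> \<le> 2 * r"
proof (rule that)
  define b where "b x = (\<Prod>i<n. smooth_step (((x i + (- a i)) * (1 / r)) * ((x i + (- a i)) * (1 / r))))" for x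
  show "Cinf_on n S b" if "openin (Euclidean_space n) S" for S
    unfolding b_def[abs_def]
    by (intro Cinf_on_prod Cinf_on_smooth_step Cinf_on_mult Cinf_on_add Cinf_on_const Cinf_on_coord that)
  show "b x = 1" if "x \<in> obox n a r" for x
    unfolding b_def
  proof (rule prod.neutral, rule ballI, rule smooth_step_1)
    fix i assume "i \<in> {..<n}"
    then have "\<bar>(x i + (- a i)) * (1 / r)\<bar> \<le> 1"
      using that assms by (auto simp: obox_def abs_mult)
    then show "((x i + (- a i)) * (1 / r)) * ((x i + (- a i)) * (1 / r)) \<le> 1"
      using abs_square_le_1[of "(x i + (- a i)) * (1 / r)"] by (simp add: power2_eq_square)
  qed
  show "\<bar>x i - a i\<bar> \<le> 2 * r" if "b x \<noteq> 0" "i < n" for x i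
  proof (rule ccontr)
    let ?u = "(x i + (- a i)) * (1 / r)"
    assume "\<not> ?thesis"
    then have "2 \<le> \<bar>?u\<bar>"
      using assms by (simp add: abs_mult field_simps)
    then have "2 * 2 \<le> \<bar>?u\<bar> * \<bar>?u\<bar>"
      by (intro mult_mono) auto
    then have "smooth_step (?u * ?u) = 0"
      by (intro smooth_step_0) (simp only: abs_mult_self_eq)
    then have "b x = 0"
      unfolding b_def using \<open>i < n\<close> by (intro prod_zero) auto
    with \<open>b x \<noteq> 0\<close> show False by simp
  qed
qed

section \<open>Smooth functions on manifolds\<close>

locale smooth_mfd =
  fixes M :: "'a manifold"
  assumes smooth_manifold: "smooth_manifold M"
begin

lemma Hausdorff: "Hausdorff_space (mtop M)"
  and second_countable: "second_countable (mtop M)"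
  using smooth_manifold by (auto simp: smooth_manifold_def)

lemma chart_cover: "x \<in> carr M \<Longrightarrow> \<exists>U \<phi>. (U, \<phi>) \<in> atlas M \<and> x \<in> U"
  using smooth_manifold unfolding smooth_manifold_def by (metis UN_iff prod.collapse)

context
  fixes U :: "'a set" and \<phi> :: "'a \<Rightarrow> nat \<Rightarrow> real"
  assumes c: "(U, \<phi>) \<in> atlas M"
begin

lemma is_chart: "is_chart (mtop M) (mdim M) (U, \<phi>)"
  using smooth_manifold c by (auto simp: smooth_manifold_def)

lemma chart_open: "openin (mtop M) U"
  and chart_image_open: "openin (Euclidean_space (mdim M)) (\<phi> ` U)"
  and chart_homeo: "homeomorphic_map (subtopology (mtop M) U) (subtopology (Euclidean_space (mdim M)) (\<phi> ` U)) \<phi>"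
  using is_chart by (auto simp: is_chart_def)

lemma chart_carr: "U \<subseteq> carr M"
  using chart_open by (rule openin_subset)

lemma chart_topspace: "topspace (subtopology (mtop M) U) = U"
  using chart_carr by auto

lemma chart_inj: "inj_on \<phi> U"
  using homeomorphic_imp_injective_map[OF chart_homeo] unfolding chart_topspace .

lemma chart_inv [simp]: "x \<in> U \<Longrightarrow> inv_into U \<phi> (\<phi> x) = x"
  by (rule inv_into_f_f[OF chart_inj])

lemma chart_open_image:
  assumes "openin (mtop M) W"
  shows "openin (Euclidean_space (mdim M)) (\<phi> ` (U \<inter> W))"
proof -
  have "openin (subtopology (mtop M) U) (U \<inter> W)"
    using assms by (simp add: openin_subtopology_Int2)
  then have "openin (subtopology (Euclidean_space (mdim M)) (\<phi> ` U)) (\<phi> ` (U \<inter> W))"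
    using homeomorphic_imp_open_map[OF chart_homeo] by (simp add: open_map_def)
  then show ?thesis
    using chart_image_open openin_open_subtopology by blast
qed

lemma chart_open_preimage:
  assumes "openin (Euclidean_space (mdim M)) S"
  shows "openin (mtop M) {x \<in> U. \<phi> x \<in> S}"
proof -
  have "continuous_map (subtopology (mtop M) U) (Euclidean_space (mdim M)) \<phi>"
    using homeomorphic_imp_continuous_map[OF chart_homeo] by (simp add: continuous_map_in_subtopology)
  then have "openin (subtopology (mtop M) U) {x \<in> topspace (subtopology (mtop M) U). \<phi> x \<in> S}"
    using assms by (rule openin_continuous_map_preimage)
  then show ?thesis
    unfolding chart_topspace using chart_open openin_open_subtopology by blast
qed

lemma chart_compactin_preimage:
  assumes "compactin (Euclidean_space (mdim M)) K" "K \<subseteq> \<phi> ` U"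
  shows "compactin (mtop M) {x \<in> U. \<phi> x \<in> K}"
proof -
  have "\<phi> ` {x \<in> U. \<phi> x \<in> K} = K"
    using assms(2) by auto
  then have "compactin (subtopology (Euclidean_space (mdim M)) (\<phi> ` U)) (\<phi> ` {x \<in> U. \<phi> x \<in> K})"
    using assms by (simp add: compactin_subtopology)
  then have "compactin (subtopology (mtop M) U) {x \<in> U. \<phi> x \<in> K}"
    by (subst (asm) homeomorphic_map_compactness[OF chart_homeo]) (use chart_carr in auto)
  then show ?thesis
    by (simp add: compactin_subtopology)
qed

lemma chart_zero: "x \<in> U \<Longrightarrow> i \<ge> mdim M \<Longrightarrow> \<phi> x i = 0"
  using openin_Euclidean_zero[OF chart_image_open] by blast

end

lemma chart_transition:
  assumes "(U, \<phi>) \<in> atlas M" "(V, \<psi>) \<in> atlas M" "j < mdim M"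
  shows "Cinf_on (mdim M) (\<phi> ` (U \<inter> V)) (\<lambda>x. \<psi> (inv_into U \<phi> x) j)"
proof -
  have "compatible_charts (mdim M) (U, \<phi>) (V, \<psi>)"
    using smooth_manifold assms(1,2) unfolding smooth_manifold_def by blast
  then show ?thesis
    using assms(3) by (simp add: compatible_charts_def)
qed

lemma smooth_on_chart:
  assumes "smooth_on M W f" "(U, \<phi>) \<in> atlas M"
  shows "Cinf_on (mdim M) (\<phi> ` (U \<inter> W)) (\<lambda>x. f (inv_into U \<phi> x))"
proof -
  have "case (U, \<phi>) of (U, \<phi>) \<Rightarrow> Cinf_on (mdim M) (\<phi> ` (U \<inter> W)) (f \<circ> inv_into U \<phi>)"
    using assms unfolding smooth_on_def by (rule bspec)
  then show ?thesis
    by (simp add: o_def)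
qed

text \<open>One chart around each point suffices: the expression in any other chart arises by
  composition with a transition map, which is smooth by compatibility.\<close>

lemma smooth_onI:
  assumes W: "openin (mtop M) W"
    and loc: "\<And>x. x \<in> W \<Longrightarrow> \<exists>U \<phi> W'. (U, \<phi>) \<in> atlas M \<and> openin (mtop M) W' \<and> x \<in> U \<and> x \<in> W' \<and> W' \<subseteq> W \<and>
      Cinf_on (mdim M) (\<phi> ` (U \<inter> W')) (\<lambda>x. f (inv_into U \<phi> x))"
  shows "smooth_on M W f"
proof -
  have "Cinf_on (mdim M) (\<psi> ` (V \<inter> W)) (\<lambda>x. f (inv_into V \<psi> x))" if V: "(V, \<psi>) \<in> atlas M" for V \<psi>
  proof (rule Cinf_on_locally[OF chart_open_image[OF V W]])
    fix y assume "y \<in> \<psi> ` (V \<inter> W)"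
    then obtain x where x: "x \<in> V" "x \<in> W" "y = \<psi> x" by blast
    obtain U \<phi> W' where U: "(U, \<phi>) \<in> atlas M" and W': "openin (mtop M) W'" "x \<in> U" "x \<in> W'" "W' \<subseteq> W"
      and f: "Cinf_on (mdim M) (\<phi> ` (U \<inter> W')) (\<lambda>x. f (inv_into U \<phi> x))"
      using loc[OF x(2)] by blast
    let ?S = "\<psi> ` (V \<inter> (U \<inter> W'))"
    have S: "openin (Euclidean_space (mdim M)) ?S"
      using chart_open_image[OF V openin_Int[OF chart_open[OF U] W'(1)]] .
    have in_S: "inv_into V \<psi> z \<in> U \<inter> W'" if "z \<in> ?S" for z
      using that V by auto
    have "Cinf_on (mdim M) ?S (\<lambda>z. (\<lambda>x. f (inv_into U \<phi> x)) ((\<lambda>z. \<phi> (inv_into V \<psi> z)) z))"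
    proof (rule Cinf_on_compose[OF S chart_open_image[OF U W'(1)] f])
      show "Cinf_on (mdim M) ?S (\<lambda>x. \<phi> (inv_into V \<psi> x) j)" if "j < mdim M" for j
        by (rule Cinf_on_subset[OF chart_transition[OF V U that] chart_open_image[OF V chart_open[OF U]] S]) auto
      show "\<phi> (inv_into V \<psi> x) \<in> \<phi> ` (U \<inter> W')" if "x \<in> ?S" for x
        using in_S[OF that] by blast
    qed
    then have "Cinf_on (mdim M) ?S (\<lambda>z. f (inv_into V \<psi> z))"
      by (subst Cinf_on_cong[OF S]) (use in_S U in auto)
    then show "\<exists>T. openin (Euclidean_space (mdim M)) T \<and> y \<in> T \<and> T \<subseteq> \<psi> ` (V \<inter> W) \<and>
        Cinf_on (mdim M) T (\<lambda>x. f (inv_into V \<psi> x))"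
      using S x W' by blast
  qed
  then show ?thesis
    by (auto simp: smooth_on_def o_def)
qed

section \<open>Restriction, locality and algebra of smooth functions\<close>

lemma smooth_on_subset:
  assumes "smooth_on M W f" "openin (mtop M) W" "openin (mtop M) V" "V \<subseteq> W"
  shows "smooth_on M V f"
proof -
  have "Cinf_on (mdim M) (\<phi> ` (U \<inter> V)) (\<lambda>x. f (inv_into U \<phi> x))" if U: "(U, \<phi>) \<in> atlas M" for U \<phi>
    by (rule Cinf_on_subset[OF smooth_on_chart[OF assms(1) U] chart_open_image[OF U assms(2)] chart_open_image[OF U assms(3)]])
       (use assms(4) in auto)
  then show ?thesis by (auto simp: smooth_on_def o_def)
qed

lemma smooth_on_cong:
  assumes "smooth_on M W f" "openin (mtop M) W" "\<And>x. x \<in> W \<Longrightarrow> f x = g x"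
  shows "smooth_on M W g"
proof -
  have "Cinf_on (mdim M) (\<phi> ` (U \<inter> W)) (\<lambda>x. g (inv_into U \<phi> x))" if U: "(U, \<phi>) \<in> atlas M" for U \<phi>
  proof -
    have "\<forall>y\<in>\<phi> ` (U \<inter> W). f (inv_into U \<phi> y) = g (inv_into U \<phi> y)"
      using assms(3) U by auto
    from Cinf_on_cong[OF chart_open_image[OF U assms(2)] this] show ?thesis
      using smooth_on_chart[OF assms(1) U] by simp
  qed
  then show ?thesis by (auto simp: smooth_on_def o_def)
qed

lemma smooth_on_locally:
  assumes W: "openin (mtop M) W"
    and loc: "\<And>x. x \<in> W \<Longrightarrow> \<exists>V. openin (mtop M) V \<and> x \<in> V \<and> V \<subseteq> W \<and> smooth_on M V f"
  shows "smooth_on M W f"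
proof (rule smooth_onI[OF W])
  fix x assume "x \<in> W"
  then obtain V where V: "openin (mtop M) V" "x \<in> V" "V \<subseteq> W" "smooth_on M V f"
    using loc by blast
  obtain U \<phi> where U: "(U, \<phi>) \<in> atlas M" "x \<in> U"
    using chart_cover \<open>x \<in> W\<close> openin_subset[OF W] by blast
  then show "\<exists>U \<phi> W'. (U, \<phi>) \<in> atlas M \<and> openin (mtop M) W' \<and> x \<in> U \<and> x \<in> W' \<and> W' \<subseteq> W \<and>
      Cinf_on (mdim M) (\<phi> ` (U \<inter> W')) (\<lambda>x. f (inv_into U \<phi> x))"
    using V smooth_on_chart[OF V(4)] by blast
qed

lemma smooth_on_const: "openin (mtop M) W \<Longrightarrow> smooth_on M W (\<lambda>_. c)"
  by (auto simp: smooth_on_def o_def intro!: Cinf_on_const chart_open_image)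

lemma smooth_on_add:
  "openin (mtop M) W \<Longrightarrow> smooth_on M W f \<Longrightarrow> smooth_on M W g \<Longrightarrow> smooth_on M W (\<lambda>x. f x + g x)"
  unfolding smooth_on_def o_def using Cinf_on_add[OF chart_open_image] by fast

lemma smooth_on_mult:
  "openin (mtop M) W \<Longrightarrow> smooth_on M W f \<Longrightarrow> smooth_on M W g \<Longrightarrow> smooth_on M W (\<lambda>x. f x * g x)"
  unfolding smooth_on_def o_def using Cinf_on_mult[OF chart_open_image] by fast

lemma smooth_on_sum:
  assumes "openin (mtop M) W" "\<And>i. i \<in> I \<Longrightarrow> smooth_on M W (f i)"
  shows "smooth_on M W (\<lambda>x. \<Sum>i\<in>I. f i x)"
  using assms(2)
  by (induction I rule: infinite_finite_induct) (simp_all add: smooth_on_const smooth_on_add assms(1))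

lemma smooth_on_prod:
  assumes "openin (mtop M) W" "\<And>i. i \<in> I \<Longrightarrow> smooth_on M W (f i)"
  shows "smooth_on M W (\<lambda>x. \<Prod>i\<in>I. f i x)"
  using assms(2)
  by (induction I rule: infinite_finite_induct) (simp_all add: smooth_on_const smooth_on_mult assms(1))

lemma smooth_on_scale: "openin (mtop M) W \<Longrightarrow> smooth_on M W f \<Longrightarrow> smooth_on M W (\<lambda>x. c * f x)"
  using smooth_on_mult[OF _ smooth_on_const] by blast

lemma smooth_on_diff:
  assumes "openin (mtop M) W" "smooth_on M W f" "smooth_on M W g"
  shows "smooth_on M W (\<lambda>x. f x - g x)"
  using smooth_on_add[OF assms(1,2) smooth_on_scale[OF assms(1,3), of "- 1"]] by simp

lemma smooth_on_from_chart:
  assumes U: "(U, \<phi>) \<in> atlas M" and S: "openin (Euclidean_space (mdim M)) S" and F: "Cinf_on (mdim M) S F"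
  shows "smooth_on M {x \<in> U. \<phi> x \<in> S} (\<lambda>x. F (\<phi> x))"
proof (rule smooth_onI[OF chart_open_preimage[OF U S]])
  let ?W = "{x \<in> U. \<phi> x \<in> S}"
  fix x assume "x \<in> ?W"
  have W: "openin (Euclidean_space (mdim M)) (\<phi> ` (U \<inter> ?W))"
    using chart_open_image[OF U chart_open_preimage[OF U S]] .
  have "Cinf_on (mdim M) (\<phi> ` (U \<inter> ?W)) F"
    by (rule Cinf_on_subset[OF F S W]) auto
  then have "Cinf_on (mdim M) (\<phi> ` (U \<inter> ?W)) (\<lambda>y. F (\<phi> (inv_into U \<phi> y)))"
    by (subst Cinf_on_cong[OF W]) (use U in auto)
  then show "\<exists>U \<psi> W'. (U, \<psi>) \<in> atlas M \<and> openin (mtop M) W' \<and> x \<in> U \<and> x \<in> W' \<and> W' \<subseteq> ?W \<and>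
      Cinf_on (mdim M) (\<psi> ` (U \<inter> W')) (\<lambda>x. F (\<phi> (inv_into U \<psi> x)))"
    using U \<open>x \<in> ?W\<close> chart_open_preimage[OF U S] by blast
qed

lemma smooth_on_chart_coord:
  assumes U: "(U, \<phi>) \<in> atlas M"
  shows "smooth_on M U (\<lambda>x. \<phi> x j)"
proof -
  have "{x \<in> U. \<phi> x \<in> \<phi> ` U} = U" by auto
  then show ?thesis
    using smooth_on_from_chart[OF U chart_image_open[OF U] Cinf_on_coord[OF chart_image_open[OF U]]] by metis
qed

lemma Cinf_smooth_on: "f \<in> Cinf M W \<Longrightarrow> smooth_on M W f"
  by (simp add: Cinf_def)

lemma Cinf_outside: "f \<in> Cinf M W \<Longrightarrow> x \<notin> W \<Longrightarrow> f x = 0"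
  by (simp add: Cinf_def)

lemma CinfI: "smooth_on M W f \<Longrightarrow> (\<And>x. x \<notin> W \<Longrightarrow> f x = 0) \<Longrightarrow> f \<in> Cinf M W"
  by (simp add: Cinf_def)

lemma zero_in_Cinf: "openin (mtop M) W \<Longrightarrow> (\<lambda>_. 0) \<in> Cinf M W"
  by (simp add: Cinf_def smooth_on_const)

lemma Cinf_add: "openin (mtop M) W \<Longrightarrow> f \<in> Cinf M W \<Longrightarrow> g \<in> Cinf M W \<Longrightarrow> (\<lambda>x. f x + g x) \<in> Cinf M W"
  by (simp add: Cinf_def smooth_on_add)

lemma Cinf_mult: "openin (mtop M) W \<Longrightarrow> f \<in> Cinf M W \<Longrightarrow> g \<in> Cinf M W \<Longrightarrow> (\<lambda>x. f x * g x) \<in> Cinf M W"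
  by (simp add: Cinf_def smooth_on_mult)

lemma Cinf_scale: "openin (mtop M) W \<Longrightarrow> f \<in> Cinf M W \<Longrightarrow> (\<lambda>x. c * f x) \<in> Cinf M W"
  by (simp add: Cinf_def smooth_on_scale)

lemma Cinf_sum:
  "openin (mtop M) W \<Longrightarrow> (\<And>i. i \<in> I \<Longrightarrow> f i \<in> Cinf M W) \<Longrightarrow> (\<lambda>x. \<Sum>i\<in>I. f i x) \<in> Cinf M W"
  by (simp add: Cinf_def smooth_on_sum)

lemma restr_in_Cinf:
  assumes "openin (mtop M) W" "smooth_on M W f"
  shows "restr W f \<in> Cinf M W"
  using smooth_on_cong[OF assms(2,1), of "restr W f"] by (auto simp: Cinf_def restr_def)

lemma openin_carr [simp]: "openin (mtop M) (carr M)"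
  by simp

subsection \<open>Compactly supported functions and bump functions\<close>

lemma supp_mono:
  assumes "\<And>x. x \<in> carr M \<Longrightarrow> f x \<noteq> 0 \<Longrightarrow> g x \<noteq> 0"
  shows "supp M f \<subseteq> supp M g"
  unfolding supp_def using assms by (intro closure_of_mono) auto

lemma closedin_supp: "closedin (mtop M) (supp M f)"
  unfolding supp_def by simp

lemma supp_outside: "x \<in> carr M \<Longrightarrow> x \<notin> supp M f \<Longrightarrow> f x = 0"
  unfolding supp_def using closure_of_subset[of "{x \<in> carr M. f x \<noteq> 0}" "mtop M"] by blast

lemma CcD:
  assumes "f \<in> Cc M W"
  shows "f \<in> Cinf M (carr M)" "compactin (mtop M) (supp M f)" "supp M f \<subseteq> W" "x \<notin> supp M f \<Longrightarrow> f x = 0"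
    "x \<notin> W \<Longrightarrow> f x = 0"
proof -
  show f: "f \<in> Cinf M (carr M)" "compactin (mtop M) (supp M f)" "supp M f \<subseteq> W"
    using assms by (auto simp: Cc_def)
  show *: "f x = 0" if "x \<notin> supp M f" for x
    using supp_outside[OF _ that] Cinf_outside[OF f(1)] by blast
  then show "x \<notin> W \<Longrightarrow> f x = 0" using f(3) by blast
qed

lemma Cc_mono: "V \<subseteq> W \<Longrightarrow> Cc M V \<subseteq> Cc M W"
  by (auto simp: Cc_def)

lemma Cc_dominated:
  assumes f: "f \<in> Cc M W" and g: "g \<in> Cinf M (carr M)" and "\<And>x. f x = 0 \<Longrightarrow> g x = 0"
  shows "g \<in> Cc M W"
proof -
  have "supp M g \<subseteq> supp M f"
    by (rule supp_mono) (use assms(3) in auto)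
  then show ?thesis
    using CcD[OF f] g closed_compactin[OF CcD(2)[OF f] _ closedin_supp] by (auto simp: Cc_def)
qed

text \<open>The product extended by zero is smooth although the second factor need not extend.\<close>

lemma Cc_mult:
  assumes f: "f \<in> Cc M W" and W: "openin (mtop M) W" and g: "smooth_on M W g"
  shows "(\<lambda>x. f x * g x) \<in> Cc M W"
proof (rule Cc_dominated[OF f])
  show "(\<lambda>x. f x * g x) \<in> Cinf M (carr M)"
  proof (rule CinfI)
    show "f x * g x = 0" if "x \<notin> carr M" for x
      using Cinf_outside[OF CcD(1)[OF f] that] by simp
    show "smooth_on M (carr M) (\<lambda>x. f x * g x)"
    proof (rule smooth_on_locally)
      fix x assume x: "x \<in> carr M"
      show "\<exists>V. openin (mtop M) V \<and> x \<in> V \<and> V \<subseteq> carr M \<and> smooth_on M V (\<lambda>x. f x * g x)"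
      proof (cases "x \<in> supp M f")
        case True
        have "smooth_on M W f"
          using smooth_on_subset[OF Cinf_smooth_on[OF CcD(1)[OF f]] _ W] openin_subset[OF W] by simp
        then have "smooth_on M W (\<lambda>x. f x * g x)"
          by (rule smooth_on_mult[OF W _ g])
        moreover have "x \<in> W" using True CcD(3)[OF f] by blast
        ultimately show ?thesis using W openin_subset[OF W] by blast
      next
        case False
        let ?V = "carr M - supp M f"
        have V: "openin (mtop M) ?V"
          using closedin_supp by blast
        moreover have "smooth_on M ?V (\<lambda>x. f x * g x)"
          by (rule smooth_on_cong[OF smooth_on_const[OF V, of 0] V]) (use CcD(4)[OF f] in simp)
        ultimately show ?thesis using x False by blast
      qed
    qed simp
  qed
qed auto

lemma zero_in_Cc: "(\<lambda>_. 0) \<in> Cc M W"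
  using zero_in_Cinf[OF openin_carr] by (auto simp: Cc_def supp_def)

lemma Cc_add:
  assumes f: "f \<in> Cc M W" and g: "g \<in> Cc M W"
  shows "(\<lambda>x. f x + g x) \<in> Cc M W"
proof -
  have "supp M (\<lambda>x. f x + g x) \<subseteq> supp M f \<union> supp M g"
    unfolding supp_def closure_of_Un[symmetric] by (rule closure_of_mono) auto
  moreover have "compactin (mtop M) (supp M f \<union> supp M g)"
    using CcD(2)[OF f] CcD(2)[OF g] by (rule compactin_Un)
  ultimately show ?thesis
    using CcD(1,3)[OF f] CcD(1,3)[OF g] Cinf_add[OF openin_carr] closed_compactin[OF _ _ closedin_supp]
    by (auto simp: Cc_def)
qed

text \<open>A Euclidean bump is transported by a chart and extended by 0. The extension is smooth
  because \<open>M\<close> is covered by the chart domain and the complement of a compact set inside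
  it, which is open as \<open>M\<close> is Hausdorff.\<close>

lemma bump_at:
  assumes W: "openin (mtop M) W" and q: "q \<in> W"
  obtains b B where "b \<in> Cc M W" "openin (mtop M) B" "q \<in> B" "B \<subseteq> W" "\<forall>x\<in>B. b x = 1"
proof -
  obtain U \<phi> where U: "(U, \<phi>) \<in> atlas M" "q \<in> U"
    using chart_cover q openin_subset[OF W] by blast
  obtain r where r: "r > 0" "obox (mdim M) (\<phi> q) r \<subseteq> \<phi> ` (U \<inter> W)"
    using obox_subset[OF chart_open_image[OF U(1) W], of "\<phi> q"] U q by blast
  \<comment> \<open>With radius r/3 the bump vanishes outside the closed box of radius 2r/3, which
    still lies in the open box of radius \<open>r\<close>.\<close>
  obtain \<beta> where \<beta>: "\<And>S. openin (Euclidean_space (mdim M)) S \<Longrightarrow> Cinf_on (mdim M) S \<beta>"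
    "\<And>x. x \<in> obox (mdim M) (\<phi> q) (r / 3) \<Longrightarrow> \<beta> x = 1"
    "\<And>x i. \<beta> x \<noteq> 0 \<Longrightarrow> i < mdim M \<Longrightarrow> \<bar>x i - \<phi> q i\<bar> \<le> 2 * (r / 3)"
    using Euclidean_bump[of "r / 3" "mdim M" "\<phi> q"] r(1) by auto
  let ?K = "clbox (mdim M) (\<phi> q) (2 * (r / 3))"
  let ?K' = "{x \<in> U. \<phi> x \<in> ?K}"
  have "?K \<subseteq> obox (mdim M) (\<phi> q) r"
    using r(1) by (fastforce simp: clbox_def obox_def)
  then have K: "?K \<subseteq> \<phi> ` (U \<inter> W)" using r(2) by blast
  have K'W: "?K' \<subseteq> W"
  proof
    fix x assume "x \<in> ?K'"
    then obtain y where "x \<in> U" "y \<in> U" "y \<in> W" "\<phi> x = \<phi> y" using K by blast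
    then show "x \<in> W" using inj_onD[OF chart_inj[OF U(1)]] by blast
  qed
  have cK': "compactin (mtop M) ?K'"
    using chart_compactin_preimage[OF U(1) compactin_clbox] K by blast
  then have clK': "closedin (mtop M) ?K'"
    using Hausdorff compactin_imp_closedin by blast
  define b where "b x = (if x \<in> U then \<beta> (\<phi> x) else 0)" for x
  have b0: "x \<in> ?K'" if "b x \<noteq> 0" for x
    using that \<beta>(3)[of "\<phi> x"] chart_zero[OF U(1)] by (auto simp: b_def clbox_def split: if_splits)
  have "smooth_on M (carr M) b"
  proof (rule smooth_on_locally)
    fix x assume x: "x \<in> carr M"
    show "\<exists>V. openin (mtop M) V \<and> x \<in> V \<and> V \<subseteq> carr M \<and> smooth_on M V b"
    proof (cases "x \<in> U")
      case True
      have "{x \<in> U. \<phi> x \<in> \<phi> ` U} = U" by auto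
      then have "smooth_on M U (\<lambda>x. \<beta> (\<phi> x))"
        using smooth_on_from_chart[OF U(1) chart_image_open[OF U(1)] \<beta>(1)[OF chart_image_open[OF U(1)]]] by simp
      then have "smooth_on M U b"
        by (rule smooth_on_cong[OF _ chart_open[OF U(1)]]) (simp add: b_def)
      then show ?thesis using True chart_open[OF U(1)] chart_carr[OF U(1)] by blast
    next
      case False
      have V: "openin (mtop M) (carr M - ?K')" using clK' by blast
      moreover have "smooth_on M (carr M - ?K') b"
        by (rule smooth_on_cong[OF smooth_on_const[OF V, of 0] V]) (use b0 in auto)
      ultimately show ?thesis using x False by blast
    qed
  qed simp
  moreover have "b x = 0" if "x \<notin> carr M" for x
    using that chart_carr[OF U(1)] by (auto simp: b_def)
  moreover have "supp M b \<subseteq> ?K'"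
    unfolding supp_def by (rule closure_of_minimal[OF _ clK']) (use b0 in auto)
  ultimately have "b \<in> Cc M W"
    using K'W closed_compactin[OF cK' _ closedin_supp] by (auto simp: Cc_def intro: CinfI)
  let ?B = "{x \<in> U. \<phi> x \<in> obox (mdim M) (\<phi> q) (r / 3)} \<inter> W"
  show thesis
  proof (rule that[OF \<open>b \<in> Cc M W\<close>])
    show "openin (mtop M) ?B"
      using chart_open_preimage[OF U(1) openin_obox] W by (rule openin_Int)
    show "q \<in> ?B" using U q r(1) chart_zero[OF U(1)] by auto
    show "\<forall>x\<in>?B. b x = 1" using \<beta>(2) by (auto simp: b_def)
  qed auto
qed

text \<open>Compactness leaves finitely many bumps to combine, and \<open>f + (1 - f) * g\<close> is
  1 wherever \<open>f\<close> or \<open>g\<close> is. The property \<open>P\<close> is carried along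
  for two uses: the trivial \<open>P\<close> yields a plain bump, and a \<open>P\<close> about
  membership in the module of a foliation shows that membership in the sheaf is local.\<close>

lemma compact_bump_induct:
  assumes K: "compactin (mtop M) K" "K \<subseteq> W"
    and zero: "P (\<lambda>_. 0)"
    and union: "\<And>f g. f \<in> Cc M W \<Longrightarrow> g \<in> Cc M W \<Longrightarrow> P f \<Longrightarrow> P g \<Longrightarrow> P (\<lambda>x. f x + (1 - f x) * g x)"
    and loc: "\<And>x. x \<in> W \<Longrightarrow> \<exists>f B. f \<in> Cc M W \<and> P f \<and> openin (mtop M) B \<and> x \<in> B \<and> (\<forall>y\<in>B. f y = 1)"
  obtains f B where "f \<in> Cc M W" "P f" "openin (mtop M) B" "K \<subseteq> B" "\<forall>y\<in>B. f y = 1"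
proof -
  let ?G = "{B. openin (mtop M) B \<and> (\<exists>f \<in> Cc M W. P f \<and> (\<forall>y\<in>B. f y = 1))}"
  have "\<exists>\<F>. finite \<F> \<and> \<F> \<subseteq> ?G \<and> K \<subseteq> \<Union>\<F>"
  proof (rule compactinD[OF K(1)])
    show "openin (mtop M) B" if "B \<in> ?G" for B
      using that by simp
    show "K \<subseteq> \<Union>?G"
    proof
      fix x assume "x \<in> K"
      then obtain f B where "f \<in> Cc M W" "P f" "openin (mtop M) B" "x \<in> B" "\<forall>y\<in>B. f y = 1"
        using loc K(2) by (meson subsetD)
      then have "B \<in> ?G" by auto
      with \<open>x \<in> B\<close> show "x \<in> \<Union>?G" by (rule UnionI[rotated])
    qed
  qed
  then obtain \<F> where \<F>: "finite \<F>" "\<F> \<subseteq> ?G" "K \<subseteq> \<Union>\<F>" by blast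
  have "\<Union>\<F> \<in> ?G" using \<F>(1,2)
  proof (induction \<F>)
    case empty
    then show ?case using zero zero_in_Cc by auto
  next
    case (insert B \<F>)
    then have G: "B \<in> ?G" "\<Union>\<F> \<in> ?G" by simp_all
    from G(1) obtain f where f: "f \<in> Cc M W" "P f" "\<forall>y\<in>B. f y = 1" by auto
    from G(2) obtain g where g: "g \<in> Cc M W" "P g" "\<forall>y\<in>\<Union>\<F>. g y = 1" by auto
    note fg = f g
    have "(\<lambda>x. f x + (1 - f x) * g x) \<in> Cc M W"
    proof (rule Cc_add[OF fg(1)], rule Cc_dominated[OF fg(4)])
      have fgs: "smooth_on M (carr M) f" "smooth_on M (carr M) g"
        using CcD(1)[OF fg(1)] CcD(1)[OF fg(4)] by (auto intro: Cinf_smooth_on)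
      show "(\<lambda>x. (1 - f x) * g x) \<in> Cinf M (carr M)"
        by (rule CinfI)
           (use fgs Cinf_outside[OF CcD(1)[OF fg(4)]] in \<open>auto intro!: smooth_on_mult smooth_on_diff smooth_on_const\<close>)
    qed auto
    moreover have "P (\<lambda>x. f x + (1 - f x) * g x)"
      by (rule union[OF fg(1,4,2,5)])
    ultimately have "\<exists>f \<in> Cc M W. P f \<and> (\<forall>y\<in>\<Union>(insert B \<F>). f y = 1)"
      using fg by (intro bexI[of _ "\<lambda>x. f x + (1 - f x) * g x"]) auto
    moreover have "openin (mtop M) (\<Union>(insert B \<F>))"
      using insert.prems by (intro openin_Union) auto
    ultimately show ?case by simp
  qed
  then obtain f where "f \<in> Cc M W" "P f" "openin (mtop M) (\<Union>\<F>)" "\<forall>y\<in>\<Union>\<F>. f y = 1" by auto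
  then show thesis using \<F>(3) by (intro that[of f "\<Union>\<F>"]) auto
qed

lemma compact_bump:
  assumes "compactin (mtop M) K" "K \<subseteq> W" "openin (mtop M) W"
  obtains f B where "f \<in> Cc M W" "openin (mtop M) B" "K \<subseteq> B" "\<forall>y\<in>B. f y = 1"
proof -
  have loc: "\<exists>f B. f \<in> Cc M W \<and> True \<and> openin (mtop M) B \<and> x \<in> B \<and> (\<forall>y\<in>B. f y = 1)" if "x \<in> W" for x
    using bump_at[OF assms(3) that] by metis
  show thesis
    by (rule compact_bump_induct[OF assms(1,2), of "\<lambda>_. True", OF _ _ loc]) (auto intro: that)
qed

text \<open>By second countability the cover of \<open>W\<close> by sets on which some bump is 1 has
  a countable subcover. No local finiteness of the sets is asked for.\<close>

lemma bump_sequence: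
  assumes W: "openin (mtop M) W"
  obtains b :: "nat \<Rightarrow> 'a \<Rightarrow> real" and B where "\<And>k. b k \<in> Cc M W" "\<And>k. openin (mtop M) (B k)"
    "\<And>k x. x \<in> B k \<Longrightarrow> b k x = 1" "W = (\<Union>k. B k)"
proof -
  let ?G = "{B. openin (mtop M) B \<and> B \<subseteq> W \<and> (\<exists>f \<in> Cc M W. \<forall>y\<in>B. f y = 1)}"
  have "\<Union>?G \<subseteq> W"
    by (rule Union_least) simp
  have "W \<subseteq> \<Union>?G"
  proof
    fix x assume "x \<in> W"
    obtain b B where "b \<in> Cc M W" "openin (mtop M) B" "x \<in> B" "B \<subseteq> W" "\<forall>y\<in>B. b y = 1"
      using bump_at[OF W \<open>x \<in> W\<close>] by metis
    then have "B \<in> ?G" by auto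
    with \<open>x \<in> B\<close> show "x \<in> \<Union>?G" by (rule UnionI[rotated])
  qed
  moreover have "Lindelof_space (subtopology (mtop M) W)"
    using second_countable second_countable_subtopology second_countable_imp_Lindelof_space by blast
  ultimately have "\<exists>\<V>. countable \<V> \<and> \<V> \<subseteq> ?G \<and> W \<subseteq> \<Union>\<V>"
    using Lindelof_space_subtopology_subset[OF openin_subset[OF W], THEN iffD1, THEN spec[of _ ?G]] by simp
  then obtain \<V> where V: "countable \<V>" "\<V> \<subseteq> ?G" "W \<subseteq> \<Union>\<V>"
    by (elim exE conjE)
  moreover have "\<Union>\<V> \<subseteq> W"
    using Union_mono[OF V(2)] \<open>\<Union>?G \<subseteq> W\<close> by (rule subset_trans)
  ultimately have "\<Union>\<V> = W" by simp
  \<comment> \<open>The empty set, with the bump 0, is added so that the family is nonempty and can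
    be enumerated by the natural numbers, also when \<open>W\<close> is empty.\<close>
  have "{} \<in> ?G" using zero_in_Cc by auto
  with V \<open>\<Union>\<V> = W\<close> have V': "countable (insert {} \<V>)" "insert {} \<V> \<subseteq> ?G" "\<Union>(insert {} \<V>) = W"
    by auto
  define B where "B = from_nat_into (insert {} \<V>)"
  have r: "range B = insert {} \<V>"
    unfolding B_def using V'(1) by (rule range_from_nat_into[OF insert_not_empty])
  have BG: "B k \<in> ?G" for k
    using V'(2) rangeI[of B k] unfolding r by (rule subsetD)
  have "\<exists>f. f \<in> Cc M W \<and> (\<forall>y\<in>B k. f y = 1)" for k using BG[of k] by auto
  then obtain b where b: "\<And>k. b k \<in> Cc M W \<and> (\<forall>y\<in>B k. b k y = 1)" by metis
  moreover have "W = (\<Union>k. B k)" using r V'(3) by simp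
  moreover have "openin (mtop M) (B k)" for k using BG[of k] by simp
  ultimately show thesis using b by (intro that[of b B]) auto
qed

end

section \<open>Tangent and cotangent vectors\<close>

context smooth_mfd
begin

lemma smooth_nearI: "openin (mtop M) W \<Longrightarrow> q \<in> W \<Longrightarrow> smooth_on M W f \<Longrightarrow> smooth_near M q f"
  unfolding smooth_near_def by blast

lemma smooth_nearE:
  assumes "smooth_near M q f" "openin (mtop M) V" "q \<in> V"
  obtains W where "openin (mtop M) W" "q \<in> W" "W \<subseteq> V" "smooth_on M W f"
proof -
  obtain W where W: "openin (mtop M) W" "q \<in> W" "smooth_on M W f"
    using assms(1) by (auto simp: smooth_near_def)
  show thesis
  proof (rule that)
    show WV: "openin (mtop M) (W \<inter> V)" using W(1) assms(2) by (rule openin_Int)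
    show "smooth_on M (W \<inter> V) f" by (rule smooth_on_subset[OF W(3,1) WV]) simp
  qed (use W assms in simp_all)
qed

lemma smooth_near_carr: "smooth_near M q f \<Longrightarrow> q \<in> carr M"
  unfolding smooth_near_def by (elim exE conjE) (drule openin_subset, auto)

lemma smooth_near_const: "q \<in> carr M \<Longrightarrow> smooth_near M q (\<lambda>_. c)"
  by (rule smooth_nearI[OF openin_carr _ smooth_on_const]) auto

lemma
  assumes "smooth_near M q f" "smooth_near M q g"
  shows smooth_near_add: "smooth_near M q (\<lambda>x. f x + g x)"
    and smooth_near_mult: "smooth_near M q (\<lambda>x. f x * g x)"
proof -
  obtain V where V: "openin (mtop M) V" "q \<in> V" "smooth_on M V f"
    using assms(1) by (auto simp: smooth_near_def)
  obtain W where W: "openin (mtop M) W" "q \<in> W" "W \<subseteq> V" "smooth_on M W g"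
    by (rule smooth_nearE[OF assms(2) V(1,2)])
  have f: "smooth_on M W f"
    by (rule smooth_on_subset[OF V(3,1) W(1,3)])
  show "smooth_near M q (\<lambda>x. f x + g x)" "smooth_near M q (\<lambda>x. f x * g x)"
    using W f by (auto intro!: smooth_nearI smooth_on_add smooth_on_mult)
qed

lemma smooth_near_scale: "smooth_near M q f \<Longrightarrow> smooth_near M q (\<lambda>x. c * f x)"
  by (rule smooth_near_mult[OF smooth_near_const[OF smooth_near_carr]])

lemma smooth_near_sum:
  "q \<in> carr M \<Longrightarrow> (\<And>i. i \<in> I \<Longrightarrow> smooth_near M q (f i)) \<Longrightarrow> smooth_near M q (\<lambda>x. \<Sum>i\<in>I. f i x)"
  by (induction I rule: infinite_finite_induct) (simp_all add: smooth_near_const smooth_near_add)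

lemma smooth_near_cong:
  assumes "openin (mtop M) W" "q \<in> W" "\<And>x. x \<in> W \<Longrightarrow> f x = g x" "smooth_near M q f"
  shows "smooth_near M q g"
proof -
  obtain V where V: "openin (mtop M) V" "q \<in> V" "V \<subseteq> W" "smooth_on M V f"
    by (rule smooth_nearE[OF assms(4,1,2)])
  have "smooth_on M V g"
    by (rule smooth_on_cong[OF V(4,1)]) (use V(3) assms(3) in auto)
  then show ?thesis using V by (auto intro: smooth_nearI)
qed

lemma smooth_near_cong_iff:
  assumes "openin (mtop M) W" "q \<in> W" "\<And>x. x \<in> W \<Longrightarrow> f x = g x"
  shows "smooth_near M q f \<longleftrightarrow> smooth_near M q g"
proof
  show "smooth_near M q g" if "smooth_near M q f"
    by (rule smooth_near_cong[OF assms that])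
  show "smooth_near M q f" if "smooth_near M q g"
    by (rule smooth_near_cong[OF assms(1,2) _ that]) (simp add: assms(3))
qed

lemma smooth_near_chart_coord: "(U, \<phi>) \<in> atlas M \<Longrightarrow> q \<in> U \<Longrightarrow> smooth_near M q (\<lambda>x. \<phi> x j)"
  by (rule smooth_nearI[OF chart_open _ smooth_on_chart_coord])

lemma Cinf_smooth_near: "f \<in> Cinf M W \<Longrightarrow> openin (mtop M) W \<Longrightarrow> q \<in> W \<Longrightarrow> smooth_near M q f"
  by (rule smooth_nearI) (auto intro: Cinf_smooth_on)

subsection \<open>Partial derivatives in a chart\<close>

lemma smooth_near_rep:
  assumes "smooth_near M q f" and U: "(U, \<phi>) \<in> atlas M" "q \<in> U"
  obtains S where "openin (Euclidean_space (mdim M)) S" "\<phi> q \<in> S" "S \<subseteq> \<phi> ` U"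
    "Cinf_on (mdim M) S (f \<circ> inv_into U \<phi>)"
proof -
  obtain W where W: "openin (mtop M) W" "q \<in> W" "smooth_on M W f"
    using assms(1) by (auto simp: smooth_near_def)
  show thesis
    by (rule that[OF chart_open_image[OF U(1) W(1)]])
       (use smooth_on_chart[OF W(3) U(1)] U W in \<open>auto simp: o_def\<close>)
qed

context
  fixes U \<phi> q
  assumes U: "(U, \<phi>) \<in> atlas M" "q \<in> U"
begin

lemma partial_rep_cong:
  assumes "openin (mtop M) W" "q \<in> W" "\<And>x. x \<in> W \<Longrightarrow> f x = g x" "i < mdim M"
  shows "partial i (f \<circ> inv_into U \<phi>) (\<phi> q) = partial i (g \<circ> inv_into U \<phi>) (\<phi> q)"
  by (rule partial_cong[OF chart_open_image[OF U(1) assms(1)] _ assms(4)])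
     (use U assms(2,3) in auto)

lemma has_partial_rep:
  assumes "smooth_near M q f" "i < mdim M"
  shows "((\<lambda>t. (f \<circ> inv_into U \<phi>) ((\<phi> q)(i := t))) has_real_derivative
      partial i (f \<circ> inv_into U \<phi>) (\<phi> q)) (at (\<phi> q i))"
proof -
  obtain S where "openin (Euclidean_space (mdim M)) S" "\<phi> q \<in> S" "Cinf_on (mdim M) S (f \<circ> inv_into U \<phi>)"
    using smooth_near_rep[OF assms(1) U] by blast
  then show ?thesis using Cinf_on_has_partial assms(2) by blast
qed

lemma partial_rep_add:
  assumes "smooth_near M q f" "smooth_near M q g" "i < mdim M"
  shows "partial i ((\<lambda>x. f x + g x) \<circ> inv_into U \<phi>) (\<phi> q) =
    partial i (f \<circ> inv_into U \<phi>) (\<phi> q) + partial i (g \<circ> inv_into U \<phi>) (\<phi> q)"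
  by (rule partialI) (use DERIV_add[OF has_partial_rep[OF assms(1,3)] has_partial_rep[OF assms(2,3)]] in \<open>simp add: o_def\<close>)

lemma partial_rep_mult:
  assumes "smooth_near M q f" "smooth_near M q g" "i < mdim M"
  shows "partial i ((\<lambda>x. f x * g x) \<circ> inv_into U \<phi>) (\<phi> q) =
    f q * partial i (g \<circ> inv_into U \<phi>) (\<phi> q) + g q * partial i (f \<circ> inv_into U \<phi>) (\<phi> q)"
  by (rule partialI)
     (use DERIV_mult[OF has_partial_rep[OF assms(1,3)] has_partial_rep[OF assms(2,3)]] U in \<open>simp add: o_def algebra_simps\<close>)

lemma partial_rep_scale:
  assumes "smooth_near M q f" "i < mdim M"
  shows "partial i ((\<lambda>x. c * f x) \<circ> inv_into U \<phi>) (\<phi> q) = c * partial i (f \<circ> inv_into U \<phi>) (\<phi> q)"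
  by (rule partialI) (use DERIV_cmult[OF has_partial_rep[OF assms]] in \<open>simp add: o_def\<close>)

lemma partial_rep_coord:
  assumes "i < mdim M"
  shows "partial i ((\<lambda>x. \<phi> x j) \<circ> inv_into U \<phi>) (\<phi> q) = (if i = j then 1 else 0)"
proof -
  have "partial i ((\<lambda>x. \<phi> x j) \<circ> inv_into U \<phi>) (\<phi> q) = partial i (\<lambda>y. y j) (\<phi> q)"
    by (rule partial_cong[OF chart_image_open[OF U(1)] _ assms]) (use U in \<open>auto simp: f_inv_into_f\<close>)
  then show ?thesis by (simp add: partial_coord)
qed

lemma coord_vec_eq: "smooth_near M q f \<Longrightarrow> coord_vec M (U, \<phi>) i q f = partial i (f \<circ> inv_into U \<phi>) (\<phi> q)"
  by (simp add: coord_vec_def)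

lemma coord_vec_tangent:
  assumes i: "i < mdim M"
  shows "coord_vec M (U, \<phi>) i q \<in> tangent_space M q"
  unfolding tangent_space_def
proof (intro CollectI conjI allI impI)
  let ?v = "coord_vec M (U, \<phi>) i q"
  show "?v f = 0" if "\<not> smooth_near M q f" for f
    using that by (simp add: coord_vec_def)
  show "?v f = ?v g" if "openin (mtop M) W \<and> q \<in> W \<and> (\<forall>x\<in>W. f x = g x)" for f g W
  proof -
    have W: "openin (mtop M) W" "q \<in> W" "\<And>x. x \<in> W \<Longrightarrow> f x = g x" using that by auto
    show ?thesis
      unfolding coord_vec_def using smooth_near_cong_iff[OF W] partial_rep_cong[OF W i] by simp
  qed
  show "?v (\<lambda>x. f x + g x) = ?v f + ?v g" "?v (\<lambda>x. f x * g x) = f q * ?v g + g q * ?v f"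
    if "smooth_near M q f \<and> smooth_near M q g" for f g
    using that i by (simp_all add: coord_vec_eq smooth_near_add smooth_near_mult partial_rep_add partial_rep_mult)
  show "?v (\<lambda>x. c * f x) = c * ?v f" if "smooth_near M q f" for f c
    using that i by (simp add: coord_vec_eq smooth_near_scale partial_rep_scale)
qed

end

subsection \<open>The coordinate basis\<close>

lemma tangent_nonsmooth: "v \<in> tangent_space M q \<Longrightarrow> \<not> smooth_near M q f \<Longrightarrow> v f = 0"
  by (simp add: tangent_space_def)

lemma tangent_cong:
  "v \<in> tangent_space M q \<Longrightarrow> openin (mtop M) W \<Longrightarrow> q \<in> W \<Longrightarrow> (\<And>x. x \<in> W \<Longrightarrow> f x = g x) \<Longrightarrow> v f = v g"
  unfolding tangent_space_def by blast

lemma tangent_add: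
  "v \<in> tangent_space M q \<Longrightarrow> smooth_near M q f \<Longrightarrow> smooth_near M q g \<Longrightarrow> v (\<lambda>x. f x + g x) = v f + v g"
  unfolding tangent_space_def by blast

lemma tangent_mult:
  "v \<in> tangent_space M q \<Longrightarrow> smooth_near M q f \<Longrightarrow> smooth_near M q g \<Longrightarrow>
    v (\<lambda>x. f x * g x) = f q * v g + g q * v f"
  unfolding tangent_space_def by blast

lemma tangent_scale:
  "v \<in> tangent_space M q \<Longrightarrow> smooth_near M q f \<Longrightarrow> v (\<lambda>x. c * f x) = c * v f"
  unfolding tangent_space_def by blast

text \<open>The Leibniz rule for 1 = 1 * 1 forces the value on the constant 1 to equal its
  double.\<close>

lemma tangent_const:
  assumes "v \<in> tangent_space M q" "q \<in> carr M"
  shows "v (\<lambda>_. c) = 0"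
proof -
  have "v (\<lambda>_. 1 * 1) = 1 * v (\<lambda>_. 1) + 1 * v (\<lambda>_. 1)"
    using tangent_mult[OF assms(1) smooth_near_const smooth_near_const] assms(2) by blast
  moreover have "v (\<lambda>_. c * 1) = c * v (\<lambda>_. 1)"
    using tangent_scale[OF assms(1) smooth_near_const[OF assms(2)]] by blast
  ultimately show ?thesis by simp
qed

lemma tangent_sum:
  assumes "v \<in> tangent_space M q" "q \<in> carr M" "\<And>i. i \<in> I \<Longrightarrow> smooth_near M q (f i)"
  shows "v (\<lambda>x. \<Sum>i\<in>I. f i x) = (\<Sum>i\<in>I. v (f i))"
  using assms(3)
  by (induction I rule: infinite_finite_induct)
     (simp_all add: tangent_const[OF assms(1,2)] tangent_add[OF assms(1)] smooth_near_sum[OF assms(2)])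

lemma zero_tangent: "(\<lambda>_. 0) \<in> tangent_space M q"
  by (simp add: tangent_space_def)

lemma add_tangent:
  assumes u: "u \<in> tangent_space M q" and v: "v \<in> tangent_space M q"
  shows "(\<lambda>f. u f + v f) \<in> tangent_space M q"
  unfolding tangent_space_def
proof (intro CollectI conjI allI impI)
  show "u f + v f = u g + v g" if "openin (mtop M) W \<and> q \<in> W \<and> (\<forall>x\<in>W. f x = g x)" for f g W
  proof -
    have W: "openin (mtop M) W" "q \<in> W" "\<And>x. x \<in> W \<Longrightarrow> f x = g x" using that by auto
    show ?thesis by (simp only: tangent_cong[OF u W] tangent_cong[OF v W])
  qed
qed (simp_all add: tangent_nonsmooth[OF u] tangent_nonsmooth[OF v] tangent_add[OF u] tangent_add[OF v]
      tangent_mult[OF u] tangent_mult[OF v] tangent_scale[OF u] tangent_scale[OF v] algebra_simps)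

lemma scale_tangent:
  assumes v: "v \<in> tangent_space M q"
  shows "(\<lambda>f. c * v f) \<in> tangent_space M q"
  unfolding tangent_space_def
proof (intro CollectI conjI allI impI)
  show "c * v f = c * v g" if "openin (mtop M) W \<and> q \<in> W \<and> (\<forall>x\<in>W. f x = g x)" for f g W
  proof -
    have W: "openin (mtop M) W" "q \<in> W" "\<And>x. x \<in> W \<Longrightarrow> f x = g x" using that by auto
    show ?thesis by (simp only: tangent_cong[OF v W])
  qed
qed (simp_all add: tangent_nonsmooth[OF v] tangent_add[OF v] tangent_mult[OF v] tangent_scale[OF v] algebra_simps)

lemma sum_tangent:
  "(\<And>i. i \<in> I \<Longrightarrow> v i \<in> tangent_space M q) \<Longrightarrow> (\<lambda>f. \<Sum>i\<in>I. v i f) \<in> tangent_space M q"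
  by (induction I rule: infinite_finite_induct) (simp_all add: zero_tangent add_tangent)

text \<open>By Hadamard's lemma a derivation is determined by its values on the coordinate functions.\<close>

lemma tangent_expand:
  assumes v: "v \<in> tangent_space M q" and U: "(U, \<phi>) \<in> atlas M" "q \<in> U" and f: "smooth_near M q f"
  shows "v f = (\<Sum>i<mdim M. v (\<lambda>x. \<phi> x i) * partial i (f \<circ> inv_into U \<phi>) (\<phi> q))"
proof -
  let ?n = "mdim M" and ?a = "\<phi> q"
  have q: "q \<in> carr M" using U chart_carr by blast
  obtain S where S: "openin (Euclidean_space ?n) S" "?a \<in> S" "S \<subseteq> \<phi> ` U" "Cinf_on ?n S (f \<circ> inv_into U \<phi>)"
    by (rule smooth_near_rep[OF f U])
  obtain r where r: "r > 0" "obox ?n ?a r \<subseteq> S"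
    by (rule obox_subset[OF S(1,2)])
  have a: "?a \<in> obox ?n ?a r"
    using r(1) chart_zero[OF U] by auto
  obtain g where g: "\<And>j. j < ?n \<Longrightarrow> Cinf_on ?n (obox ?n ?a r) (g j)"
    "\<And>j. j < ?n \<Longrightarrow> g j ?a = partial j (f \<circ> inv_into U \<phi>) ?a"
    "\<And>y. y \<in> obox ?n ?a r \<Longrightarrow> (f \<circ> inv_into U \<phi>) y = (f \<circ> inv_into U \<phi>) ?a + (\<Sum>j<?n. (y j - ?a j) * g j y)"
    using Hadamard[OF Cinf_on_subset[OF S(4,1) openin_obox r(2)] a] by (elim exE conjE) blast
  let ?W = "{x \<in> U. \<phi> x \<in> obox ?n ?a r}"
  have W: "openin (mtop M) ?W" "q \<in> ?W"
    using chart_open_preimage[OF U(1) openin_obox] U a by auto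
  have g_near: "smooth_near M q (\<lambda>x. g j (\<phi> x))" if "j < ?n" for j
    by (rule smooth_nearI[OF W smooth_on_from_chart[OF U(1) openin_obox g(1)[OF that]]])
  have c_near: "smooth_near M q (\<lambda>x. \<phi> x j + (- ?a j))" for j
    by (rule smooth_near_add[OF smooth_near_chart_coord[OF U] smooth_near_const[OF q]])
  have prod_near: "smooth_near M q (\<lambda>x. (\<phi> x j + (- ?a j)) * g j (\<phi> x))" if "j < ?n" for j
    by (rule smooth_near_mult[OF c_near g_near[OF that]])
  then have sum_near: "smooth_near M q (\<lambda>x. \<Sum>j<?n. (\<phi> x j + (- ?a j)) * g j (\<phi> x))"
    by (intro smooth_near_sum[OF q]) simp
  have "v f = v (\<lambda>x. f q + (\<Sum>j<?n. (\<phi> x j + (- ?a j)) * g j (\<phi> x)))"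
  proof (rule tangent_cong[OF v W])
    fix x assume "x \<in> ?W"
    then show "f x = f q + (\<Sum>j<?n. (\<phi> x j + (- ?a j)) * g j (\<phi> x))"
      using g(3)[of "\<phi> x"] U by simp
  qed
  also have "\<dots> = v (\<lambda>_. f q) + v (\<lambda>x. \<Sum>j<?n. (\<phi> x j + (- ?a j)) * g j (\<phi> x))"
    by (rule tangent_add[OF v smooth_near_const[OF q] sum_near])
  also have "v (\<lambda>x. \<Sum>j<?n. (\<phi> x j + (- ?a j)) * g j (\<phi> x)) = (\<Sum>j<?n. v (\<lambda>x. (\<phi> x j + (- ?a j)) * g j (\<phi> x)))"
    by (rule tangent_sum[OF v q prod_near]) simp
  also have "\<dots> = (\<Sum>j<?n. v (\<lambda>x. \<phi> x j) * partial j (f \<circ> inv_into U \<phi>) ?a)"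
  proof (rule sum.cong)
    fix j assume "j \<in> {..<?n}"
    then have j: "j < ?n" by simp
    have "v (\<lambda>x. \<phi> x j + (- ?a j)) = v (\<lambda>x. \<phi> x j) + v (\<lambda>_. - ?a j)"
      by (rule tangent_add[OF v smooth_near_chart_coord[OF U] smooth_near_const[OF q]])
    then have "v (\<lambda>x. \<phi> x j + (- ?a j)) = v (\<lambda>x. \<phi> x j)"
      using tangent_const[OF v q] by simp
    \<comment> \<open>The factor \<open>\<phi> x j - ?a j\<close> is 0 at \<open>q\<close>, so only
      one term of the Leibniz rule survives, and the value of \<open>g j\<close> at
      \<open>?a\<close> is the partial derivative.\<close>
    then show "v (\<lambda>x. (\<phi> x j + (- ?a j)) * g j (\<phi> x)) = v (\<lambda>x. \<phi> x j) * partial j (f \<circ> inv_into U \<phi>) ?a"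
      using tangent_mult[OF v c_near g_near[OF j]] g(2)[OF j] by simp
  qed simp
  finally show ?thesis using tangent_const[OF v q] by simp
qed

lemma tangent_expand_coord_vec:
  assumes v: "v \<in> tangent_space M q" and U: "(U, \<phi>) \<in> atlas M" "q \<in> U"
  shows "v = (\<lambda>f. \<Sum>i<mdim M. v (\<lambda>x. \<phi> x i) * coord_vec M (U, \<phi>) i q f)"
proof
  fix f
  show "v f = (\<Sum>i<mdim M. v (\<lambda>x. \<phi> x i) * coord_vec M (U, \<phi>) i q f)"
  proof (cases "smooth_near M q f")
    case True
    then show ?thesis using tangent_expand[OF v U True] by (simp add: coord_vec_eq[OF U])
  next
    case False
    then show ?thesis using tangent_nonsmooth[OF v] by (simp add: coord_vec_def)
  qed
qed

lemma coord_vec_coord: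
  assumes "(U, \<phi>) \<in> atlas M" "q \<in> U" "i < mdim M"
  shows "coord_vec M (U, \<phi>) i q (\<lambda>x. \<phi> x j) = (if i = j then 1 else 0)"
  using assms by (simp add: coord_vec_eq smooth_near_chart_coord partial_rep_coord)

section \<open>Cotangent vectors in coordinates\<close>

lemma cotangent_add:
  "p \<in> cotangent_space M q \<Longrightarrow> u \<in> tangent_space M q \<Longrightarrow> v \<in> tangent_space M q \<Longrightarrow>
    p (\<lambda>f. u f + v f) = p u + p v"
  unfolding cotangent_space_def by blast

lemma cotangent_scale:
  "p \<in> cotangent_space M q \<Longrightarrow> v \<in> tangent_space M q \<Longrightarrow> p (\<lambda>f. c * v f) = c * p v"
  unfolding cotangent_space_def by blast

lemma cotangent_zero: "p \<in> cotangent_space M q \<Longrightarrow> p (\<lambda>_. 0) = 0"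
  using cotangent_scale[OF _ zero_tangent, of p q 0] by simp

lemma cotangent_sum:
  assumes "p \<in> cotangent_space M q" "\<And>i. i \<in> I \<Longrightarrow> v i \<in> tangent_space M q"
  shows "p (\<lambda>f. \<Sum>i\<in>I. v i f) = (\<Sum>i\<in>I. p (v i))"
  using assms(2)
  by (induction I rule: infinite_finite_induct)
     (simp_all add: cotangent_zero[OF assms(1)] cotangent_add[OF assms(1)] sum_tangent)

lemma cotangent_expand:
  assumes p: "p \<in> cotangent_space M q" and v: "v \<in> tangent_space M q" and U: "(U, \<phi>) \<in> atlas M" "q \<in> U"
  shows "p v = (\<Sum>i<mdim M. v (\<lambda>x. \<phi> x i) * p (coord_vec M (U, \<phi>) i q))"
proof -
  have "p v = p (\<lambda>f. \<Sum>i<mdim M. v (\<lambda>x. \<phi> x i) * coord_vec M (U, \<phi>) i q f)"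
    using tangent_expand_coord_vec[OF v U] by (rule arg_cong)
  also have "\<dots> = (\<Sum>i<mdim M. p (\<lambda>f. v (\<lambda>x. \<phi> x i) * coord_vec M (U, \<phi>) i q f))"
    by (rule cotangent_sum[OF p]) (simp add: scale_tangent coord_vec_tangent[OF U])
  also have "\<dots> = (\<Sum>i<mdim M. v (\<lambda>x. \<phi> x i) * p (coord_vec M (U, \<phi>) i q))"
    by (intro sum.cong refl cotangent_scale[OF p]) (simp add: coord_vec_tangent[OF U])
  finally show ?thesis .
qed

text \<open>The covector with components \<open>y\<close>: the sum of \<open>y i\<close> times the
  differential of the \<open>i\<close>th coordinate. The value 0 off the tangent space follows the
  convention of \<open>cotangent_space\<close>.\<close>

definition covector :: "('a \<Rightarrow> nat \<Rightarrow> real) \<Rightarrow> (nat \<Rightarrow> real) \<Rightarrow> 'a \<Rightarrow> 'a cvec" where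
  "covector \<phi> y q = (\<lambda>v. if v \<in> tangent_space M q then \<Sum>i<mdim M. y i * v (\<lambda>x. \<phi> x i) else 0)"

lemma covector_in: "covector \<phi> y q \<in> cotangent_space M q"
  unfolding cotangent_space_def covector_def
  by (auto simp: add_tangent scale_tangent sum.distrib sum_distrib_left algebra_simps)

lemma covector_coord:
  assumes U: "(U, \<phi>) \<in> atlas M" "q \<in> U" and j: "j < mdim M"
  shows "covector \<phi> y q (coord_vec M (U, \<phi>) j q) = y j"
proof -
  have "covector \<phi> y q (coord_vec M (U, \<phi>) j q) = (\<Sum>i<mdim M. y i * (if j = i then 1 else 0))"
    unfolding covector_def by (simp add: coord_vec_tangent[OF U j] coord_vec_coord[OF U j])
  also have "\<dots> = (\<Sum>i<mdim M. if j = i then y i else 0)"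
    by (rule sum.cong) auto
  also have "\<dots> = y j" using j by simp
  finally show ?thesis .
qed

end

section \<open>The cotangent bundle as a smooth manifold\<close>

definition trunc :: "nat \<Rightarrow> (nat \<Rightarrow> real) \<Rightarrow> nat \<Rightarrow> real" where
  "trunc n x = (\<lambda>i. if i < n then x i else 0)"

text \<open>For \<open>n \<le> m\<close> this is the product of \<open>S\<close> with the space of
  the remaining \<open>m - n\<close> coordinates. With \<open>m = 2 * n\<close> it is the coordinate
  image of the cotangent bundle over the open set with image \<open>S\<close>.\<close>

definition cyl :: "nat \<Rightarrow> nat \<Rightarrow> (nat \<Rightarrow> real) set \<Rightarrow> (nat \<Rightarrow> real) set" where
  "cyl n m S = {x. (\<forall>i\<ge>m. x i = 0) \<and> trunc n x \<in> S}"

lemma openin_Euclidean_preimage: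
  assumes S: "openin (Euclidean_space n) S" and T: "openin (Euclidean_space m) T"
    and G: "continuous_on S G" and GE: "\<And>x i. x \<in> S \<Longrightarrow> i \<ge> m \<Longrightarrow> G x i = 0"
  shows "openin (Euclidean_space n) {x \<in> S. G x \<in> T}"
proof -
  obtain T' where T': "open T'" "T = {x. \<forall>i\<ge>m. x i = 0} \<inter> T'"
    using T by (auto simp: Euclidean_space_eq openin_open)
  have "openin (top_of_set S) (S \<inter> G -` T')"
    by (rule continuous_openin_preimage_gen[OF G T'(1)])
  then have "openin (Euclidean_space n) (S \<inter> G -` T')"
    using S unfolding Euclidean_space_eq by (rule openin_trans)
  moreover have "S \<inter> G -` T' = {x \<in> S. G x \<in> T}"
    using GE T'(2) by auto
  ultimately show ?thesis by simp
qed

lemma openin_cyl: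
  assumes "openin (Euclidean_space n) S"
  shows "openin (Euclidean_space m) (cyl n m S)"
proof -
  let ?E = "{x::nat \<Rightarrow> real. \<forall>i\<ge>m. x i = 0}"
  have E: "openin (Euclidean_space m) ?E"
    by (simp add: Euclidean_space_eq)
  have "continuous_on ?E (trunc n)"
  proof (rule continuous_on_coordinatewise_then_product)
    fix i
    show "continuous_on ?E (\<lambda>x. trunc n x i)"
      by (cases "i < n") (auto simp: trunc_def intro: continuous_on_subset[OF continuous_on_product_coordinates])
  qed
  then have "openin (Euclidean_space m) {x \<in> ?E. trunc n x \<in> S}"
    by (rule openin_Euclidean_preimage[OF E assms]) (simp add: trunc_def)
  then show ?thesis
    by (simp add: cyl_def)
qed

lemma Cinf_on_cyl:
  assumes S: "openin (Euclidean_space n) S" and F: "Cinf_on n S F"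
  shows "Cinf_on m (cyl n m S) (\<lambda>x. F (trunc n x))"
    and "x \<in> cyl n m S \<Longrightarrow> i < m \<Longrightarrow> partial i (\<lambda>x. F (trunc n x)) x = (if i < n then partial i F (trunc n x) else 0)"
proof -
  have c: "openin (Euclidean_space m) (cyl n m S)"
    by (rule openin_cyl[OF S])
  have eq: "(\<lambda>x. trunc n x j) = (\<lambda>x. x j)" if "j < n" for j
    using that by (simp add: trunc_def)
  then have co: "Cinf_on m (cyl n m S) (\<lambda>x. trunc n x j)" if "j < n" for j
    using Cinf_on_coord[OF c, of j] that by simp
  have cS: "trunc n x \<in> S" if "x \<in> cyl n m S" for x
    using that by (simp add: cyl_def)
  show "Cinf_on m (cyl n m S) (\<lambda>x. F (trunc n x))"
    by (rule Cinf_on_compose[OF c S F co cS])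
  assume x: "x \<in> cyl n m S" "i < m"
  have "partial i (\<lambda>x. F (trunc n x)) x = (\<Sum>j<n. partial j F (trunc n x) * partial i (\<lambda>x. trunc n x j) x)"
    by (rule partial_compose[OF c S F co cS x])
  also have "\<dots> = (\<Sum>j<n. if i = j then partial j F (trunc n x) else 0)"
    by (rule sum.cong) (simp_all add: eq partial_coord)
  also have "\<dots> = (if i < n then partial i F (trunc n x) else 0)"
    by simp
  finally show "partial i (\<lambda>x. F (trunc n x)) x = (if i < n then partial i F (trunc n x) else 0)" .
qed

section \<open>Induced charts and their inverses\<close>

definition cdom :: "'a manifold \<Rightarrow> 'a set \<Rightarrow> ('a \<times> 'a cvec) set" where
  "cdom M U = {z \<in> cotangent_carrier M. fst z \<in> U}"

text \<open>The domain \<open>U\<close> is an argument besides \<open>\<phi>\<close> because the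
  coordinate vectors involve the inverse of \<open>\<phi>\<close> on \<open>U\<close>.\<close>

definition cmap :: "'a manifold \<Rightarrow> 'a set \<Rightarrow> ('a \<Rightarrow> nat \<Rightarrow> real) \<Rightarrow> 'a \<times> 'a cvec \<Rightarrow> nat \<Rightarrow> real" where
  "cmap M U \<phi> z = (\<lambda>i. if i < mdim M then \<phi> (fst z) i
     else if i < 2 * mdim M then snd z (coord_vec M (U, \<phi>) (i - mdim M) (fst z)) else 0)"

lemma cotangent_chart_eq: "cotangent_chart M (U, \<phi>) = (cdom M U, cmap M U \<phi>)"
  by (auto simp: cotangent_chart_def cdom_def cmap_def fun_eq_iff)

context smooth_mfd
begin

text \<open>The explicit inverse of the induced chart: \<open>trunc\<close> leads back to the base
  point, and the last coordinates are the components of the covector. Unlike the abstract inverse of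
  the chart it can be computed with.\<close>

definition cinv :: "'a set \<Rightarrow> ('a \<Rightarrow> nat \<Rightarrow> real) \<Rightarrow> (nat \<Rightarrow> real) \<Rightarrow> 'a \<times> 'a cvec" where
  "cinv U \<phi> x = (let q = inv_into U \<phi> (trunc (mdim M) x) in (q, covector \<phi> (\<lambda>i. x (mdim M + i)) q))"

lemma fst_cinv: "fst (cinv U \<phi> x) = inv_into U \<phi> (trunc (mdim M) x)"
  by (simp add: cinv_def Let_def)

lemma cmap_eq_0: "i \<ge> 2 * mdim M \<Longrightarrow> cmap M U \<phi> z i = 0"
  by (simp add: cmap_def)

lemma cdom_Int: "cdom M U \<inter> cdom M V = cdom M (U \<inter> V)"
  by (auto simp: cdom_def)

context
  fixes U \<phi>
  assumes U: "(U, \<phi>) \<in> atlas M"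
begin

lemma trunc_cmap: "z \<in> cdom M U \<Longrightarrow> trunc (mdim M) (cmap M U \<phi> z) = \<phi> (fst z)"
  using chart_zero[OF U] by (auto simp: trunc_def cmap_def cdom_def fun_eq_iff)

text \<open>A cotangent vector is recovered from its values on the coordinate vectors by
  \<open>cotangent_expand\<close>; off the tangent space both forms are 0 by convention.\<close>

lemma cinv_cmap:
  assumes z: "z \<in> cdom M U"
  shows "cinv U \<phi> (cmap M U \<phi> z) = z"
proof -
  obtain q p where zq: "z = (q, p)" by (cases z)
  have q: "q \<in> U" and p: "p \<in> cotangent_space M q"
    using z by (auto simp: zq cdom_def cotangent_carrier_def)
  have "covector \<phi> (\<lambda>i. cmap M U \<phi> z (mdim M + i)) q v = p v" for v
  proof (cases "v \<in> tangent_space M q")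
    case True
    have "(\<Sum>i<mdim M. cmap M U \<phi> z (mdim M + i) * v (\<lambda>x. \<phi> x i)) =
        (\<Sum>i<mdim M. v (\<lambda>x. \<phi> x i) * p (coord_vec M (U, \<phi>) i q))"
      by (rule sum.cong) (auto simp: cmap_def zq)
    then show ?thesis
      using cotangent_expand[OF p True U q] True by (simp add: covector_def)
  next
    case False
    then show ?thesis using p by (simp add: covector_def cotangent_space_def)
  qed
  then have "covector \<phi> (\<lambda>i. cmap M U \<phi> z (mdim M + i)) q = p" by blast
  then show ?thesis
    using chart_inv[OF U q] trunc_cmap[OF z] by (simp add: cinv_def zq)
qed

lemma cinv_in: "x \<in> cyl (mdim M) (2 * mdim M) (\<phi> ` (U \<inter> W)) \<Longrightarrow> cinv U \<phi> x \<in> cdom M (U \<inter> W)"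
  using covector_in chart_carr[OF U] chart_inv[OF U]
  by (auto simp: cinv_def cdom_def cotangent_carrier_def cyl_def Let_def)

lemma cmap_cinv:
  assumes x: "x \<in> cyl (mdim M) (2 * mdim M) (\<phi> ` U)"
  shows "cmap M U \<phi> (cinv U \<phi> x) = x"
proof
  fix i
  obtain q where q: "q \<in> U" "trunc (mdim M) x = \<phi> q"
    using x by (auto simp: cyl_def)
  have *: "cinv U \<phi> x = (q, covector \<phi> (\<lambda>i. x (mdim M + i)) q)"
    by (simp add: cinv_def q(2) chart_inv[OF U q(1)])
  consider "i < mdim M" | "mdim M \<le> i" "i < 2 * mdim M" | "2 * mdim M \<le> i" by linarith
  then show "cmap M U \<phi> (cinv U \<phi> x) i = x i"
  proof cases
    case 1
    then show ?thesis using q(2)[symmetric] by (simp add: * cmap_def trunc_def)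
  next
    case 2
    then show ?thesis using covector_coord[OF U q(1), of "i - mdim M"] by (simp add: * cmap_def)
  next
    case 3
    then show ?thesis using x by (simp add: cmap_def cyl_def)
  qed
qed

lemma cmap_in: "z \<in> cdom M U \<Longrightarrow> fst z \<in> W \<Longrightarrow> cmap M U \<phi> z \<in> cyl (mdim M) (2 * mdim M) (\<phi> ` (U \<inter> W))"
  unfolding cyl_def by (auto simp: trunc_cmap cmap_eq_0) (auto simp: cdom_def)

lemma cmap_image: "cmap M U \<phi> ` cdom M (U \<inter> W) = cyl (mdim M) (2 * mdim M) (\<phi> ` (U \<inter> W))"
proof
  show "cmap M U \<phi> ` cdom M (U \<inter> W) \<subseteq> cyl (mdim M) (2 * mdim M) (\<phi> ` (U \<inter> W))"
    by (rule image_subsetI, rule cmap_in) (auto simp: cdom_def)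
  show "cyl (mdim M) (2 * mdim M) (\<phi> ` (U \<inter> W)) \<subseteq> cmap M U \<phi> ` cdom M (U \<inter> W)"
  proof
    fix x assume x: "x \<in> cyl (mdim M) (2 * mdim M) (\<phi> ` (U \<inter> W))"
    then have "x = cmap M U \<phi> (cinv U \<phi> x)"
      by (subst cmap_cinv) (auto simp: cyl_def)
    then show "x \<in> cmap M U \<phi> ` cdom M (U \<inter> W)" using cinv_in[OF x] by (rule image_eqI)
  qed
qed

lemma cmap_image_cdom: "cmap M U \<phi> ` cdom M U = cyl (mdim M) (2 * mdim M) (\<phi> ` U)"
  using cmap_image[of U] by simp

lemma cmap_inj: "inj_on (cmap M U \<phi>) (cdom M U)"
  by (rule inj_on_inverseI[of _ "cinv U \<phi>"]) (rule cinv_cmap)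

lemma inv_into_cmap:
  assumes "x \<in> cyl (mdim M) (2 * mdim M) (\<phi> ` U)"
  shows "inv_into (cdom M U) (cmap M U \<phi>) x = cinv U \<phi> x"
  by (rule inv_into_f_eq[OF cmap_inj]) (use assms cinv_in[of x U] cmap_cinv in auto)

lemma cmap_image_open: "openin (Euclidean_space (2 * mdim M)) (cmap M U \<phi> ` cdom M U)"
  unfolding cmap_image_cdom by (rule openin_cyl[OF chart_image_open[OF U]])

end

subsection \<open>Transition maps\<close>

context
  fixes U \<phi> V \<psi>
  assumes U: "(U, \<phi>) \<in> atlas M" and V: "(V, \<psi>) \<in> atlas M"
begin

lemma cmap_cinv_base:
  assumes x: "x \<in> cyl (mdim M) (2 * mdim M) (\<phi> ` (U \<inter> V))" and j: "j < mdim M"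
  shows "cmap M V \<psi> (cinv U \<phi> x) j = \<psi> (inv_into U \<phi> (trunc (mdim M) x)) j"
  using j by (simp add: cmap_def cinv_def Let_def)

text \<open>Momenta transform with the transposed Jacobian of the inverse base transition: a
  coordinate vector of the new chart acts on the old coordinate functions by their partial
  derivatives in the new chart.\<close>

lemma cmap_cinv_fibre:
  assumes x: "x \<in> cyl (mdim M) (2 * mdim M) (\<phi> ` (U \<inter> V))" and j: "j < mdim M"
  shows "cmap M V \<psi> (cinv U \<phi> x) (mdim M + j) =
    (\<Sum>i<mdim M. x (mdim M + i) *
       partial j (\<lambda>y. \<phi> (inv_into V \<psi> y) i) (\<psi> (inv_into U \<phi> (trunc (mdim M) x))))"
proof -
  obtain q where q: "q \<in> U" "q \<in> V" "trunc (mdim M) x = \<phi> q"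
    using x by (auto simp: cyl_def)
  have "cmap M V \<psi> (cinv U \<phi> x) (mdim M + j) = covector \<phi> (\<lambda>i. x (mdim M + i)) q (coord_vec M (V, \<psi>) j q)"
    using j by (simp add: cmap_def cinv_def q(3) chart_inv[OF U q(1)])
  also have "\<dots> = (\<Sum>i<mdim M. x (mdim M + i) * partial j ((\<lambda>x. \<phi> x i) \<circ> inv_into V \<psi>) (\<psi> q))"
    by (simp add: covector_def coord_vec_tangent[OF V q(2) j] coord_vec_eq[OF V q(2)] smooth_near_chart_coord[OF U q(1)])
  finally show ?thesis
    by (simp add: o_def q(3) chart_inv[OF U q(1)])
qed

lemma transition_open: "openin (Euclidean_space (mdim M)) (\<phi> ` (U \<inter> V))"
  by (rule chart_open_image[OF U chart_open[OF V]])

text \<open>New positions depend on the old positions only. New momenta are linear in the old ones,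
  with coefficients that are derivatives of the inverse transition read at the transformed base
  point.\<close>

lemma transition_smooth:
  assumes j: "j < 2 * mdim M"
  shows "Cinf_on (2 * mdim M) (cyl (mdim M) (2 * mdim M) (\<phi> ` (U \<inter> V))) (\<lambda>x. cmap M V \<psi> (cinv U \<phi> x) j)"
proof -
  let ?n = "mdim M" and ?S = "\<phi> ` (U \<inter> V)"
  let ?C = "cyl ?n (2 * ?n) ?S"
  have C: "openin (Euclidean_space (2 * ?n)) ?C"
    by (rule openin_cyl[OF transition_open])
  have A: "Cinf_on (2 * ?n) ?C (\<lambda>x. \<psi> (inv_into U \<phi> (trunc ?n x)) k)" if "k < ?n" for k
    by (rule Cinf_on_cyl(1)[OF transition_open chart_transition[OF U V that]])
  show ?thesis
  proof (cases "j < ?n")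
    case True
    then show ?thesis
      using A[OF True] by (subst Cinf_on_cong[OF C]) (auto simp: cmap_cinv_base)
  next
    case False
    then obtain k where k: "j = ?n + k" "k < ?n"
      using j by (metis add_less_cancel_left le_add_diff_inverse mult_2 not_less)
    have VU: "openin (Euclidean_space ?n) (\<psi> ` (V \<inter> U))"
      by (rule chart_open_image[OF V chart_open[OF U]])
    have "Cinf_on (2 * ?n) ?C (\<lambda>x. partial k (\<lambda>y. \<phi> (inv_into V \<psi> y) i) (\<psi> (inv_into U \<phi> (trunc ?n x))))"
      if "i < ?n" for i
    proof (rule Cinf_on_compose[OF C VU Cinf_on_partial[OF chart_transition[OF V U that] VU k(2)]])
      show "Cinf_on (2 * ?n) ?C (\<lambda>x. \<psi> (inv_into U \<phi> (trunc ?n x)) j)" if "j < ?n" for j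
        by (rule A[OF that])
      show "\<psi> (inv_into U \<phi> (trunc ?n x)) \<in> \<psi> ` (V \<inter> U)" if "x \<in> ?C" for x
        using that chart_inv[OF U] by (auto simp: cyl_def)
    qed
    then have "Cinf_on (2 * ?n) ?C (\<lambda>x. \<Sum>i<?n. x (?n + i) *
        partial k (\<lambda>y. \<phi> (inv_into V \<psi> y) i) (\<psi> (inv_into U \<phi> (trunc ?n x))))"
      by (intro Cinf_on_sum[OF C] Cinf_on_mult[OF C] Cinf_on_coord[OF C]) auto
    then show ?thesis
      by (subst Cinf_on_cong[OF C]) (auto simp: cmap_cinv_fibre k)
  qed
qed

lemma transition_in:
  assumes "x \<in> cyl (mdim M) (2 * mdim M) (\<phi> ` (U \<inter> V))"
  shows "cmap M V \<psi> (cinv U \<phi> x) \<in> cyl (mdim M) (2 * mdim M) (\<psi> ` (V \<inter> U))"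
  using cinv_in[OF U assms] by (intro cmap_in[OF V]) (auto simp: cdom_def)

lemma transition_continuous:
  "continuous_on (cyl (mdim M) (2 * mdim M) (\<phi> ` (U \<inter> V))) (\<lambda>x. cmap M V \<psi> (cinv U \<phi> x))"
  by (rule continuous_on_into_Euclidean[OF openin_cyl[OF transition_open]
        openin_cyl[OF chart_open_image[OF V chart_open[OF U]]] transition_smooth transition_in])

end

subsection \<open>Topology\<close>

lemma mdim_cotangent: "mdim (cotangent_bundle M) = 2 * mdim M"
  by (simp add: cotangent_bundle_def)

lemma atlas_cotangent: "atlas (cotangent_bundle M) = {(cdom M U, cmap M U \<phi>) | U \<phi>. (U, \<phi>) \<in> atlas M}"
  by (force simp: cotangent_bundle_def cotangent_chart_eq image_iff)

lemma cotangent_basic_open: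
  assumes "(U, \<phi>) \<in> atlas M" "openin (Euclidean_space (2 * mdim M)) V"
  shows "openin (mtop (cotangent_bundle M)) {z \<in> cdom M U. cmap M U \<phi> z \<in> V}"
  unfolding cotangent_bundle_def manifold.simps
  by (rule topology_generated_by_Basis)
     (use assms in \<open>force simp: cotangent_chart_eq image_iff\<close>)

text \<open>This amounts to continuity of the bundle projection. Each chart contributes a set that
  is open by construction, the preimage of a cylinder.\<close>

lemma cotangent_open_preimage_fst:
  assumes W: "openin (mtop M) W"
  shows "openin (mtop (cotangent_bundle M)) (cdom M W)"
proof -
  have "cdom M W = (\<Union>(U, \<phi>)\<in>atlas M. {z \<in> cdom M U. cmap M U \<phi> z \<in> cyl (mdim M) (2 * mdim M) (\<phi> ` (U \<inter> W))})"
    (is "_ = ?R")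
  proof (intro set_eqI iffI)
    fix z assume z: "z \<in> cdom M W"
    then have "fst z \<in> carr M"
      using openin_subset[OF W] by (auto simp: cdom_def)
    then obtain U \<phi> where U: "(U, \<phi>) \<in> atlas M" "fst z \<in> U"
      using chart_cover by blast
    then have "z \<in> cdom M U" "fst z \<in> W" using z by (auto simp: cdom_def)
    with U(1) cmap_in[OF U(1) this] show "z \<in> ?R"
      by (intro UN_I[of "(U, \<phi>)"]) auto
  next
    fix z assume "z \<in> ?R"
    then obtain U \<phi> where U: "(U, \<phi>) \<in> atlas M" and z: "z \<in> cdom M U"
      "cmap M U \<phi> z \<in> cyl (mdim M) (2 * mdim M) (\<phi> ` (U \<inter> W))"
      by blast
    have "\<phi> (fst z) \<in> \<phi> ` (U \<inter> W)"
      using z trunc_cmap[OF U z(1)] by (simp add: cyl_def)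
    moreover have "fst z \<in> U" using z(1) by (simp add: cdom_def)
    ultimately have "fst z \<in> W" using inj_onD[OF chart_inj[OF U]] by blast
    then show "z \<in> cdom M W" using z(1) by (simp add: cdom_def)
  qed
  moreover have "openin (mtop (cotangent_bundle M)) ?R"
    by (rule openin_Union)
       (auto intro!: cotangent_basic_open openin_cyl chart_open_image W)
  ultimately show ?thesis by simp
qed

lemma carr_cotangent: "carr (cotangent_bundle M) = cotangent_carrier M"
proof
  show "carr (cotangent_bundle M) \<subseteq> cotangent_carrier M"
    by (auto simp: cotangent_bundle_def cotangent_chart_eq cdom_def)
  have "cdom M (carr M) = cotangent_carrier M"
    by (auto simp: cdom_def cotangent_carrier_def)
  then show "cotangent_carrier M \<subseteq> carr (cotangent_bundle M)"
    using openin_subset[OF cotangent_open_preimage_fst[OF openin_carr]] by simp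
qed

text \<open>Induction over the generation of the topology: the chart is injective, so images commute
  with intersections, and the image of a basic set is the preimage of an open set under a continuous
  transition map.\<close>

lemma cotangent_open_image:
  assumes "openin (mtop (cotangent_bundle M)) W" and U: "(U, \<phi>) \<in> atlas M"
  shows "openin (Euclidean_space (2 * mdim M)) (cmap M U \<phi> ` (cdom M U \<inter> W))"
proof -
  have "generate_topology_on {{z \<in> D. \<Phi> z \<in> V} | D \<Phi> V.
           (D, \<Phi>) \<in> cotangent_chart M ` atlas M \<and> openin (Euclidean_space (2 * mdim M)) V} W"
    using assms(1) by (simp add: cotangent_bundle_def openin_topology_generated_by_iff)
  then show ?thesis
  proof induction
    case Empty
    show ?case by simp
  next
    case (Int a b)
    have "cmap M U \<phi> ` (cdom M U \<inter> (a \<inter> b)) = cmap M U \<phi> ` (cdom M U \<inter> a) \<inter> cmap M U \<phi> ` (cdom M U \<inter> b)"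
      using inj_on_image_Int[OF cmap_inj[OF U], of "cdom M U \<inter> a" "cdom M U \<inter> b"] by (simp add: Int_ac)
    then show ?case using Int.IH by (simp add: openin_Int)
  next
    case (UN K)
    have "cmap M U \<phi> ` (cdom M U \<inter> \<Union>K) = (\<Union>k\<in>K. cmap M U \<phi> ` (cdom M U \<inter> k))"
      by blast
    then show ?case using UN.IH by auto
  next
    case (Basis s)
    then obtain V \<psi> T where V: "(V, \<psi>) \<in> atlas M" and T: "openin (Euclidean_space (2 * mdim M)) T"
      and s: "s = {z \<in> cdom M V. cmap M V \<psi> z \<in> T}"
      by (auto simp: cotangent_chart_eq)
    let ?C = "cyl (mdim M) (2 * mdim M) (\<phi> ` (U \<inter> V))"
    have "cmap M U \<phi> ` (cdom M U \<inter> s) = {x \<in> ?C. cmap M V \<psi> (cinv U \<phi> x) \<in> T}"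
    proof (intro set_eqI iffI)
      fix x assume "x \<in> cmap M U \<phi> ` (cdom M U \<inter> s)"
      then obtain z where "z \<in> cdom M U" "z \<in> cdom M V" "cmap M V \<psi> z \<in> T" "x = cmap M U \<phi> z"
        by (auto simp: s)
      then show "x \<in> {x \<in> ?C. cmap M V \<psi> (cinv U \<phi> x) \<in> T}"
        using cmap_in[OF U, of z V] cinv_cmap[OF U] by (simp add: cdom_def)
    next
      fix x assume x: "x \<in> {x \<in> ?C. cmap M V \<psi> (cinv U \<phi> x) \<in> T}"
      then have "cinv U \<phi> x \<in> cdom M (U \<inter> V)" using cinv_in[OF U] by blast
      then have "cinv U \<phi> x \<in> cdom M U \<inter> s" using x by (auto simp: s cdom_def)
      moreover have "x \<in> cyl (mdim M) (2 * mdim M) (\<phi> ` U)" using x by (auto simp: cyl_def)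
      ultimately show "x \<in> cmap M U \<phi> ` (cdom M U \<inter> s)"
        using cmap_cinv[OF U] by (metis image_eqI)
    qed
    moreover have "openin (Euclidean_space (2 * mdim M)) {x \<in> ?C. cmap M V \<psi> (cinv U \<phi> x) \<in> T}"
      by (rule openin_Euclidean_preimage[OF openin_cyl[OF transition_open[OF U V]] T transition_continuous[OF U V]])
         (simp add: cmap_eq_0)
    ultimately show ?case by simp
  qed
qed

lemma cotangent_is_chart:
  assumes U: "(U, \<phi>) \<in> atlas M"
  shows "is_chart (mtop (cotangent_bundle M)) (2 * mdim M) (cdom M U, cmap M U \<phi>)"
proof -
  let ?P = "mtop (cotangent_bundle M)" and ?E = "Euclidean_space (2 * mdim M)"
  have D: "openin ?P (cdom M U)"
    by (rule cotangent_open_preimage_fst[OF chart_open[OF U]])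
  then have Dsub: "topspace (subtopology ?P (cdom M U)) = cdom M U"
    using openin_subset by auto
  have im: "openin ?E (cmap M U \<phi> ` cdom M U)"
    by (rule cmap_image_open[OF U])
  have "homeomorphic_map (subtopology ?P (cdom M U)) (subtopology ?E (cmap M U \<phi> ` cdom M U)) (cmap M U \<phi>)"
  proof (rule bijective_open_imp_homeomorphic_map)
    show "continuous_map (subtopology ?P (cdom M U)) (subtopology ?E (cmap M U \<phi> ` cdom M U)) (cmap M U \<phi>)"
      unfolding continuous_map_in_subtopology
    proof
      show "continuous_map (subtopology ?P (cdom M U)) ?E (cmap M U \<phi>)"
        unfolding continuous_map
      proof (intro conjI allI impI)
        show "cmap M U \<phi> ` topspace (subtopology ?P (cdom M U)) \<subseteq> topspace ?E"
          unfolding Dsub by (rule openin_subset[OF im])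
        fix V assume "openin ?E V"
        then have "openin ?P {z \<in> cdom M U. cmap M U \<phi> z \<in> V}"
          by (rule cotangent_basic_open[OF U])
        then show "openin (subtopology ?P (cdom M U)) {x \<in> topspace (subtopology ?P (cdom M U)). cmap M U \<phi> x \<in> V}"
          unfolding Dsub by (simp add: openin_open_subtopology[OF D])
      qed
      show "cmap M U \<phi> \<in> topspace (subtopology ?P (cdom M U)) \<rightarrow> cmap M U \<phi> ` cdom M U"
        unfolding Dsub by blast
    qed
    show "open_map (subtopology ?P (cdom M U)) (subtopology ?E (cmap M U \<phi> ` cdom M U)) (cmap M U \<phi>)"
      unfolding open_map_def
    proof (intro allI impI)
      fix W assume "openin (subtopology ?P (cdom M U)) W"
      then have W: "openin ?P W" "W \<subseteq> cdom M U"
        by (auto simp: openin_open_subtopology[OF D])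
      then have "cdom M U \<inter> W = W" by blast
      then have "openin ?E (cmap M U \<phi> ` W)"
        using cotangent_open_image[OF W(1) U] by simp
      then show "openin (subtopology ?E (cmap M U \<phi> ` cdom M U)) (cmap M U \<phi> ` W)"
        using W(2) by (auto simp: openin_open_subtopology[OF im])
    qed
    show "cmap M U \<phi> ` topspace (subtopology ?P (cdom M U)) =
        topspace (subtopology ?E (cmap M U \<phi> ` cdom M U))"
      unfolding Dsub using openin_subset[OF im] by auto
    show "inj_on (cmap M U \<phi>) (topspace (subtopology ?P (cdom M U)))"
      unfolding Dsub by (rule cmap_inj[OF U])
  qed
  then show ?thesis
    using D im by (simp add: is_chart_def)
qed

text \<open>Points over different base points are separated by sets pulled back from
  \<open>M\<close>; two covectors at the same base point lie in one chart, where the model space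
  separates them.\<close>

lemma cotangent_Hausdorff: "Hausdorff_space (mtop (cotangent_bundle M))"
  unfolding Hausdorff_space_def
proof (intro allI impI)
  fix z w assume zw: "z \<in> carr (cotangent_bundle M) \<and> w \<in> carr (cotangent_bundle M) \<and> z \<noteq> w"
  then have z: "z \<in> cotangent_carrier M" "w \<in> cotangent_carrier M" "z \<noteq> w"
    by (auto simp: carr_cotangent)
  then have c: "fst z \<in> carr M" "fst w \<in> carr M"
    by (auto simp: cotangent_carrier_def)
  show "\<exists>A B. openin (mtop (cotangent_bundle M)) A \<and> openin (mtop (cotangent_bundle M)) B \<and> z \<in> A \<and> w \<in> B \<and> disjnt A B"
  proof (cases "fst z = fst w")
    case False
    then obtain A B where AB: "openin (mtop M) A" "openin (mtop M) B" "fst z \<in> A" "fst w \<in> B" "disjnt A B"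
      using Hausdorff c unfolding Hausdorff_space_def by blast
    show ?thesis
      by (intro exI[of _ "cdom M A"] exI[of _ "cdom M B"] conjI cotangent_open_preimage_fst AB)
         (use AB z in \<open>auto simp: cdom_def disjnt_iff\<close>)
  next
    case True
    obtain U \<phi> where U: "(U, \<phi>) \<in> atlas M" "fst z \<in> U"
      using chart_cover[OF c(1)] by blast
    then have d: "z \<in> cdom M U" "w \<in> cdom M U"
      using z True by (auto simp: cdom_def)
    have "cmap M U \<phi> z \<noteq> cmap M U \<phi> w"
      using inj_onD[OF cmap_inj[OF U(1)] _ d] z(3) by blast
    moreover have "cmap M U \<phi> z \<in> topspace (Euclidean_space (2 * mdim M))" "cmap M U \<phi> w \<in> topspace (Euclidean_space (2 * mdim M))"
      using openin_subset[OF cmap_image_open[OF U(1)]] d by blast+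
    ultimately obtain A B where AB: "openin (Euclidean_space (2 * mdim M)) A" "openin (Euclidean_space (2 * mdim M)) B"
      "cmap M U \<phi> z \<in> A" "cmap M U \<phi> w \<in> B" "disjnt A B"
      using Hausdorff_Euclidean_space[of "2 * mdim M"] unfolding Hausdorff_space_def by blast
    show ?thesis
      by (rule exI[of _ "{z \<in> cdom M U. cmap M U \<phi> z \<in> A}"], rule exI[of _ "{z \<in> cdom M U. cmap M U \<phi> z \<in> B}"])
         (use AB d U in \<open>auto simp: cotangent_basic_open disjnt_iff\<close>)
  qed
qed

text \<open>Countably many chart domains cover \<open>M\<close> by the Lindelof property; the
  preimages of a countable basis of the sequence space under their induced charts form a countable
  basis.\<close>

lemma cotangent_second_countable: "second_countable (mtop (cotangent_bundle M))"
proof -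
  let ?P = "mtop (cotangent_bundle M)" and ?E = "{x::nat \<Rightarrow> real. \<forall>i\<ge>2 * mdim M. x i = 0}"
  have "Lindelof_space (mtop M)"
    by (rule second_countable_imp_Lindelof_space[OF second_countable])
  moreover have "\<forall>U\<in>fst ` atlas M. openin (mtop M) U" "\<Union>(fst ` atlas M) = carr M"
    using smooth_manifold chart_open by (auto simp: smooth_manifold_def)
  ultimately obtain \<V> where \<V>: "countable \<V>" "\<V> \<subseteq> fst ` atlas M" "\<Union>\<V> = carr M"
    unfolding Lindelof_space_def by meson
  have "\<exists>\<phi>. (U, \<phi>) \<in> atlas M" if "U \<in> \<V>" for U
    using \<V>(2) that by force
  then obtain \<phi> where \<phi>: "\<And>U. U \<in> \<V> \<Longrightarrow> (U, \<phi> U) \<in> atlas M"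
    by metis
  obtain \<B> :: "(nat \<Rightarrow> real) set set" where \<B>: "countable \<B>" "topological_basis \<B>"
    using ex_countable_basis by blast
  let ?f = "\<lambda>(U, V). {z \<in> cdom M U. cmap M U (\<phi> U) z \<in> ?E \<inter> V}"
  show ?thesis
    unfolding second_countable_def
  proof (intro exI conjI ballI allI impI)
    show "countable (?f ` (\<V> \<times> \<B>))"
      using \<V>(1) \<B>(1) by (intro countable_image countable_SIGMA) auto
    show "openin ?P W" if "W \<in> ?f ` (\<V> \<times> \<B>)" for W
    proof -
      obtain U V where UV: "U \<in> \<V>" "V \<in> \<B>" "W = {z \<in> cdom M U. cmap M U (\<phi> U) z \<in> ?E \<inter> V}"
        using \<open>W \<in> ?f ` (\<V> \<times> \<B>)\<close> by auto
      have "openin (Euclidean_space (2 * mdim M)) (?E \<inter> V)"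
        unfolding Euclidean_space_eq using topological_basis_open[OF \<B>(2) UV(2)] by (rule openin_open_Int)
      then show ?thesis
        unfolding UV(3) by (rule cotangent_basic_open[OF \<phi>[OF UV(1)]])
    qed
    fix W z assume Wz: "openin ?P W \<and> z \<in> W"
    then have z: "z \<in> cotangent_carrier M"
      using openin_subset[of ?P W] carr_cotangent by auto
    then have "fst z \<in> carr M" by (auto simp: cotangent_carrier_def)
    then obtain U where U: "U \<in> \<V>" "fst z \<in> U" using \<V>(3) by blast
    note UA = \<phi>[OF U(1)]
    have d: "z \<in> cdom M U" using z U(2) by (simp add: cdom_def)
    obtain T where T: "open T" "cmap M U (\<phi> U) ` (cdom M U \<inter> W) = ?E \<inter> T"
      using cotangent_open_image[OF conjunct1[OF Wz] UA] by (auto simp: Euclidean_space_eq openin_open)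
    have "cmap M U (\<phi> U) z \<in> T" using T(2) d Wz by blast
    then obtain B where B: "B \<in> \<B>" "cmap M U (\<phi> U) z \<in> B" "B \<subseteq> T"
      by (rule topological_basisE[OF \<B>(2) T(1)])
    have "?f (U, B) \<subseteq> W"
    proof
      fix w assume "w \<in> ?f (U, B)"
      then have w: "w \<in> cdom M U" "cmap M U (\<phi> U) w \<in> ?E \<inter> T" using B(3) by auto
      then have "cmap M U (\<phi> U) w \<in> cmap M U (\<phi> U) ` (cdom M U \<inter> W)" using T(2) by simp
      then show "w \<in> W"
        using inj_on_image_mem_iff[OF cmap_inj[OF UA] w(1), of "cdom M U \<inter> W"] by simp
    qed
    moreover have "z \<in> ?f (U, B)" using d B(2) by (auto simp: cmap_eq_0)
    ultimately show "\<exists>V\<in>?f ` (\<V> \<times> \<B>). z \<in> V \<and> V \<subseteq> W"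
      using U(1) B(1) by (intro bexI[of _ "?f (U, B)"]) auto
  qed
qed

lemma smooth_manifold_cotangent: "smooth_manifold (cotangent_bundle M)"
  unfolding smooth_manifold_def
proof (intro conjI ballI)
  show "Hausdorff_space (mtop (cotangent_bundle M))" by (rule cotangent_Hausdorff)
  show "second_countable (mtop (cotangent_bundle M))" by (rule cotangent_second_countable)
  show "is_chart (mtop (cotangent_bundle M)) (mdim (cotangent_bundle M)) c" if "c \<in> atlas (cotangent_bundle M)" for c
    using that cotangent_is_chart by (auto simp: atlas_cotangent mdim_cotangent)
  show "(\<Union>c\<in>atlas (cotangent_bundle M). fst c) = carr (cotangent_bundle M)"
  proof
    show "(\<Union>c\<in>atlas (cotangent_bundle M). fst c) \<subseteq> carr (cotangent_bundle M)"
      by (auto simp: atlas_cotangent carr_cotangent cdom_def)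
    show "carr (cotangent_bundle M) \<subseteq> (\<Union>c\<in>atlas (cotangent_bundle M). fst c)"
    proof
      fix z assume "z \<in> carr (cotangent_bundle M)"
      then have z: "z \<in> cotangent_carrier M" by (simp add: carr_cotangent)
      then have "fst z \<in> carr M" by (auto simp: cotangent_carrier_def)
      then obtain U \<phi> where U: "(U, \<phi>) \<in> atlas M" "fst z \<in> U"
        using chart_cover by blast
      then have "(cdom M U, cmap M U \<phi>) \<in> atlas (cotangent_bundle M)" "z \<in> cdom M U"
        using z by (auto simp: atlas_cotangent cdom_def)
      then show "z \<in> (\<Union>c\<in>atlas (cotangent_bundle M). fst c)"
        by (intro UN_I[of "(cdom M U, cmap M U \<phi>)"]) auto
    qed
  qed
  fix c d assume "c \<in> atlas (cotangent_bundle M)" "d \<in> atlas (cotangent_bundle M)"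
  then obtain U \<phi> V \<psi> where U: "(U, \<phi>) \<in> atlas M" "c = (cdom M U, cmap M U \<phi>)"
    and V: "(V, \<psi>) \<in> atlas M" "d = (cdom M V, cmap M V \<psi>)"
    by (auto simp: atlas_cotangent)
  have "Cinf_on (2 * mdim M) (cyl (mdim M) (2 * mdim M) (\<phi> ` (U \<inter> V)))
      (\<lambda>x. cmap M V \<psi> (inv_into (cdom M U) (cmap M U \<phi>) x) j)" if "j < 2 * mdim M" for j
  proof -
    have "\<forall>x\<in>cyl (mdim M) (2 * mdim M) (\<phi> ` (U \<inter> V)).
        cmap M V \<psi> (inv_into (cdom M U) (cmap M U \<phi>) x) j = cmap M V \<psi> (cinv U \<phi> x) j"
      using inv_into_cmap[OF U(1)] by (auto simp: cyl_def)
    from Cinf_on_cong[OF openin_cyl[OF transition_open[OF U(1) V(1)]] this] show ?thesis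
      using transition_smooth[OF U(1) V(1) that] by simp
  qed
  then show "compatible_charts (mdim (cotangent_bundle M)) c d"
    by (simp add: compatible_charts_def U(2) V(2) mdim_cotangent cdom_Int cmap_image[OF U(1)])
qed

end

section \<open>The Poisson bracket in canonical coordinates\<close>

definition pb :: "nat \<Rightarrow> ((nat \<Rightarrow> real) \<Rightarrow> real) \<Rightarrow> ((nat \<Rightarrow> real) \<Rightarrow> real) \<Rightarrow> (nat \<Rightarrow> real) \<Rightarrow> real" where
  "pb n f g x = (\<Sum>i<n. partial (n + i) f x * partial i g x - partial i f x * partial (n + i) g x)"

text \<open>The matrix of the brackets of the coordinate functions, with the momenta at the indices
  from \<open>n\<close> on: the entry at \<open>(n + l, l)\<close> is 1, in accordance with the
  bracket of a momentum and its position being 1.\<close>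

definition Omega :: "nat \<Rightarrow> nat \<Rightarrow> nat \<Rightarrow> real" where
  "Omega n k l = (if l < n \<and> k = n + l then 1 else if k < n \<and> l = n + k then - 1 else 0)"

lemma coord_bracket_eq: "coord_bracket n (D, \<Phi>) f g z = pb n (f \<circ> inv_into D \<Phi>) (g \<circ> inv_into D \<Phi>) (\<Phi> z)"
  by (simp add: coord_bracket_def pb_def Let_def)

lemma pb_cong:
  assumes "\<And>k. k < 2 * n \<Longrightarrow> partial k f x = partial k f' x'" "\<And>k. k < 2 * n \<Longrightarrow> partial k g x = partial k g' x'"
  shows "pb n f g x = pb n f' g' x'"
  unfolding pb_def by (rule sum.cong) (use assms in auto)

lemma Omega_skew: "Omega n l k = - Omega n k l"
  by (auto simp: Omega_def)

lemma pb_skew: "pb n g f x = - pb n f g x"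
  by (simp add: pb_def sum_subtractf algebra_simps)

lemma sum_lessThan_add: "(\<Sum>k<n + m. h k) = (\<Sum>i<n. h i) + (\<Sum>i<m. h (n + i :: nat) :: real)"
  by (induction m) (simp_all add: algebra_simps)

lemma sum_lessThan_double: "(\<Sum>k<2 * n. h k) = (\<Sum>i<n. h i) + (\<Sum>i<n. h (n + i :: nat) :: real)"
  unfolding mult_2 by (rule sum_lessThan_add)

text \<open>Constant coefficients in one double sum, with positions and momenta on the same footing:
  the form in which the bracket is differentiated and the Jacobi identity is proved.\<close>

lemma pb_Omega: "pb n f g x = (\<Sum>k<2 * n. \<Sum>l<2 * n. Omega n k l * (partial k f x * partial l g x))"
proof -
  have 1: "(\<Sum>l<2 * n. Omega n i l * (a * b l)) = - (a * b (n + i))" if "i < n" for i a and b :: "nat \<Rightarrow> real"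
  proof -
    have "(\<Sum>l<n. Omega n i l * (a * b l)) = 0"
      by (rule sum.neutral) (use that in \<open>auto simp: Omega_def\<close>)
    moreover have "(\<Sum>j<n. Omega n i (n + j) * (a * b (n + j))) = (\<Sum>j<n. if j = i then - (a * b (n + i)) else 0)"
      by (rule sum.cong) (use that in \<open>auto simp: Omega_def\<close>)
    ultimately show ?thesis
      using that by (simp add: sum_lessThan_double)
  qed
  have 2: "(\<Sum>l<2 * n. Omega n (n + i) l * (a * b l)) = a * b i" if "i < n" for i a and b :: "nat \<Rightarrow> real"
  proof -
    have "(\<Sum>l<n. Omega n (n + i) (n + l) * (a * b (n + l))) = 0"
      by (rule sum.neutral) (use that in \<open>auto simp: Omega_def\<close>)
    moreover have "(\<Sum>j<n. Omega n (n + i) j * (a * b j)) = (\<Sum>j<n. if j = i then a * b i else 0)"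
      by (rule sum.cong) (use that in \<open>auto simp: Omega_def\<close>)
    ultimately show ?thesis
      using that by (simp add: sum_lessThan_double)
  qed
  show ?thesis
    unfolding sum_lessThan_double[of "\<lambda>k. \<Sum>l<2 * n. Omega n k l * (partial k f x * partial l g x)"]
    by (simp add: 1 2 pb_def sum_subtractf sum_negf)
qed

text \<open>The bracket is of first order in each argument, so by the chain rule a map preserves it
  at \<open>x\<close> once it preserves the brackets of the coordinate functions at
  \<open>x\<close>.\<close>

lemma pb_compose:
  assumes S: "openin (Euclidean_space (2 * n)) S" and T: "openin (Euclidean_space (2 * n)) T"
    and F: "Cinf_on (2 * n) T F" and G: "Cinf_on (2 * n) T G"
    and \<tau>: "\<And>j. j < 2 * n \<Longrightarrow> Cinf_on (2 * n) S (\<lambda>x. \<tau> x j)" "\<And>x. x \<in> S \<Longrightarrow> \<tau> x \<in> T" and x: "x \<in> S"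
    and canonical: "\<And>k l. k < 2 * n \<Longrightarrow> l < 2 * n \<Longrightarrow> pb n (\<lambda>x. \<tau> x k) (\<lambda>x. \<tau> x l) x = Omega n k l"
  shows "pb n (\<lambda>x. F (\<tau> x)) (\<lambda>x. G (\<tau> x)) x = pb n F G (\<tau> x)"
proof -
  let ?F = "\<lambda>k. partial k F (\<tau> x)" and ?G = "\<lambda>l. partial l G (\<tau> x)"
  let ?d = "\<lambda>i k. partial i (\<lambda>x. \<tau> x k) x"
  have pF: "partial i (\<lambda>x. F (\<tau> x)) x = (\<Sum>k<2 * n. ?F k * ?d i k)" if "i < 2 * n" for i
    by (rule partial_compose[OF S T F \<tau> x that])
  have pG: "partial i (\<lambda>x. G (\<tau> x)) x = (\<Sum>k<2 * n. ?G k * ?d i k)" if "i < 2 * n" for i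
    by (rule partial_compose[OF S T G \<tau> x that])
  have "pb n (\<lambda>x. F (\<tau> x)) (\<lambda>x. G (\<tau> x)) x =
      (\<Sum>i<n. (\<Sum>k<2 * n. ?F k * ?d (n + i) k) * (\<Sum>l<2 * n. ?G l * ?d i l) -
         (\<Sum>k<2 * n. ?F k * ?d i k) * (\<Sum>l<2 * n. ?G l * ?d (n + i) l))"
    unfolding pb_def by (rule sum.cong) (auto simp: pF pG)
  also have "\<dots> = (\<Sum>i<n. \<Sum>k<2 * n. \<Sum>l<2 * n. ?F k * ?G l * (?d (n + i) k * ?d i l - ?d i k * ?d (n + i) l))"
    unfolding sum_product sum_subtractf[symmetric] by (intro sum.cong refl) (simp add: algebra_simps)
  also have "\<dots> = (\<Sum>k<2 * n. \<Sum>l<2 * n. \<Sum>i<n. ?F k * ?G l * (?d (n + i) k * ?d i l - ?d i k * ?d (n + i) l))"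
    unfolding sum.swap[of _ "{..<2 * n}" "{..<n}"] ..
  also have "\<dots> = (\<Sum>k<2 * n. \<Sum>l<2 * n. ?F k * ?G l * pb n (\<lambda>x. \<tau> x k) (\<lambda>x. \<tau> x l) x)"
    by (simp add: pb_def sum_distrib_left)
  also have "\<dots> = (\<Sum>k<2 * n. \<Sum>l<2 * n. Omega n k l * (?F k * ?G l))"
    by (intro sum.cong refl) (simp add: canonical)
  finally show ?thesis by (simp add: pb_Omega)
qed

lemma Cinf_on_pb:
  assumes S: "openin (Euclidean_space (2 * n)) S" and f: "Cinf_on (2 * n) S f" and g: "Cinf_on (2 * n) S g"
  shows "Cinf_on (2 * n) S (pb n f g)"
proof -
  have "Cinf_on (2 * n) S (\<lambda>x. \<Sum>k<2 * n. \<Sum>l<2 * n. Omega n k l * (partial k f x * partial l g x))"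
    by (intro Cinf_on_sum[OF S] Cinf_on_mult[OF S] Cinf_on_const[OF S] Cinf_on_partial[OF f S] Cinf_on_partial[OF g S]) auto
  then show ?thesis
    by (simp add: pb_Omega[abs_def])
qed

subsection \<open>The Jacobi identity\<close>

lemma partial_pb:
  assumes S: "openin (Euclidean_space (2 * n)) S" and f: "Cinf_on (2 * n) S f" and g: "Cinf_on (2 * n) S g"
    and x: "x \<in> S" and m: "m < 2 * n"
  shows "partial m (pb n f g) x = (\<Sum>k<2 * n. \<Sum>l<2 * n. Omega n k l *
     (partial m (partial k f) x * partial l g x + partial m (partial l g) x * partial k f x))"
proof (rule partialI)
  have "((\<lambda>t. \<Sum>k<2 * n. \<Sum>l<2 * n. Omega n k l * (partial k f (x(m := t)) * partial l g (x(m := t))))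
      has_real_derivative (\<Sum>k<2 * n. \<Sum>l<2 * n. Omega n k l *
     (partial m (partial k f) x * partial l g x + partial m (partial l g) x * partial k f x))) (at (x m))"
  proof (intro DERIV_sum DERIV_cmult)
    fix k l assume "k \<in> {..<2 * n}" "l \<in> {..<2 * n}"
    then show "((\<lambda>t. partial k f (x(m := t)) * partial l g (x(m := t))) has_real_derivative
        partial m (partial k f) x * partial l g x + partial m (partial l g) x * partial k f x) (at (x m))"
      using DERIV_mult[OF Cinf_on_has_partial[OF Cinf_on_partial[OF f S] S x m] Cinf_on_has_partial[OF Cinf_on_partial[OF g S] S x m]]
      by simp
  qed
  then show "((\<lambda>t. pb n f g (x(m := t))) has_real_derivative (\<Sum>k<2 * n. \<Sum>l<2 * n. Omega n k l *
     (partial m (partial k f) x * partial l g x + partial m (partial l g) x * partial k f x))) (at (x m))"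
    by (simp add: pb_Omega)
qed

text \<open>The Hessian \<open>a\<close> of one function contracted through \<open>Omega\<close>
  with the gradients \<open>b\<close> and \<open>c\<close> of two others. Iterated brackets are
  differences of such sums.\<close>

definition hess_sum :: "nat \<Rightarrow> (nat \<Rightarrow> nat \<Rightarrow> real) \<Rightarrow> (nat \<Rightarrow> real) \<Rightarrow> (nat \<Rightarrow> real) \<Rightarrow> real" where
  "hess_sum n a b c = (\<Sum>m<2 * n. \<Sum>r<2 * n. \<Sum>k<2 * n. \<Sum>l<2 * n. Omega n m r * Omega n k l * a m k * b l * c r)"

text \<open>Exchanging the index pairs \<open>(m, r)\<close> and \<open>(k, l)\<close> exchanges the
  gradients and transposes the Hessian, which is symmetric.\<close>

lemma hess_sum_commute:
  assumes "\<And>m k. m < 2 * n \<Longrightarrow> k < 2 * n \<Longrightarrow> a m k = a k m"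
  shows "hess_sum n a b c = hess_sum n a c b"
proof -
  let ?I = "{..<2 * n}"
  let ?X = "\<lambda>m r k l. Omega n m r * Omega n k l * a m k * b l * c r"
  have "(\<Sum>m\<in>?I. \<Sum>r\<in>?I. \<Sum>k\<in>?I. \<Sum>l\<in>?I. ?X m r k l) = (\<Sum>m\<in>?I. \<Sum>k\<in>?I. \<Sum>r\<in>?I. \<Sum>l\<in>?I. ?X m r k l)"
    by (rule sum.cong[OF refl], rule sum.swap)
  also have "\<dots> = (\<Sum>k\<in>?I. \<Sum>m\<in>?I. \<Sum>l\<in>?I. \<Sum>r\<in>?I. ?X m r k l)"
    by (subst sum.swap, rule sum.cong[OF refl], rule sum.cong[OF refl], rule sum.swap)
  also have "\<dots> = (\<Sum>k\<in>?I. \<Sum>l\<in>?I. \<Sum>m\<in>?I. \<Sum>r\<in>?I. ?X m r k l)"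
    by (rule sum.cong[OF refl], rule sum.swap)
  also have "\<dots> = hess_sum n a c b"
    unfolding hess_sum_def by (intro sum.cong refl) (use assms in simp)
  finally show ?thesis by (simp add: hess_sum_def)
qed

text \<open>The product rule produces one term with the Hessian of \<open>f\<close> and one with the
  Hessian of \<open>g\<close>; in the second the inner indices have to be exchanged, and the skew
  symmetry of \<open>Omega\<close> gives the minus sign.\<close>

lemma pb_pb:
  assumes S: "openin (Euclidean_space (2 * n)) S" and f: "Cinf_on (2 * n) S f" and g: "Cinf_on (2 * n) S g"
    and x: "x \<in> S"
  shows "pb n (pb n f g) h x =
    hess_sum n (\<lambda>m k. partial m (partial k f) x) (\<lambda>l. partial l g x) (\<lambda>r. partial r h x) -
    hess_sum n (\<lambda>m k. partial m (partial k g) x) (\<lambda>l. partial l f x) (\<lambda>r. partial r h x)"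
proof -
  let ?I = "{..<2 * n}"
  let ?f2 = "\<lambda>m k. partial m (partial k f) x" and ?g2 = "\<lambda>m k. partial m (partial k g) x"
  let ?f = "\<lambda>k. partial k f x" and ?g = "\<lambda>k. partial k g x" and ?h = "\<lambda>k. partial k h x"
  have skew: "Omega n m r * Omega n k l * a * b * c = - (Omega n m r * Omega n l k * a * b * c)" for m r k l a b c
    by (subst Omega_skew[of n k l]) simp
  have "pb n (pb n f g) h x = (\<Sum>m\<in>?I. \<Sum>r\<in>?I. Omega n m r *
      ((\<Sum>k\<in>?I. \<Sum>l\<in>?I. Omega n k l * (?f2 m k * ?g l + ?g2 m l * ?f k)) * ?h r))"
    unfolding pb_Omega[of n "pb n f g"] by (intro sum.cong refl) (simp add: partial_pb[OF S f g x])
  also have "\<dots> = (\<Sum>m\<in>?I. \<Sum>r\<in>?I. \<Sum>k\<in>?I. \<Sum>l\<in>?I. Omega n m r * Omega n k l * ?f2 m k * ?g l * ?h r +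
      Omega n m r * Omega n k l * ?g2 m l * ?f k * ?h r)"
    by (simp add: sum_distrib_left sum_distrib_right algebra_simps)
  also have "\<dots> = hess_sum n ?f2 ?g ?h +
      (\<Sum>m\<in>?I. \<Sum>r\<in>?I. \<Sum>k\<in>?I. \<Sum>l\<in>?I. Omega n m r * Omega n k l * ?g2 m l * ?f k * ?h r)"
    by (simp add: hess_sum_def sum.distrib)
  also have "(\<Sum>m\<in>?I. \<Sum>r\<in>?I. \<Sum>k\<in>?I. \<Sum>l\<in>?I. Omega n m r * Omega n k l * ?g2 m l * ?f k * ?h r) =
      (\<Sum>m\<in>?I. \<Sum>r\<in>?I. \<Sum>l\<in>?I. \<Sum>k\<in>?I. - (Omega n m r * Omega n l k * ?g2 m l * ?f k * ?h r))"
    by (rule sum.cong[OF refl], rule sum.cong[OF refl], rule trans[OF sum.swap], intro sum.cong refl) (rule skew)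
  also have "\<dots> = - hess_sum n ?g2 ?f ?h"
    by (simp add: hess_sum_def sum_negf)
  finally show ?thesis by simp
qed

text \<open>Among the six Hessian sums each function occurs twice with its Hessian, with opposite
  signs and the gradients in opposite order.\<close>

lemma pb_Jacobi:
  assumes S: "openin (Euclidean_space (2 * n)) S" and f: "Cinf_on (2 * n) S f" and g: "Cinf_on (2 * n) S g"
    and h: "Cinf_on (2 * n) S h" and x: "x \<in> S"
  shows "pb n (pb n f g) h x + pb n (pb n g h) f x + pb n (pb n h f) g x = 0"
proof -
  have comm: "hess_sum n (\<lambda>m k. partial m (partial k u) x) b c = hess_sum n (\<lambda>m k. partial m (partial k u) x) c b"
    if "Cinf_on (2 * n) S u" for u b c
    by (rule hess_sum_commute) (rule partial_commute[OF S that x])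
  show ?thesis
    unfolding pb_pb[OF S f g x] pb_pb[OF S g h x] pb_pb[OF S h f x]
    using comm[OF f, of "\<lambda>r. partial r g x" "\<lambda>r. partial r h x"]
      comm[OF g, of "\<lambda>r. partial r f x" "\<lambda>r. partial r h x"]
      comm[OF h, of "\<lambda>r. partial r f x" "\<lambda>r. partial r g x"] by linarith
qed

subsection \<open>Cotangent lifts of diffeomorphisms are canonical\<close>

text \<open>The functions in question are linear on the fibres, with coefficients \<open>B i\<close>
  from the base. The new momenta under a change of chart and the lifts of vector fields both have
  this form.\<close>

lemma partial_sum_fibre:
  assumes S: "openin (Euclidean_space n) S" and B: "\<And>i. i < n \<Longrightarrow> Cinf_on n S (B i)"
    and x: "x \<in> cyl n (2 * n) S"
  shows "m < n \<Longrightarrow> partial m (\<lambda>x. \<Sum>i<n. x (n + i) * B i (trunc n x)) x = (\<Sum>i<n. x (n + i) * partial m (B i) (trunc n x))"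
    and "m < n \<Longrightarrow> partial (n + m) (\<lambda>x. \<Sum>i<n. x (n + i) * B i (trunc n x)) x = B m (trunc n x)"
proof -
  have C: "openin (Euclidean_space (2 * n)) (cyl n (2 * n) S)"
    by (rule openin_cyl[OF S])
  have d: "((\<lambda>t. \<Sum>i<n. (x(k := t)) (n + i) * B i (trunc n (x(k := t)))) has_real_derivative
      (\<Sum>i<n. (if k = n + i then 1 else 0) * B i (trunc n x) +
         (if k < n then partial k (B i) (trunc n x) else 0) * x (n + i))) (at (x k))" if k: "k < 2 * n" for k
  proof (rule DERIV_sum)
    fix i assume "i \<in> {..<n}"
    then have i: "i < n" by simp
    have "((\<lambda>t. B i (trunc n (x(k := t)))) has_real_derivative (if k < n then partial k (B i) (trunc n x) else 0)) (at (x k))"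
      using Cinf_on_has_partial[OF Cinf_on_cyl(1)[OF S B[OF i]] C x k] Cinf_on_cyl(2)[OF S B[OF i] x k] by simp
    from DERIV_mult[OF DERIV_coord[of x k "n + i"] this] show "((\<lambda>t. (x(k := t)) (n + i) * B i (trunc n (x(k := t)))) has_real_derivative
        (if k = n + i then 1 else 0) * B i (trunc n x) + (if k < n then partial k (B i) (trunc n x) else 0) * x (n + i)) (at (x k))"
      by simp
  qed
  show "partial m (\<lambda>x. \<Sum>i<n. x (n + i) * B i (trunc n x)) x = (\<Sum>i<n. x (n + i) * partial m (B i) (trunc n x))"
    if "m < n"
  proof (rule partialI)
    have "(\<Sum>i<n. (if m = n + i then 1 else 0) * B i (trunc n x) +
         (if m < n then partial m (B i) (trunc n x) else 0) * x (n + i)) =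
        (\<Sum>i<n. x (n + i) * partial m (B i) (trunc n x))"
      by (rule sum.cong) (use that in auto)
    then show "((\<lambda>t. \<Sum>i<n. (x(m := t)) (n + i) * B i (trunc n (x(m := t)))) has_real_derivative
        (\<Sum>i<n. x (n + i) * partial m (B i) (trunc n x))) (at (x m))"
      using d[of m] that by simp
  qed
  show "partial (n + m) (\<lambda>x. \<Sum>i<n. x (n + i) * B i (trunc n x)) x = B m (trunc n x)" if "m < n"
  proof (rule partialI)
    have "(\<Sum>i<n. (if n + m = n + i then 1 else 0) * B i (trunc n x) +
         (if n + m < n then partial (n + m) (B i) (trunc n x) else 0) * x (n + i)) =
        (\<Sum>i<n. if i = m then B m (trunc n x) else 0)"
      by (rule sum.cong) auto
    then have "(\<Sum>i<n. (if n + m = n + i then 1 else 0) * B i (trunc n x) +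
         (if n + m < n then partial (n + m) (B i) (trunc n x) else 0) * x (n + i)) = B m (trunc n x)"
      using that by simp
    then show "((\<lambda>t. \<Sum>i<n. (x(n + m := t)) (n + i) * B i (trunc n (x(n + m := t)))) has_real_derivative
        B m (trunc n x)) (at (x (n + m)))"
      using d[of "n + m"] that by simp
  qed
qed

text \<open>Here \<open>A\<close> is a change of base coordinates, \<open>C\<close> its inverse and
  \<open>\<tau>\<close> the lift. Brackets of two positions vanish because no momentum occurs; those
  of a momentum and a position reduce to the chain rule for \<open>A\<close> after \<open>C\<close>;
  those of two momenta vanish by symmetry of the second derivatives of \<open>C\<close>.\<close>

lemma cotangent_lift_canonical:
  assumes S: "openin (Euclidean_space n) S" and T: "openin (Euclidean_space n) T"
    and A: "\<And>j. j < n \<Longrightarrow> Cinf_on n S (\<lambda>y. A y j)" "\<And>y. y \<in> S \<Longrightarrow> A y \<in> T"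
    and C: "\<And>j. j < n \<Longrightarrow> Cinf_on n T (\<lambda>w. C w j)" "\<And>w. w \<in> T \<Longrightarrow> C w \<in> S"
    and inv: "\<And>y. y \<in> S \<Longrightarrow> C (A y) = y" "\<And>w. w \<in> T \<Longrightarrow> A (C w) = w"
    and base: "\<And>x j. x \<in> cyl n (2 * n) S \<Longrightarrow> j < n \<Longrightarrow> \<tau> x j = A (trunc n x) j"
    and fibre: "\<And>x j. x \<in> cyl n (2 * n) S \<Longrightarrow> j < n \<Longrightarrow>
       \<tau> x (n + j) = (\<Sum>i<n. x (n + i) * partial j (\<lambda>w. C w i) (A (trunc n x)))"
    and x: "x \<in> cyl n (2 * n) S" and kl: "k < 2 * n" "l < 2 * n"
  shows "pb n (\<lambda>x. \<tau> x k) (\<lambda>x. \<tau> x l) x = Omega n k l"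
proof -
  let ?Cy = "cyl n (2 * n) S"
  define y where "y = trunc n x"
  have y: "y \<in> S" using x by (simp add: y_def cyl_def)
  \<comment> \<open>\<open>B j i\<close> is the coefficient of the old momentum \<open>i\<close> in
    the new momentum \<open>j\<close>.\<close>
  define B where "B j i = (\<lambda>y. partial j (\<lambda>w. C w i) (A y))" for j i
  have Cy: "openin (Euclidean_space (2 * n)) ?Cy"
    by (rule openin_cyl[OF S])
  have B: "Cinf_on n S (B j i)" if "i < n" "j < n" for i j
    unfolding B_def by (rule Cinf_on_compose[OF S T Cinf_on_partial[OF C(1)[OF that(1)] T that(2)] A])
  have base0: "partial m (\<lambda>x. \<tau> x j) x = (if m < n then partial m (\<lambda>y. A y j) y else 0)" if "j < n" "m < 2 * n" for j m
  proof -
    have "partial m (\<lambda>x. \<tau> x j) x = partial m (\<lambda>x. A (trunc n x) j) x"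
      by (rule partial_cong[OF Cy x that(2)]) (use base that in auto)
    then show ?thesis
      using Cinf_on_cyl(2)[OF S A(1)[OF that(1)] x that(2)] by (simp add: y_def)
  qed
  have fibre_cong: "partial m (\<lambda>x. \<tau> x (n + j)) x = partial m (\<lambda>x. \<Sum>i<n. x (n + i) * B j i (trunc n x)) x"
    if "j < n" "m < 2 * n" for j m
    by (rule partial_cong[OF Cy x that(2)]) (use fibre that in \<open>auto simp: B_def\<close>)
  have fibre_q: "partial m (\<lambda>x. \<tau> x (n + j)) x = (\<Sum>i<n. x (n + i) * partial m (B j i) y)" if "j < n" "m < n" for j m
    using fibre_cong[of j m] partial_sum_fibre(1)[OF S, of "B j" x m] B x that by (simp add: y_def)
  have fibre_p: "partial (n + m) (\<lambda>x. \<tau> x (n + j)) x = B j m y" if "j < n" "m < n" for j m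
    using fibre_cong[of j "n + m"] partial_sum_fibre(2)[OF S, of "B j" x m] B x that by (simp add: y_def)
  \<comment> \<open>Obtained by differentiating the identity \<open>A (C w) = w\<close> at
    \<open>w = A y\<close>.\<close>
  have dual: "(\<Sum>i<n. B j i y * partial i (\<lambda>y. A y k) y) = (if j = k then 1 else 0)" if "j < n" "k < n" for j k
  proof -
    have Ay: "A y \<in> T" by (rule A(2)[OF y])
    have "partial j (\<lambda>w. A (C w) k) (A y) = (\<Sum>i<n. partial i (\<lambda>y. A y k) (C (A y)) * partial j (\<lambda>w. C w i) (A y))"
      by (rule partial_compose[OF T S A(1)[OF that(2)] C Ay that(1)])
    moreover have "partial j (\<lambda>w. A (C w) k) (A y) = partial j (\<lambda>w. w k) (A y)"
      by (rule partial_cong[OF T Ay that(1)]) (simp add: inv)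
    ultimately show ?thesis
      by (simp add: partial_coord inv(1)[OF y] B_def mult.commute)
  qed
  \<comment> \<open>Contraction with \<open>B j\<close> undoes the inner derivative of
    \<open>A\<close>, so what remains is a second derivative of \<open>C\<close>, symmetric in
    \<open>j\<close> and \<open>k\<close>.\<close>
  have hess: "(\<Sum>i<n. B j i y * partial i (B k l) y) = partial j (partial k (\<lambda>w. C w l)) (A y)"
    if "j < n" "k < n" "l < n" for j k l
  proof -
    have "partial i (B k l) y = (\<Sum>m<n. partial m (partial k (\<lambda>w. C w l)) (A y) * partial i (\<lambda>y. A y m) y)" if "i < n" for i
      unfolding B_def
      by (rule partial_compose[OF S T Cinf_on_partial[OF C(1)[OF \<open>l < n\<close>] T \<open>k < n\<close>] A y that])
    then have "(\<Sum>i<n. B j i y * partial i (B k l) y) =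
        (\<Sum>i<n. \<Sum>m<n. partial m (partial k (\<lambda>w. C w l)) (A y) * (B j i y * partial i (\<lambda>y. A y m) y))"
      by (intro sum.cong refl) (simp add: sum_distrib_left algebra_simps)
    also have "\<dots> = (\<Sum>m<n. \<Sum>i<n. partial m (partial k (\<lambda>w. C w l)) (A y) * (B j i y * partial i (\<lambda>y. A y m) y))"
      by (rule sum.swap)
    also have "\<dots> = (\<Sum>m<n. partial m (partial k (\<lambda>w. C w l)) (A y) * (if j = m then 1 else 0))"
      unfolding sum_distrib_left[symmetric] by (intro sum.cong refl) (simp add: dual that)
    also have "\<dots> = (\<Sum>m<n. if m = j then partial j (partial k (\<lambda>w. C w l)) (A y) else 0)"
      by (rule sum.cong) auto
    also have "\<dots> = partial j (partial k (\<lambda>w. C w l)) (A y)"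
      using that by simp
    finally show ?thesis .
  qed
  have bb: "pb n (\<lambda>x. \<tau> x j) (\<lambda>x. \<tau> x k) x = Omega n j k" if "j < n" "k < n" for j k
    unfolding pb_def using that by (simp add: base0) (simp add: Omega_def)
  have fb: "pb n (\<lambda>x. \<tau> x (n + j)) (\<lambda>x. \<tau> x k) x = Omega n (n + j) k" if "j < n" "k < n" for j k
    unfolding pb_def using that dual[OF that] by (simp add: base0 fibre_p) (simp add: Omega_def)
  have bf: "pb n (\<lambda>x. \<tau> x k) (\<lambda>x. \<tau> x (n + j)) x = Omega n k (n + j)" if "j < n" "k < n" for j k
    using fb[OF that] pb_skew[of n "\<lambda>x. \<tau> x k" "\<lambda>x. \<tau> x (n + j)" x] Omega_skew[of n k "n + j"] by simp
  have ff: "pb n (\<lambda>x. \<tau> x (n + j)) (\<lambda>x. \<tau> x (n + k)) x = Omega n (n + j) (n + k)" if "j < n" "k < n" for j k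
  proof -
    have half: "(\<Sum>i<n. B j i y * (\<Sum>l<n. x (n + l) * partial i (B k l) y)) =
        (\<Sum>l<n. x (n + l) * partial j (partial k (\<lambda>w. C w l)) (A y))" if "j < n" "k < n" for j k
    proof -
      have "(\<Sum>i<n. B j i y * (\<Sum>l<n. x (n + l) * partial i (B k l) y)) =
          (\<Sum>i<n. \<Sum>l<n. x (n + l) * (B j i y * partial i (B k l) y))"
        by (intro sum.cong refl) (simp add: sum_distrib_left algebra_simps)
      also have "\<dots> = (\<Sum>l<n. \<Sum>i<n. x (n + l) * (B j i y * partial i (B k l) y))"
        by (rule sum.swap)
      finally show ?thesis
        unfolding sum_distrib_left[symmetric] by (simp add: hess that)
    qed
    have "pb n (\<lambda>x. \<tau> x (n + j)) (\<lambda>x. \<tau> x (n + k)) x =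
        (\<Sum>i<n. B j i y * (\<Sum>l<n. x (n + l) * partial i (B k l) y)) -
        (\<Sum>i<n. B k i y * (\<Sum>l<n. x (n + l) * partial i (B j l) y))"
      unfolding pb_def sum_subtractf[symmetric]
      by (rule sum.cong) (simp_all add: fibre_p fibre_q that mult.commute)
    also have "\<dots> = 0"
      unfolding half[OF that] half[OF that(2,1)]
      using partial_commute[OF T C(1) A(2)[OF y] that] by simp
    also have "\<dots> = Omega n (n + j) (n + k)"
      by (simp add: Omega_def)
    finally show ?thesis .
  qed
  have "(\<exists>j. j < n \<and> k = j) \<or> (\<exists>j. j < n \<and> k = n + j)" "(\<exists>j. j < n \<and> l = j) \<or> (\<exists>j. j < n \<and> l = n + j)"
    using kl by presburger+
  then show ?thesis using bb fb bf ff by blast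
qed

section \<open>The canonical bracket on the cotangent bundle\<close>

text \<open>A copy of \<open>smooth_mfd\<close> in which the facts of that locale are available for
  the bundle too, with prefix \<open>P\<close>, without passing on to the bundle of the
  bundle.\<close>

locale cotangent = smooth_mfd M for M :: "'a manifold"

sublocale cotangent \<subseteq> P: smooth_mfd "cotangent_bundle M"
  by unfold_locales (rule smooth_manifold_cotangent)

context cotangent
begin

lemma cotangent_atlas: "(U, \<phi>) \<in> atlas M \<Longrightarrow> (cdom M U, cmap M U \<phi>) \<in> atlas (cotangent_bundle M)"
  by (auto simp: atlas_cotangent)

lemma cotangent_point_chart:
  assumes "z \<in> cotangent_carrier M"
  obtains U \<phi> where "(U, \<phi>) \<in> atlas M" "z \<in> cdom M U"
proof -
  have "fst z \<in> carr M" using assms by (auto simp: cotangent_carrier_def)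
  then obtain U \<phi> where "(U, \<phi>) \<in> atlas M" "fst z \<in> U" using chart_cover by blast
  then show thesis using assms by (intro that[of U \<phi>]) (auto simp: cdom_def)
qed

abbreviation rep :: "'a set \<Rightarrow> ('a \<Rightarrow> nat \<Rightarrow> real) \<Rightarrow> ('a \<times> 'a cvec \<Rightarrow> real) \<Rightarrow> (nat \<Rightarrow> real) \<Rightarrow> real" where
  "rep U \<phi> f \<equiv> f \<circ> inv_into (cdom M U) (cmap M U \<phi>)"

abbreviation smooth_at :: "'a \<times> 'a cvec \<Rightarrow> ('a \<times> 'a cvec \<Rightarrow> real) \<Rightarrow> bool" where
  "smooth_at \<equiv> smooth_near (cotangent_bundle M)"

lemma rep_smooth:
  assumes "smooth_at z f" "(U, \<phi>) \<in> atlas M" "z \<in> cdom M U"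
  obtains S where "openin (Euclidean_space (2 * mdim M)) S" "cmap M U \<phi> z \<in> S" "S \<subseteq> cmap M U \<phi> ` cdom M U"
    "Cinf_on (2 * mdim M) S (rep U \<phi> f)"
  using P.smooth_near_rep[OF assms(1) cotangent_atlas[OF assms(2)] assms(3)] unfolding mdim_cotangent by blast

lemma rep_smooth2:
  assumes "smooth_at z f" "smooth_at z g" "(U, \<phi>) \<in> atlas M" "z \<in> cdom M U"
  obtains S where "openin (Euclidean_space (2 * mdim M)) S" "cmap M U \<phi> z \<in> S" "S \<subseteq> cmap M U \<phi> ` cdom M U"
    "Cinf_on (2 * mdim M) S (rep U \<phi> f)" "Cinf_on (2 * mdim M) S (rep U \<phi> g)"
proof -
  obtain S where S: "openin (Euclidean_space (2 * mdim M)) S" "cmap M U \<phi> z \<in> S" "S \<subseteq> cmap M U \<phi> ` cdom M U"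
    "Cinf_on (2 * mdim M) S (rep U \<phi> f)"
    by (rule rep_smooth[OF assms(1,3,4)])
  obtain T where T: "openin (Euclidean_space (2 * mdim M)) T" "cmap M U \<phi> z \<in> T"
    "Cinf_on (2 * mdim M) T (rep U \<phi> g)"
    by (rule rep_smooth[OF assms(2,3,4)])
  have ST: "openin (Euclidean_space (2 * mdim M)) (S \<inter> T)" using S(1) T(1) by (rule openin_Int)
  show thesis
    by (rule that[OF ST]) (use S T Cinf_on_subset[OF S(4,1) ST] Cinf_on_subset[OF T(3,1) ST] in auto)
qed

text \<open>The change between induced charts is the cotangent lift of the base transition, whose
  inverse is the transition in the other direction; so \<open>cotangent_lift_canonical\<close> and
  \<open>pb_compose\<close> apply.\<close>

lemma bracket_chart_independent:
  assumes U: "(U, \<phi>) \<in> atlas M" "z \<in> cdom M U" and V: "(V, \<psi>) \<in> atlas M" "z \<in> cdom M V"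
    and f: "smooth_at z f" and g: "smooth_at z g"
  shows "pb (mdim M) (rep U \<phi> f) (rep U \<phi> g) (cmap M U \<phi> z) = pb (mdim M) (rep V \<psi> f) (rep V \<psi> g) (cmap M V \<psi> z)"
proof -
  let ?n = "mdim M"
  define \<tau> where "\<tau> x = cmap M V \<psi> (cinv U \<phi> x)" for x
  let ?C = "cyl ?n (2 * ?n) (\<phi> ` (U \<inter> V))"
  let ?x = "cmap M U \<phi> z"
  obtain T where T: "openin (Euclidean_space (2 * ?n)) T" "cmap M V \<psi> z \<in> T" "T \<subseteq> cmap M V \<psi> ` cdom M V"
    "Cinf_on (2 * ?n) T (rep V \<psi> f)" "Cinf_on (2 * ?n) T (rep V \<psi> g)"
    by (rule rep_smooth2[OF f g V])
  have C: "openin (Euclidean_space (2 * ?n)) ?C"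
    by (rule openin_cyl[OF transition_open[OF U(1) V(1)]])
  \<comment> \<open>The domain is shrunk to the points that \<open>\<tau>\<close> sends into
    \<open>T\<close>, because \<open>f\<close> and \<open>g\<close> are smooth only near
    \<open>z\<close>.\<close>
  define S where "S = {x \<in> ?C. \<tau> x \<in> T}"
  have S: "openin (Euclidean_space (2 * ?n)) S"
    unfolding S_def \<tau>_def
    by (rule openin_Euclidean_preimage[OF C T(1) transition_continuous[OF U(1) V(1)]]) (simp add: cmap_eq_0)
  have z: "fst z \<in> V" using V(2) by (simp add: cdom_def)
  have xC: "?x \<in> ?C" by (rule cmap_in[OF U z])
  have \<tau>x: "\<tau> ?x = cmap M V \<psi> z" by (simp add: \<tau>_def cinv_cmap[OF U])
  have xS: "?x \<in> S" using xC \<tau>x T(2) by (simp add: S_def)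
  have \<tau>_smooth: "Cinf_on (2 * ?n) S (\<lambda>x. \<tau> x j)" if "j < 2 * ?n" for j
    unfolding \<tau>_def by (rule Cinf_on_subset[OF transition_smooth[OF U(1) V(1) that] C S]) (auto simp: S_def)
  have canonical: "pb ?n (\<lambda>x. \<tau> x k) (\<lambda>x. \<tau> x l) ?x = Omega ?n k l" if "k < 2 * ?n" "l < 2 * ?n" for k l
  proof (rule cotangent_lift_canonical[where S="\<phi> ` (U \<inter> V)" and T="\<psi> ` (V \<inter> U)"
        and A="\<lambda>y. \<psi> (inv_into U \<phi> y)" and C="\<lambda>w. \<phi> (inv_into V \<psi> w)"])
    show "\<tau> x j = \<psi> (inv_into U \<phi> (trunc ?n x)) j" if "x \<in> ?C" "j < ?n" for x j
      unfolding \<tau>_def by (rule cmap_cinv_base[OF U(1) V(1) that])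
    show "\<tau> x (?n + j) = (\<Sum>i<?n. x (?n + i) * partial j (\<lambda>w. \<phi> (inv_into V \<psi> w) i) (\<psi> (inv_into U \<phi> (trunc ?n x))))"
      if "x \<in> ?C" "j < ?n" for x j
      unfolding \<tau>_def by (rule cmap_cinv_fibre[OF U(1) V(1) that])
  qed (use that xC chart_inv[OF U(1)] chart_inv[OF V(1)] chart_transition[OF U(1) V(1)] chart_transition[OF V(1) U(1)]
       transition_open[OF U(1) V(1)] transition_open[OF V(1) U(1)] in auto)
  have rep_eq: "rep U \<phi> h x = rep V \<psi> h (\<tau> x)" if "x \<in> S" for x h
  proof -
    have "x \<in> ?C" using that by (simp add: S_def)
    then have c: "cinv U \<phi> x \<in> cdom M (U \<inter> V)" "x \<in> cyl ?n (2 * ?n) (\<phi> ` U)"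
      using cinv_in[OF U(1)] by (auto simp: cyl_def)
    then have "cinv U \<phi> x \<in> cdom M V" by (simp add: cdom_def)
    then have "inv_into (cdom M V) (cmap M V \<psi>) (\<tau> x) = cinv U \<phi> x"
      unfolding \<tau>_def by (rule inv_into_f_f[OF cmap_inj[OF V(1)]])
    then show ?thesis by (simp add: inv_into_cmap[OF U(1) c(2)])
  qed
  have "pb ?n (rep U \<phi> f) (rep U \<phi> g) ?x = pb ?n (\<lambda>x. rep V \<psi> f (\<tau> x)) (\<lambda>x. rep V \<psi> g (\<tau> x)) ?x"
    by (intro pb_cong partial_cong[OF S xS]) (use rep_eq in auto)
  also have "\<dots> = pb ?n (rep V \<psi> f) (rep V \<psi> g) (\<tau> ?x)"
    by (rule pb_compose[OF S T(1,4,5) \<tau>_smooth _ xS canonical]) (auto simp: S_def)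
  finally show ?thesis by (simp add: \<tau>x)
qed

text \<open>The bracket is a definite description over all charts at the base point; by chart
  independence the value in any one chart is its witness.\<close>

lemma canonical_bracket_eq:
  assumes U: "(U, \<phi>) \<in> atlas M" "z \<in> cdom M U" and f: "smooth_at z f" and g: "smooth_at z g"
  shows "canonical_bracket M f g z = pb (mdim M) (rep U \<phi> f) (rep U \<phi> g) (cmap M U \<phi> z)"
proof -
  have z: "z \<in> cotangent_carrier M" "fst z \<in> U" using U(2) by (auto simp: cdom_def)
  have "(THE b. \<forall>c\<in>atlas M. fst z \<in> fst c \<longrightarrow> b = coord_bracket (mdim M) (cotangent_chart M c) f g z) =
      pb (mdim M) (rep U \<phi> f) (rep U \<phi> g) (cmap M U \<phi> z)"
  proof (rule the_equality)
    show "\<forall>c\<in>atlas M. fst z \<in> fst c \<longrightarrow>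
        pb (mdim M) (rep U \<phi> f) (rep U \<phi> g) (cmap M U \<phi> z) = coord_bracket (mdim M) (cotangent_chart M c) f g z"
    proof (intro ballI impI)
      fix c assume c: "c \<in> atlas M" "fst z \<in> fst c"
      obtain V \<psi> where V: "c = (V, \<psi>)" by (cases c)
      then have "z \<in> cdom M V" using c z by (simp add: cdom_def)
      then show "pb (mdim M) (rep U \<phi> f) (rep U \<phi> g) (cmap M U \<phi> z) = coord_bracket (mdim M) (cotangent_chart M c) f g z"
        using bracket_chart_independent[OF U _ _ f g, of V \<psi>] c(1)
        by (simp add: V cotangent_chart_eq coord_bracket_eq)
    qed
    fix b assume "\<forall>c\<in>atlas M. fst z \<in> fst c \<longrightarrow> b = coord_bracket (mdim M) (cotangent_chart M c) f g z"
    from bspec[OF this U(1)] z(2) show "b = pb (mdim M) (rep U \<phi> f) (rep U \<phi> g) (cmap M U \<phi> z)"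
      by (simp add: cotangent_chart_eq coord_bracket_eq)
  qed
  then show ?thesis using z(1) by (simp add: canonical_bracket_def)
qed

lemma canonical_bracket_outside: "z \<notin> cotangent_carrier M \<Longrightarrow> canonical_bracket M f g z = 0"
  by (simp add: canonical_bracket_def)

lemma smooth_at_carrier: "smooth_at z f \<Longrightarrow> z \<in> cotangent_carrier M"
  using P.smooth_near_carr carr_cotangent by blast

lemma canonical_bracket_smooth:
  assumes W: "openin (mtop (cotangent_bundle M)) W"
    and f: "smooth_on (cotangent_bundle M) W f" and g: "smooth_on (cotangent_bundle M) W g"
  shows "smooth_on (cotangent_bundle M) W (canonical_bracket M f g)"
proof (rule P.smooth_onI[OF W])
  fix z assume z: "z \<in> W"
  then have "z \<in> cotangent_carrier M"
    using openin_subset[OF W] carr_cotangent by auto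
  then obtain U \<phi> where U: "(U, \<phi>) \<in> atlas M" "z \<in> cdom M U"
    by (rule cotangent_point_chart)
  note UP = cotangent_atlas[OF U(1)]
  let ?S = "cmap M U \<phi> ` (cdom M U \<inter> W)"
  have S: "openin (Euclidean_space (2 * mdim M)) ?S"
    using P.chart_open_image[OF UP W] by (simp add: mdim_cotangent)
  have fr: "Cinf_on (2 * mdim M) ?S (rep U \<phi> f)" and gr: "Cinf_on (2 * mdim M) ?S (rep U \<phi> g)"
    using P.smooth_on_chart[OF f UP] P.smooth_on_chart[OF g UP] by (simp_all add: mdim_cotangent o_def)
  have "canonical_bracket M f g (inv_into (cdom M U) (cmap M U \<phi>) x) = pb (mdim M) (rep U \<phi> f) (rep U \<phi> g) x"
    if "x \<in> ?S" for x
  proof -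
    obtain w where w: "w \<in> cdom M U" "w \<in> W" "x = cmap M U \<phi> w" using \<open>x \<in> ?S\<close> by blast
    show ?thesis
      using canonical_bracket_eq[OF U(1) w(1) P.smooth_nearI[OF W w(2) f] P.smooth_nearI[OF W w(2) g]]
      by (simp add: w(3) P.chart_inv[OF UP w(1)])
  qed
  then have "Cinf_on (2 * mdim M) ?S (\<lambda>x. canonical_bracket M f g (inv_into (cdom M U) (cmap M U \<phi>) x))"
    using Cinf_on_pb[OF S fr gr] by (subst Cinf_on_cong[OF S]) auto
  then show "\<exists>U \<phi> W'. (U, \<phi>) \<in> atlas (cotangent_bundle M) \<and> openin (mtop (cotangent_bundle M)) W' \<and> z \<in> U \<and> z \<in> W' \<and>
      W' \<subseteq> W \<and> Cinf_on (mdim (cotangent_bundle M)) (\<phi> ` (U \<inter> W')) (\<lambda>x. canonical_bracket M f g (inv_into U \<phi> x))"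
    using UP U(2) z W unfolding mdim_cotangent by blast
qed

subsection \<open>Algebraic properties\<close>

lemma canonical_bracket_cong:
  assumes W: "openin (mtop (cotangent_bundle M)) W" "z \<in> W" and eq: "\<And>w. w \<in> W \<Longrightarrow> f w = f' w" "\<And>w. w \<in> W \<Longrightarrow> g w = g' w"
    and f: "smooth_at z f" and g: "smooth_at z g"
  shows "canonical_bracket M f g z = canonical_bracket M f' g' z"
proof -
  obtain U \<phi> where U: "(U, \<phi>) \<in> atlas M" "z \<in> cdom M U"
    by (rule cotangent_point_chart[OF smooth_at_carrier[OF f]])
  have "smooth_at z f'" "smooth_at z g'"
    using P.smooth_near_cong[OF W eq(1) f] P.smooth_near_cong[OF W eq(2) g] by blast+
  then show ?thesis
    unfolding canonical_bracket_eq[OF U f g] canonical_bracket_eq[OF U \<open>smooth_at z f'\<close> \<open>smooth_at z g'\<close>]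
    by (intro pb_cong P.partial_rep_cong[OF cotangent_atlas[OF U(1)] U(2) W]) (auto simp: eq mdim_cotangent)
qed

lemma canonical_bracket_skew:
  assumes "smooth_at z f" "smooth_at z g"
  shows "canonical_bracket M g f z = - canonical_bracket M f g z"
proof -
  obtain U \<phi> where U: "(U, \<phi>) \<in> atlas M" "z \<in> cdom M U"
    by (rule cotangent_point_chart[OF smooth_at_carrier[OF assms(1)]])
  show ?thesis
    unfolding canonical_bracket_eq[OF U assms] canonical_bracket_eq[OF U assms(2,1)] by (rule pb_skew)
qed

lemma
  assumes f: "smooth_at z f" and g: "smooth_at z g" and h: "smooth_at z h"
  shows canonical_bracket_add: "canonical_bracket M h (\<lambda>w. f w + g w) z = canonical_bracket M h f z + canonical_bracket M h g z"
    and canonical_bracket_mult: "canonical_bracket M h (\<lambda>w. f w * g w) z =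
      canonical_bracket M h f z * g z + f z * canonical_bracket M h g z"
proof -
  obtain U \<phi> where U: "(U, \<phi>) \<in> atlas M" "z \<in> cdom M U"
    by (rule cotangent_point_chart[OF smooth_at_carrier[OF f]])
  note UP = cotangent_atlas[OF U(1)]
  note rules = P.partial_rep_add[OF UP U(2), unfolded mdim_cotangent]
    P.partial_rep_mult[OF UP U(2), unfolded mdim_cotangent]
  show "canonical_bracket M h (\<lambda>w. f w + g w) z = canonical_bracket M h f z + canonical_bracket M h g z"
    unfolding canonical_bracket_eq[OF U h P.smooth_near_add[OF f g]] canonical_bracket_eq[OF U h f] canonical_bracket_eq[OF U h g]
    by (simp add: pb_def rules f g sum.distrib[symmetric] algebra_simps)
  show "canonical_bracket M h (\<lambda>w. f w * g w) z = canonical_bracket M h f z * g z + f z * canonical_bracket M h g z"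
    unfolding canonical_bracket_eq[OF U h P.smooth_near_mult[OF f g]] canonical_bracket_eq[OF U h f] canonical_bracket_eq[OF U h g]
    by (simp add: pb_def rules f g sum.distrib[symmetric] sum_distrib_left sum_distrib_right algebra_simps)
qed

lemma canonical_bracket_scale:
  assumes f: "smooth_at z f" and h: "smooth_at z h"
  shows "canonical_bracket M h (\<lambda>w. c * f w) z = c * canonical_bracket M h f z"
proof -
  obtain U \<phi> where U: "(U, \<phi>) \<in> atlas M" "z \<in> cdom M U"
    by (rule cotangent_point_chart[OF smooth_at_carrier[OF f]])
  note UP = cotangent_atlas[OF U(1)]
  show ?thesis
    unfolding canonical_bracket_eq[OF U h P.smooth_near_scale[OF f]] canonical_bracket_eq[OF U h f]
    by (simp add: pb_def P.partial_rep_scale[OF UP U(2), unfolded mdim_cotangent] f sum_distrib_left algebra_simps)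
qed

lemma canonical_bracket_sum:
  assumes "\<And>i. i \<in> I \<Longrightarrow> smooth_at z (f i)" and h: "smooth_at z h"
  shows "canonical_bracket M h (\<lambda>w. \<Sum>i\<in>I. f i w) z = (\<Sum>i\<in>I. canonical_bracket M h (f i) z)"
  using assms(1)
proof (induction I rule: infinite_finite_induct)
  case (insert i I)
  have "z \<in> carr (cotangent_bundle M)" by (rule P.smooth_near_carr[OF h])
  then have "smooth_at z (\<lambda>w. \<Sum>i\<in>I. f i w)"
    by (rule P.smooth_near_sum) (use insert.prems in simp)
  then show ?case
    using insert canonical_bracket_add[OF _ _ h, of "f i" "\<lambda>w. \<Sum>i\<in>I. f i w"] by simp
next
  \<comment> \<open>An infinite sum is 0 by convention. Zero is written as \<open>0 * h\<close>, so
    that homogeneity applies; the empty sum is treated in the same way.\<close>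
  case (infinite I)
  have "canonical_bracket M h (\<lambda>w. 0 * h w) z = 0 * canonical_bracket M h h z"
    by (rule canonical_bracket_scale[OF h h])
  then show ?case using infinite by simp
next
  case empty
  have "canonical_bracket M h (\<lambda>w. 0 * h w) z = 0 * canonical_bracket M h h z"
    by (rule canonical_bracket_scale[OF h h])
  then show ?case by simp
qed

lemma canonical_bracket_Jacobi:
  assumes W: "openin (mtop (cotangent_bundle M)) W" and z: "z \<in> W"
    and f: "smooth_on (cotangent_bundle M) W f" and g: "smooth_on (cotangent_bundle M) W g"
    and h: "smooth_on (cotangent_bundle M) W h"
  shows "canonical_bracket M (canonical_bracket M f g) h z + canonical_bracket M (canonical_bracket M g h) f z +
    canonical_bracket M (canonical_bracket M h f) g z = 0"
proof -
  have "z \<in> cotangent_carrier M"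
    using openin_subset[OF W] carr_cotangent z by auto
  then obtain U \<phi> where U: "(U, \<phi>) \<in> atlas M" "z \<in> cdom M U"
    by (rule cotangent_point_chart)
  note UP = cotangent_atlas[OF U(1)]
  let ?S = "cmap M U \<phi> ` (cdom M U \<inter> W)" and ?x = "cmap M U \<phi> z"
  have S: "openin (Euclidean_space (2 * mdim M)) ?S" and x: "?x \<in> ?S"
    using P.chart_open_image[OF UP W] U(2) z by (auto simp: mdim_cotangent)
  have r: "Cinf_on (2 * mdim M) ?S (rep U \<phi> u)" if "smooth_on (cotangent_bundle M) W u" for u
    using P.smooth_on_chart[OF that UP] by (simp add: mdim_cotangent o_def)
  \<comment> \<open>The inner bracket must be known in the chart on an open set, not only at
    \<open>z\<close>, before the outer one can be evaluated.\<close>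
  have double: "canonical_bracket M (canonical_bracket M u v) w z =
      pb (mdim M) (pb (mdim M) (rep U \<phi> u) (rep U \<phi> v)) (rep U \<phi> w) ?x"
    if u: "smooth_on (cotangent_bundle M) W u" and v: "smooth_on (cotangent_bundle M) W v"
      and w: "smooth_on (cotangent_bundle M) W w" for u v w
  proof -
    have "rep U \<phi> (canonical_bracket M u v) y = pb (mdim M) (rep U \<phi> u) (rep U \<phi> v) y" if "y \<in> ?S" for y
    proof -
      obtain t where t: "t \<in> cdom M U" "t \<in> W" "y = cmap M U \<phi> t" using \<open>y \<in> ?S\<close> by blast
      show ?thesis
        using canonical_bracket_eq[OF U(1) t(1) P.smooth_nearI[OF W t(2) u] P.smooth_nearI[OF W t(2) v]]
        by (simp add: t(3) P.chart_inv[OF UP t(1)])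
    qed
    then have "pb (mdim M) (rep U \<phi> (canonical_bracket M u v)) (rep U \<phi> w) ?x =
        pb (mdim M) (pb (mdim M) (rep U \<phi> u) (rep U \<phi> v)) (rep U \<phi> w) ?x"
      by (intro pb_cong partial_cong[OF S x]) auto
    then show ?thesis
      using canonical_bracket_eq[OF U P.smooth_nearI[OF W z canonical_bracket_smooth[OF W u v]] P.smooth_nearI[OF W z w]]
      by simp
  qed
  show ?thesis
    unfolding double[OF f g h] double[OF g h f] double[OF h f g]
    by (rule pb_Jacobi[OF S r[OF f] r[OF g] r[OF h] x])
qed

lemma smooth_at_Cinf: "f \<in> Cinf (cotangent_bundle M) W \<Longrightarrow> openin (mtop (cotangent_bundle M)) W \<Longrightarrow> z \<in> W \<Longrightarrow> smooth_at z f"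
  by (rule P.Cinf_smooth_near)

lemma canonical_bracket_Cinf:
  assumes "f \<in> Cinf (cotangent_bundle M) (carr (cotangent_bundle M))" "g \<in> Cinf (cotangent_bundle M) (carr (cotangent_bundle M))"
  shows "canonical_bracket M f g \<in> Cinf (cotangent_bundle M) (carr (cotangent_bundle M))"
  by (rule P.CinfI[OF canonical_bracket_smooth[OF P.openin_carr P.Cinf_smooth_on[OF assms(1)] P.Cinf_smooth_on[OF assms(2)]]])
     (simp add: carr_cotangent canonical_bracket_outside)

lemma biderivation_canonical_bracket: "biderivation (cotangent_bundle M) (canonical_bracket M)"
  unfolding biderivation_def Let_def
proof (intro conjI ballI allI)
  let ?P = "cotangent_bundle M"
  have at: "smooth_at z f" if "f \<in> Cinf ?P (carr ?P)" "z \<in> cotangent_carrier M" for f z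
    using smooth_at_Cinf[OF that(1) P.openin_carr] that(2) carr_cotangent by simp
  note out = canonical_bracket_outside
  fix f g assume f: "f \<in> Cinf ?P (carr ?P)" and g: "g \<in> Cinf ?P (carr ?P)"
  show "canonical_bracket M f g \<in> Cinf ?P (carr ?P)"
    by (rule canonical_bracket_Cinf[OF f g])
  show "canonical_bracket M f g = (\<lambda>z. - canonical_bracket M g f z)"
  proof
    fix z show "canonical_bracket M f g z = - canonical_bracket M g f z"
      by (cases "z \<in> cotangent_carrier M") (simp_all add: out canonical_bracket_skew[OF at[OF g] at[OF f]])
  qed
  fix h assume h: "h \<in> Cinf ?P (carr ?P)"
  show "canonical_bracket M f (\<lambda>x. g x * h x) = (\<lambda>z. canonical_bracket M f g z * h z + g z * canonical_bracket M f h z)"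
  proof
    fix z show "canonical_bracket M f (\<lambda>x. g x * h x) z = canonical_bracket M f g z * h z + g z * canonical_bracket M f h z"
      by (cases "z \<in> cotangent_carrier M") (simp_all add: out canonical_bracket_mult at f g h)
  qed
  fix a b :: real
  have lin: "canonical_bracket M h (\<lambda>x. a * f x + b * g x) z = a * canonical_bracket M h f z + b * canonical_bracket M h g z" for z
    by (cases "z \<in> cotangent_carrier M")
       (simp_all add: out canonical_bracket_add canonical_bracket_scale P.smooth_near_scale at f g h)
  then show "canonical_bracket M h (\<lambda>x. a * f x + b * g x) = (\<lambda>x. a * canonical_bracket M h f x + b * canonical_bracket M h g x)"
    by blast
  have comb: "(\<lambda>x. a * f x + b * g x) \<in> Cinf ?P (carr ?P)"
    by (intro P.Cinf_add P.Cinf_scale P.openin_carr f g)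
  show "canonical_bracket M (\<lambda>x. a * f x + b * g x) h = (\<lambda>x. a * canonical_bracket M f h x + b * canonical_bracket M g h x)"
  proof
    fix z show "canonical_bracket M (\<lambda>x. a * f x + b * g x) h z = a * canonical_bracket M f h z + b * canonical_bracket M g h z"
    proof (cases "z \<in> cotangent_carrier M")
      case True
      then show ?thesis
        using lin[of z] canonical_bracket_skew[OF at[OF h True] at[OF comb True]]
          canonical_bracket_skew[OF at[OF h True] at[OF f True]] canonical_bracket_skew[OF at[OF h True] at[OF g True]] by simp
    qed (simp add: out)
  qed
qed

subsection \<open>The bracket on open subsets\<close>

text \<open>Partial derivatives are values of the differential on the coordinate vectors, which are
  tangent vectors of the bundle.\<close>

lemma partial_rep_of_differential:
  assumes eq: "differential (cotangent_bundle M) f z = differential (cotangent_bundle M) f' z"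
    and f: "smooth_at z f" and f': "smooth_at z f'" and U: "(U, \<phi>) \<in> atlas M" "z \<in> cdom M U" and k: "k < 2 * mdim M"
  shows "partial k (rep U \<phi> f) (cmap M U \<phi> z) = partial k (rep U \<phi> f') (cmap M U \<phi> z)"
proof -
  let ?v = "coord_vec (cotangent_bundle M) (cdom M U, cmap M U \<phi>) k z"
  note UP = cotangent_atlas[OF U(1)]
  have "?v \<in> tangent_space (cotangent_bundle M) z"
    by (rule P.coord_vec_tangent[OF UP U(2)]) (simp add: mdim_cotangent k)
  then have "?v f = ?v f'"
    using fun_cong[OF eq, of ?v] by (simp add: differential_def)
  then show ?thesis
    by (simp add: P.coord_vec_eq[OF UP U(2)] f f')
qed

text \<open>\<open>bivector\<close> quantifies over global functions only; a bump that is 1 near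
  \<open>z\<close> extends a local function without changing its germ at \<open>z\<close>.\<close>

lemma global_representative:
  assumes f: "smooth_at z f"
  obtains f' where "f' \<in> Cinf (cotangent_bundle M) (carr (cotangent_bundle M))"
    "differential (cotangent_bundle M) f' z = differential (cotangent_bundle M) f z"
proof -
  let ?P = "cotangent_bundle M"
  obtain W where W: "openin (mtop ?P) W" "z \<in> W" "smooth_on ?P W f"
    using f by (auto simp: smooth_near_def)
  obtain b B where b: "b \<in> Cc ?P W" "openin (mtop ?P) B" "z \<in> B" "\<forall>w\<in>B. b w = 1"
    using P.bump_at[OF W(1,2)] by metis
  have "differential ?P (\<lambda>w. b w * f w) z = differential ?P f z"
  proof
    fix v
    have "v (\<lambda>w. b w * f w) = v f" if "v \<in> tangent_space ?P z"
      by (rule P.tangent_cong[OF that b(2,3)]) (simp add: b(4))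
    then show "differential ?P (\<lambda>w. b w * f w) z v = differential ?P f z v"
      by (simp add: differential_def)
  qed
  then show thesis
    using that P.CcD(1)[OF P.Cc_mult[OF b(1) W(1,3)]] by blast
qed

text \<open>The bracket at \<open>z\<close> sees only the differentials, and every differential of a
  function smooth near \<open>z\<close> comes from a global function, so the description in
  \<open>bivector\<close> has exactly one witness.\<close>

lemma bivector_eq:
  assumes f: "smooth_at z f" and g: "smooth_at z g"
  shows "bivector (cotangent_bundle M) (canonical_bracket M) z
    (differential (cotangent_bundle M) f z) (differential (cotangent_bundle M) g z) = canonical_bracket M f g z"
proof -
  let ?P = "cotangent_bundle M"
  have z: "z \<in> cotangent_carrier M" by (rule smooth_at_carrier[OF f])
  obtain U \<phi> where U: "(U, \<phi>) \<in> atlas M" "z \<in> cdom M U"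
    by (rule cotangent_point_chart[OF z])
  have same: "canonical_bracket M f' g' z = canonical_bracket M f g z"
    if "f' \<in> Cinf ?P (carr ?P)" "g' \<in> Cinf ?P (carr ?P)"
      "differential ?P f' z = differential ?P f z" "differential ?P g' z = differential ?P g z" for f' g'
  proof -
    have f': "smooth_at z f'" and g': "smooth_at z g'"
      using that smooth_at_Cinf[OF _ P.openin_carr] z carr_cotangent by auto
    show ?thesis
      unfolding canonical_bracket_eq[OF U f' g'] canonical_bracket_eq[OF U f g]
      by (intro pb_cong partial_rep_of_differential[OF that(3) f' f U] partial_rep_of_differential[OF that(4) g' g U])
  qed
  obtain f' where f': "f' \<in> Cinf ?P (carr ?P)" "differential ?P f' z = differential ?P f z"
    by (rule global_representative[OF f])
  obtain g' where g': "g' \<in> Cinf ?P (carr ?P)" "differential ?P g' z = differential ?P g z"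
    by (rule global_representative[OF g])
  show ?thesis
    unfolding bivector_def
  proof (rule the_equality)
    show "\<exists>u\<in>Cinf ?P (carr ?P). \<exists>v\<in>Cinf ?P (carr ?P). differential ?P u z = differential ?P f z \<and>
        differential ?P v z = differential ?P g z \<and> canonical_bracket M f g z = canonical_bracket M u v z"
      using f' g' same[OF f'(1) g'(1) f'(2) g'(2)] by (intro bexI[of _ f'] bexI[of _ g']) auto
  next
    fix b assume "\<exists>u\<in>Cinf ?P (carr ?P). \<exists>v\<in>Cinf ?P (carr ?P). differential ?P u z = differential ?P f z \<and>
        differential ?P v z = differential ?P g z \<and> b = canonical_bracket M u v z"
    then show "b = canonical_bracket M f g z" using same by auto
  qed
qed

lemma local_bracket_eq:
  assumes "z \<in> W" "smooth_at z f" "smooth_at z g"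
  shows "local_bracket (cotangent_bundle M) (canonical_bracket M) W f g z = canonical_bracket M f g z"
  using assms by (simp add: local_bracket_def restr_def bivector_eq)

lemma local_bracket_Cinf:
  assumes W: "openin (mtop (cotangent_bundle M)) W" and f: "f \<in> Cinf (cotangent_bundle M) W" and g: "g \<in> Cinf (cotangent_bundle M) W"
  shows "local_bracket (cotangent_bundle M) (canonical_bracket M) W f g \<in> Cinf (cotangent_bundle M) W"
proof (rule P.CinfI)
  show "smooth_on (cotangent_bundle M) W (local_bracket (cotangent_bundle M) (canonical_bracket M) W f g)"
    by (rule P.smooth_on_cong[OF canonical_bracket_smooth[OF W P.Cinf_smooth_on[OF f] P.Cinf_smooth_on[OF g]] W])
       (simp add: local_bracket_eq smooth_at_Cinf[OF f W] smooth_at_Cinf[OF g W])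
qed (simp add: local_bracket_def restr_def)

end

section \<open>Fibrewise linear functions\<close>

context cotangent
begin

lemma lift_vf_eq: "z \<in> cotangent_carrier M \<Longrightarrow> lift_vf M X z = snd z (X (fst z))"
  by (cases z) (simp add: lift_vf_def)

lemma lift_vf_outside: "z \<notin> cotangent_carrier M \<Longrightarrow> lift_vf M X z = 0"
  by (cases z) (simp add: lift_vf_def)

lemma cotangent_carrierD:
  assumes "z \<in> cotangent_carrier M"
  shows "fst z \<in> carr M" "snd z \<in> cotangent_space M (fst z)"
  using assms by (auto simp: cotangent_carrier_def)

lemma cdom_carr: "cdom M (carr M) = carr (cotangent_bundle M)"
  by (auto simp: carr_cotangent cdom_def cotangent_carrier_def)

lemma vector_field_tangent:
  assumes "X \<in> vector_fields M W"
  shows "X q \<in> tangent_space M q"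
  using assms zero_tangent by (cases "q \<in> W") (auto simp: vector_fields_def)

text \<open>The definition tests vector fields only on functions that vanish off \<open>V\<close>;
  cutting \<open>f\<close> off there does not change its germ at the points of
  \<open>V\<close>.\<close>

lemma vector_field_smooth:
  assumes X: "X \<in> vector_fields M W" and V: "openin (mtop M) V" "V \<subseteq> W" and f: "smooth_on M V f"
  shows "smooth_on M V (\<lambda>q. X q f)"
proof -
  have "\<forall>V f. openin (mtop M) V \<and> V \<subseteq> W \<and> f \<in> Cinf M V \<longrightarrow> smooth_on M V (\<lambda>q. X q f)"
    using X unfolding vector_fields_def by blast
  then have "smooth_on M V (\<lambda>q. X q (restr V f))"
    using V restr_in_Cinf[OF V(1) f] by blast
  then show ?thesis
  proof (rule smooth_on_cong[OF _ V(1)])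
    fix q assume "q \<in> V"
    then show "X q (restr V f) = X q f"
      by (intro tangent_cong[OF vector_field_tangent[OF X] V(1)]) (auto simp: restr_def)
  qed
qed

lemma vector_field_coord_smooth:
  assumes X: "X \<in> vector_fields M W" and W: "openin (mtop M) W" and U: "(U, \<phi>) \<in> atlas M"
  shows "smooth_on M (U \<inter> W) (\<lambda>q. X q (\<lambda>x. \<phi> x i))"
proof (rule vector_field_smooth[OF X])
  show UW: "openin (mtop M) (U \<inter> W)" using chart_open[OF U] W by (rule openin_Int)
  show "smooth_on M (U \<inter> W) (\<lambda>x. \<phi> x i)"
    by (rule smooth_on_subset[OF smooth_on_chart_coord[OF U] chart_open[OF U] UW]) simp
qed simp

lemma vector_field_coord_Cinf_on:
  assumes "X \<in> vector_fields M W" "openin (mtop M) W" and U: "(U, \<phi>) \<in> atlas M"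
  shows "Cinf_on (mdim M) (\<phi> ` (U \<inter> W)) (\<lambda>y. X (inv_into U \<phi> y) (\<lambda>x. \<phi> x i))"
  using smooth_on_chart[OF vector_field_coord_smooth[OF assms] U] by simp

text \<open>The coordinate form of the lift, momenta paired with the components of \<open>X\<close>,
  comes from expanding the covector on the coordinate vectors.\<close>

lemma rep_lift_vf:
  assumes X: "X \<in> vector_fields M W" and U: "(U, \<phi>) \<in> atlas M" and x: "x \<in> cyl (mdim M) (2 * mdim M) (\<phi> ` (U \<inter> W))"
  shows "rep U \<phi> (lift_vf M X) x = (\<Sum>i<mdim M. x (mdim M + i) * X (inv_into U \<phi> (trunc (mdim M) x)) (\<lambda>r. \<phi> r i))"
proof -
  have x': "x \<in> cyl (mdim M) (2 * mdim M) (\<phi> ` U)" using x by (auto simp: cyl_def)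
  let ?z = "cinv U \<phi> x"
  have "?z \<in> cdom M (U \<inter> W)" by (rule cinv_in[OF U x])
  then have z: "?z \<in> cotangent_carrier M" "fst ?z \<in> U" by (auto simp: cdom_def)
  have "lift_vf M X ?z = (\<Sum>i<mdim M. X (fst ?z) (\<lambda>x. \<phi> x i) * snd ?z (coord_vec M (U, \<phi>) i (fst ?z)))"
    unfolding lift_vf_eq[OF z(1)]
    by (rule cotangent_expand[OF cotangent_carrierD(2)[OF z(1)] vector_field_tangent[OF X] U z(2)])
  also have "\<dots> = (\<Sum>i<mdim M. x (mdim M + i) * X (inv_into U \<phi> (trunc (mdim M) x)) (\<lambda>r. \<phi> r i))"
  proof (rule sum.cong)
    fix i assume "i \<in> {..<mdim M}"
    then have "snd ?z (coord_vec M (U, \<phi>) i (fst ?z)) = cmap M U \<phi> ?z (mdim M + i)"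
      by (simp add: cmap_def)
    then show "X (fst ?z) (\<lambda>x. \<phi> x i) * snd ?z (coord_vec M (U, \<phi>) i (fst ?z)) =
        x (mdim M + i) * X (inv_into U \<phi> (trunc (mdim M) x)) (\<lambda>r. \<phi> r i)"
      using cmap_cinv[OF U x'] by (simp add: fst_cinv)
  qed simp
  finally show ?thesis by (simp add: inv_into_cmap[OF U x'])
qed

lemma P_smooth_on_cdomI:
  assumes W: "openin (mtop M) W"
    and "\<And>U \<phi>. (U, \<phi>) \<in> atlas M \<Longrightarrow> Cinf_on (2 * mdim M) (cyl (mdim M) (2 * mdim M) (\<phi> ` (U \<inter> W))) (rep U \<phi> f)"
  shows "smooth_on (cotangent_bundle M) (cdom M W) f"
proof (rule P.smooth_onI[OF cotangent_open_preimage_fst[OF W]])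
  fix z assume z: "z \<in> cdom M W"
  then obtain U \<phi> where U: "(U, \<phi>) \<in> atlas M" "z \<in> cdom M U"
    using cotangent_point_chart[of z] by (auto simp: cdom_def)
  have "Cinf_on (mdim (cotangent_bundle M)) (cmap M U \<phi> ` (cdom M U \<inter> cdom M W)) (\<lambda>x. f (inv_into (cdom M U) (cmap M U \<phi>) x))"
    using assms(2)[OF U(1)] by (simp add: mdim_cotangent cdom_Int cmap_image[OF U(1)] o_def)
  then show "\<exists>U \<phi> W'. (U, \<phi>) \<in> atlas (cotangent_bundle M) \<and> openin (mtop (cotangent_bundle M)) W' \<and> z \<in> U \<and> z \<in> W' \<and>
      W' \<subseteq> cdom M W \<and> Cinf_on (mdim (cotangent_bundle M)) (\<phi> ` (U \<inter> W')) (\<lambda>x. f (inv_into U \<phi> x))"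
    using cotangent_atlas[OF U(1)] U(2) z cotangent_open_preimage_fst[OF W] by blast
qed

lemma lift_vf_Cinf:
  assumes X: "X \<in> vector_fields M W" and W: "openin (mtop M) W"
  shows "lift_vf M X \<in> Cinf (cotangent_bundle M) (cdom M W)"
proof (rule P.CinfI)
  show "smooth_on (cotangent_bundle M) (cdom M W) (lift_vf M X)"
  proof (rule P_smooth_on_cdomI[OF W])
    fix U \<phi> assume U: "(U, \<phi>) \<in> atlas M"
    let ?C = "cyl (mdim M) (2 * mdim M) (\<phi> ` (U \<inter> W))"
    have S: "openin (Euclidean_space (mdim M)) (\<phi> ` (U \<inter> W))" by (rule chart_open_image[OF U W])
    note C = openin_cyl[OF S, of "2 * mdim M"]
    have "Cinf_on (2 * mdim M) ?C (\<lambda>x. \<Sum>i<mdim M. x (mdim M + i) * X (inv_into U \<phi> (trunc (mdim M) x)) (\<lambda>r. \<phi> r i))"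
      by (intro Cinf_on_sum[OF C] Cinf_on_mult[OF C] Cinf_on_coord[OF C]
          Cinf_on_cyl(1)[OF S vector_field_coord_Cinf_on[OF X W U]])
    then show "Cinf_on (2 * mdim M) ?C (rep U \<phi> (lift_vf M X))"
      by (subst Cinf_on_cong[OF C]) (use rep_lift_vf[OF X U] in auto)
  qed
  show "lift_vf M X z = 0" if "z \<notin> cdom M W" for z
  proof (cases "z \<in> cotangent_carrier M")
    case True
    then have "X (fst z) = (\<lambda>_. 0)" using that X by (auto simp: vector_fields_def cdom_def)
    then show ?thesis
      using cotangent_zero[OF cotangent_carrierD(2)[OF True]] by (simp add: lift_vf_eq[OF True])
  qed (rule lift_vf_outside)
qed

lemma pullback_smooth:
  assumes W: "openin (mtop M) W" and f: "smooth_on M W f"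
  shows "smooth_on (cotangent_bundle M) (cdom M W) (\<lambda>z. f (fst z))"
proof (rule P_smooth_on_cdomI[OF W])
  fix U \<phi> assume U: "(U, \<phi>) \<in> atlas M"
  let ?C = "cyl (mdim M) (2 * mdim M) (\<phi> ` (U \<inter> W))"
  have S: "openin (Euclidean_space (mdim M)) (\<phi> ` (U \<inter> W))" by (rule chart_open_image[OF U W])
  have "Cinf_on (2 * mdim M) ?C (\<lambda>x. f (inv_into U \<phi> (trunc (mdim M) x)))"
    by (rule Cinf_on_cyl(1)[OF S smooth_on_chart[OF f U]])
  moreover have "rep U \<phi> (\<lambda>z. f (fst z)) x = f (inv_into U \<phi> (trunc (mdim M) x))" if "x \<in> ?C" for x
  proof -
    have "x \<in> cyl (mdim M) (2 * mdim M) (\<phi> ` U)" using that by (auto simp: cyl_def)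
    then show ?thesis by (simp add: inv_into_cmap[OF U] fst_cinv)
  qed
  ultimately show "Cinf_on (2 * mdim M) ?C (rep U \<phi> (\<lambda>z. f (fst z)))"
    by (subst Cinf_on_cong[OF openin_cyl[OF S]]) auto
qed

lemma continuous_map_fst: "continuous_map (mtop (cotangent_bundle M)) (mtop M) fst"
  unfolding continuous_map
proof (intro conjI allI impI)
  show "fst ` carr (cotangent_bundle M) \<subseteq> carr M"
    using cotangent_carrierD(1) by (auto simp: carr_cotangent)
  fix W assume W: "openin (mtop M) W"
  have "{z \<in> carr (cotangent_bundle M). fst z \<in> W} = cdom M W"
    by (auto simp: carr_cotangent cdom_def)
  then show "openin (mtop (cotangent_bundle M)) {z \<in> carr (cotangent_bundle M). fst z \<in> W}"
    using cotangent_open_preimage_fst[OF W] by simp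
qed

lemma lift_vf_sum:
  assumes "\<And>i. i \<in> I \<Longrightarrow> X i \<in> vector_fields M W" and z: "z \<in> cotangent_carrier M"
  shows "lift_vf M (\<lambda>r f. \<Sum>i\<in>I. h i r * X i r f) z = (\<Sum>i\<in>I. h i (fst z) * lift_vf M (X i) z)"
proof -
  note p = cotangent_carrierD(2)[OF z]
  have X: "X i (fst z) \<in> tangent_space M (fst z)" if "i \<in> I" for i
    by (rule vector_field_tangent[OF assms(1)[OF that]])
  have "snd z (\<lambda>f. \<Sum>i\<in>I. h i (fst z) * X i (fst z) f) = (\<Sum>i\<in>I. snd z (\<lambda>f. h i (fst z) * X i (fst z) f))"
    by (rule cotangent_sum[OF p]) (intro scale_tangent X)
  also have "\<dots> = (\<Sum>i\<in>I. h i (fst z) * snd z (X i (fst z)))"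
    by (intro sum.cong refl cotangent_scale[OF p] X)
  finally show ?thesis by (simp add: lift_vf_eq[OF z])
qed

lemma lift_vf_scale:
  assumes X: "X \<in> vector_fields M W" and z: "z \<in> cotangent_carrier M"
  shows "lift_vf M (\<lambda>r f. h r * X r f) z = h (fst z) * lift_vf M X z"
  using cotangent_scale[OF cotangent_carrierD(2)[OF z] vector_field_tangent[OF X]] by (simp add: lift_vf_eq[OF z])

text \<open>In a chart both lifts are sums of momenta times components, and the bracket of two such
  sums is again linear in the momenta, with the components of the commutator as coefficients. That
  the Lie bracket is a vector field is assumed; for members of a foliation closure provides
  it.\<close>

lemma canonical_bracket_lift_vf:
  assumes X: "X \<in> vector_fields M (carr M)" and Y: "Y \<in> vector_fields M (carr M)"
    and XY: "lie_bracket M X Y \<in> vector_fields M (carr M)" and z: "z \<in> cotangent_carrier M"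
  shows "canonical_bracket M (lift_vf M X) (lift_vf M Y) z = lift_vf M (lie_bracket M X Y) z"
proof -
  let ?n = "mdim M"
  obtain U \<phi> where U: "(U, \<phi>) \<in> atlas M" "z \<in> cdom M U"
    by (rule cotangent_point_chart[OF z])
  have UC: "U \<inter> carr M = U" using chart_carr[OF U(1)] by blast
  define q where "q = fst z"
  have q: "q \<in> U" using U(2) by (simp add: q_def cdom_def)
  let ?S = "\<phi> ` U" and ?x = "cmap M U \<phi> z"
  define B where "B Z i y = Z (inv_into U \<phi> y) (\<lambda>r. \<phi> r i)" for Z :: "'a vfield" and i y
  have S: "openin (Euclidean_space ?n) ?S" by (rule chart_image_open[OF U(1)])
  note C = openin_cyl[OF S, of "2 * ?n"]
  have x: "?x \<in> cyl ?n (2 * ?n) ?S" using cmap_image_cdom[OF U(1)] U(2) by blast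
  have y: "trunc ?n ?x = \<phi> q" using trunc_cmap[OF U(1,2)] by (simp add: q_def)
  have Bq: "B Z i (\<phi> q) = Z q (\<lambda>r. \<phi> r i)" for Z i
    by (simp add: B_def chart_inv[OF U(1) q])
  have rep_eq: "\<forall>x\<in>cyl ?n (2 * ?n) ?S. rep U \<phi> (lift_vf M Z) x = (\<Sum>i<?n. x (?n + i) * B Z i (trunc ?n x))"
    if "Z \<in> vector_fields M (carr M)" for Z
    using rep_lift_vf[OF that U(1)] by (simp add: UC B_def)
  have B_smooth: "Cinf_on ?n ?S (B Z i)" if "Z \<in> vector_fields M (carr M)" for Z i
    using vector_field_coord_Cinf_on[OF that openin_carr U(1)] by (simp add: UC B_def[abs_def])
  have dq: "partial i (rep U \<phi> (lift_vf M Z)) ?x = (\<Sum>j<?n. ?x (?n + j) * partial i (B Z j) (\<phi> q))"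
    and dp: "partial (?n + i) (rep U \<phi> (lift_vf M Z)) ?x = B Z i (\<phi> q)"
    if i: "i < ?n" and Z: "Z \<in> vector_fields M (carr M)" for i Z
  proof -
    have "i < 2 * ?n" "?n + i < 2 * ?n" using i by auto
    then have "partial i (rep U \<phi> (lift_vf M Z)) ?x = partial i (\<lambda>x. \<Sum>i<?n. x (?n + i) * B Z i (trunc ?n x)) ?x"
      "partial (?n + i) (rep U \<phi> (lift_vf M Z)) ?x = partial (?n + i) (\<lambda>x. \<Sum>i<?n. x (?n + i) * B Z i (trunc ?n x)) ?x"
      using partial_cong[OF C x _ rep_eq[OF Z]] by blast+
    then show "partial i (rep U \<phi> (lift_vf M Z)) ?x = (\<Sum>j<?n. ?x (?n + j) * partial i (B Z j) (\<phi> q))"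
      "partial (?n + i) (rep U \<phi> (lift_vf M Z)) ?x = B Z i (\<phi> q)"
      using partial_sum_fibre[OF S, of "B Z" ?x i] B_smooth[OF Z] x i by (simp_all add: y)
  qed
  have at: "smooth_at z (lift_vf M Z)" if "Z \<in> vector_fields M (carr M)" for Z
    by (rule smooth_at_Cinf[OF lift_vf_Cinf[OF that openin_carr] cotangent_open_preimage_fst[OF openin_carr]])
       (simp add: cdom_carr carr_cotangent z)
  \<comment> \<open>The Lie bracket is evaluated on coordinate functions only, so one derivation
    acts just on the components of the other and no second derivatives of a test function
    arise.\<close>
  have deriv: "Z q (\<lambda>r. Z' r (\<lambda>r. \<phi> r j)) = (\<Sum>i<?n. B Z i (\<phi> q) * partial i (B Z' j) (\<phi> q))"
    if Z: "Z \<in> vector_fields M (carr M)" "Z' \<in> vector_fields M (carr M)" for Z Z' j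
  proof -
    have "smooth_near M q (\<lambda>r. Z' r (\<lambda>r. \<phi> r j))"
      using smooth_nearI[OF chart_open[OF U(1)] q] vector_field_coord_smooth[OF Z(2) openin_carr U(1)] by (simp add: UC)
    from tangent_expand[OF vector_field_tangent[OF Z(1)] U(1) q this] show ?thesis
      unfolding Bq by (simp add: B_def[abs_def] o_def)
  qed
  have "lift_vf M (lie_bracket M X Y) z = rep U \<phi> (lift_vf M (lie_bracket M X Y)) ?x"
    by (simp add: inv_into_f_f[OF cmap_inj[OF U(1)] U(2)])
  also have "\<dots> = (\<Sum>j<?n. ?x (?n + j) * B (lie_bracket M X Y) j (\<phi> q))"
    using rep_eq[OF XY] x by (simp add: y)
  also have "\<dots> = (\<Sum>j<?n. ?x (?n + j) * ((\<Sum>i<?n. B X i (\<phi> q) * partial i (B Y j) (\<phi> q)) -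
      (\<Sum>i<?n. B Y i (\<phi> q) * partial i (B X j) (\<phi> q))))"
    unfolding Bq[of "lie_bracket M X Y"]
    by (simp add: lie_bracket_def smooth_near_chart_coord[OF U(1) q] deriv X Y)
  also have "\<dots> = (\<Sum>j<?n. \<Sum>i<?n. ?x (?n + j) * (B X i (\<phi> q) * partial i (B Y j) (\<phi> q) - B Y i (\<phi> q) * partial i (B X j) (\<phi> q)))"
    by (simp add: sum_subtractf[symmetric] sum_distrib_left)
  also have "\<dots> = (\<Sum>i<?n. \<Sum>j<?n. ?x (?n + j) * (B X i (\<phi> q) * partial i (B Y j) (\<phi> q) - B Y i (\<phi> q) * partial i (B X j) (\<phi> q)))"
    by (rule sum.swap)
  also have "\<dots> = pb ?n (rep U \<phi> (lift_vf M X)) (rep U \<phi> (lift_vf M Y)) ?x"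
    unfolding pb_def
  proof (rule sum.cong[OF refl])
    fix i assume "i \<in> {..<?n}"
    then have i: "i < ?n" by simp
    show "(\<Sum>j<?n. ?x (?n + j) * (B X i (\<phi> q) * partial i (B Y j) (\<phi> q) - B Y i (\<phi> q) * partial i (B X j) (\<phi> q))) =
        partial (?n + i) (rep U \<phi> (lift_vf M X)) ?x * partial i (rep U \<phi> (lift_vf M Y)) ?x -
        partial i (rep U \<phi> (lift_vf M X)) ?x * partial (?n + i) (rep U \<phi> (lift_vf M Y)) ?x"
      unfolding dq[OF i X] dq[OF i Y] dp[OF i X] dp[OF i Y]
      by (simp add: sum_distrib_left sum_distrib_right sum_subtractf[symmetric] algebra_simps)
  qed
  also have "\<dots> = canonical_bracket M (lift_vf M X) (lift_vf M Y) z"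
    by (rule canonical_bracket_eq[OF U at[OF X] at[OF Y], symmetric])
  finally show ?thesis ..
qed

end

section \<open>The sheaf of a singular foliation\<close>

locale foliated = cotangent M for M :: "'a manifold" +
  fixes F :: "'a vfield set"
  assumes foliation: "singular_foliation M F"
begin

abbreviation PM :: "('a \<times> 'a cvec) manifold" where "PM \<equiv> cotangent_bundle M"

abbreviation J :: "('a \<times> 'a cvec \<Rightarrow> real) set" where "J \<equiv> J_foliation M F"

abbreviation I :: "('a \<times> 'a cvec) set \<Rightarrow> ('a \<times> 'a cvec \<Rightarrow> real) set" where "I \<equiv> I_foliation M F"

section \<open>Consequences of the axioms of a foliation\<close>

lemma F_vector_field: "X \<in> F \<Longrightarrow> X \<in> vector_fields M (carr M)"
  using foliation by (auto simp: singular_foliation_def vector_fields_c_def)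

lemma F_mult: "h \<in> Cinf M (carr M) \<Longrightarrow> X \<in> F \<Longrightarrow> (\<lambda>q f. h q * X q f) \<in> F"
  using foliation unfolding singular_foliation_def by blast

lemma F_lie_bracket: "X \<in> F \<Longrightarrow> Y \<in> F \<Longrightarrow> lie_bracket M X Y \<in> F"
  using foliation unfolding singular_foliation_def by blast

lemma F_locally_generated:
  assumes "q \<in> carr M"
  obtains U and N :: nat and X where "openin (mtop M) U" "q \<in> U" "\<forall>a<N. X a \<in> vector_fields M U"
    "{Y \<in> F. vsupp M Y \<subseteq> U} = {(\<lambda>r f. \<Sum>a<N. h a r * X a r f) | h. \<forall>a<N. h a \<in> Cc M U}"
proof -
  have "\<forall>q\<in>carr M. \<exists>U (N::nat) X. openin (mtop M) U \<and> q \<in> U \<and>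
        (\<forall>a<N. X a \<in> vector_fields M U) \<and>
        {Y \<in> F. vsupp M Y \<subseteq> U} =
          {(\<lambda>r f. \<Sum>a<N. h a r * X a r f) | h. \<forall>a<N. h a \<in> Cc M U}"
    using foliation unfolding singular_foliation_def by (elim conjE)
  from bspec[OF this assms] show thesis
    by (elim exE conjE) (rule that, auto)
qed

lemma lift_F_Cinf: "X \<in> F \<Longrightarrow> lift_vf M X \<in> Cinf PM (carr PM)"
  using lift_vf_Cinf[OF F_vector_field openin_carr] unfolding cdom_carr .

lemma canonical_bracket_lift_F:
  "X \<in> F \<Longrightarrow> Y \<in> F \<Longrightarrow> z \<in> carr PM \<Longrightarrow>
    canonical_bracket M (lift_vf M X) (lift_vf M Y) z = lift_vf M (lie_bracket M X Y) z"
  by (rule canonical_bracket_lift_vf) (simp_all add: F_vector_field F_lie_bracket flip: carr_cotangent)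

lemma smooth_at_carr: "f \<in> Cinf PM (carr PM) \<Longrightarrow> z \<in> carr PM \<Longrightarrow> smooth_at z f"
  by (rule smooth_at_Cinf[OF _ P.openin_carr])

subsection \<open>The module generated by the lifts\<close>

lemma J_memI:
  fixes N :: nat
  assumes "\<And>a. a < N \<Longrightarrow> h a \<in> Cc PM (carr PM)" "\<And>a. a < N \<Longrightarrow> X a \<in> F"
    and "\<And>z. f z = (\<Sum>a<N. h a z * lift_vf M (X a) z)"
  shows "f \<in> J"
  unfolding J_foliation_def
proof (intro CollectI exI[of _ N] exI[of _ h] exI[of _ X] conjI allI impI)
  show "f = (\<lambda>z. \<Sum>a<N. h a z * lift_vf M (X a) z)" using assms(3) by (rule ext)
qed (use assms(1,2) in auto)

lemma J_memE:
  assumes "f \<in> J"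
  obtains N :: nat and h X where "\<forall>a<N. h a \<in> Cc PM (carr PM)" "\<forall>a<N. X a \<in> F"
    "f = (\<lambda>z. \<Sum>a<N. h a z * lift_vf M (X a) z)"
proof -
  have "\<exists>(N::nat) h X. f = (\<lambda>z. \<Sum>a<N. h a z * lift_vf M (X a) z) \<and> (\<forall>a<N. h a \<in> Cc PM (carr PM) \<and> X a \<in> F)"
    using assms unfolding J_foliation_def by (rule CollectD)
  then show thesis by (elim exE conjE) (rule that, auto)
qed

lemma zero_in_J: "(\<lambda>_. 0) \<in> J"
  by (rule J_memI[of 0]) auto

lemma lift_in_J: "h \<in> Cc PM (carr PM) \<Longrightarrow> X \<in> F \<Longrightarrow> (\<lambda>z. h z * lift_vf M X z) \<in> J"
  by (rule J_memI[of "Suc 0" "\<lambda>_. h" "\<lambda>_. X"]) auto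

lemma J_add:
  assumes "f \<in> J" "g \<in> J"
  shows "(\<lambda>z. f z + g z) \<in> J"
proof -
  obtain N :: nat and h X where f: "\<forall>a<N. h a \<in> Cc PM (carr PM)" "\<forall>a<N. X a \<in> F"
    "f = (\<lambda>z. \<Sum>a<N. h a z * lift_vf M (X a) z)"
    by (rule J_memE[OF assms(1)])
  note f = f(1)[rule_format] f(2)[rule_format] f(3)
  obtain N' :: nat and k Y where g: "\<forall>a<N'. k a \<in> Cc PM (carr PM)" "\<forall>a<N'. Y a \<in> F"
    "g = (\<lambda>z. \<Sum>a<N'. k a z * lift_vf M (Y a) z)"
    by (rule J_memE[OF assms(2)])
  note g = g(1)[rule_format] g(2)[rule_format] g(3)
  show ?thesis
  proof (rule J_memI)
    fix a assume "a < N + N'"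
    then show "(if a < N then h a else k (a - N)) \<in> Cc PM (carr PM)" "(if a < N then X a else Y (a - N)) \<in> F"
      using f g by auto
  next
    fix z
    show "f z + g z = (\<Sum>a<N + N'. (if a < N then h a else k (a - N)) z * lift_vf M (if a < N then X a else Y (a - N)) z)"
      unfolding sum_lessThan_add by (simp add: f(3) g(3))
  qed
qed

lemma J_sum: "(\<And>i. i \<in> A \<Longrightarrow> f i \<in> J) \<Longrightarrow> (\<lambda>z. \<Sum>i\<in>A. f i z) \<in> J"
  by (induction A rule: infinite_finite_induct) (simp_all add: zero_in_J J_add)

lemma Cc_mult_Cinf: "h \<in> Cc PM W \<Longrightarrow> openin (mtop PM) W \<Longrightarrow> k \<in> Cinf PM W \<Longrightarrow> (\<lambda>z. h z * k z) \<in> Cc PM W"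
  by (rule P.Cc_mult) (auto intro: P.Cinf_smooth_on)

lemma Cc_into_carr: "openin (mtop PM) W \<Longrightarrow> h \<in> Cc PM W \<Longrightarrow> h \<in> Cc PM (carr PM)"
  using P.Cc_mono[OF openin_subset] by blast

lemma J_Cinf:
  assumes "f \<in> J"
  shows "f \<in> Cinf PM (carr PM)"
proof -
  obtain N :: nat and h X where f: "\<forall>a<N. h a \<in> Cc PM (carr PM)" "\<forall>a<N. X a \<in> F"
    "f = (\<lambda>z. \<Sum>a<N. h a z * lift_vf M (X a) z)"
    by (rule J_memE[OF assms(1)])
  note f = f(1)[rule_format] f(2)[rule_format] f(3)
  show ?thesis
    unfolding f(3)
    by (intro P.Cinf_sum[OF P.openin_carr] P.Cinf_mult[OF P.openin_carr] P.CcD(1)[OF f(1)] lift_F_Cinf f(2)) auto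
qed

text \<open>By the Leibniz rule the bracket of the lift of \<open>X\<close> with \<open>k a\<close>
  times the lift of \<open>Y a\<close> is a multiple of the lift of \<open>Y a\<close> plus a
  multiple of the lift of the Lie bracket, which is in \<open>F\<close>. The factor \<open>u\<close>
  gives the coefficients compact support.\<close>

lemma J_bracket_lift:
  assumes X: "X \<in> F" and g: "g \<in> J" and u: "u \<in> Cc PM (carr PM)"
  shows "(\<lambda>z. u z * canonical_bracket M (lift_vf M X) g z) \<in> J"
proof -
  obtain N :: nat and k Y where k: "\<forall>a<N. k a \<in> Cc PM (carr PM)" and Y: "\<forall>a<N. Y a \<in> F"
    and g_eq: "g = (\<lambda>z. \<Sum>a<N. k a z * lift_vf M (Y a) z)"
    by (rule J_memE[OF g])
  note k = k[rule_format] and Y = Y[rule_format]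
  let ?b = "canonical_bracket M (lift_vf M X)"
  have "(\<lambda>z. \<Sum>a<N. (u z * ?b (k a) z) * lift_vf M (Y a) z + (u z * k a z) * lift_vf M (lie_bracket M X (Y a)) z) \<in> J"
    by (intro J_sum J_add lift_in_J Cc_mult_Cinf[OF u P.openin_carr] canonical_bracket_Cinf lift_F_Cinf X Y
        F_lie_bracket P.CcD(1)[OF k]) auto
  moreover have "u z * ?b g z = (\<Sum>a<N. (u z * ?b (k a) z) * lift_vf M (Y a) z + (u z * k a z) * lift_vf M (lie_bracket M X (Y a)) z)"
    for z
  proof (cases "z \<in> carr PM")
    case True
    note X_at = smooth_at_carr[OF lift_F_Cinf[OF X] True]
    have k_at: "smooth_at z (k a)" and Y_at: "smooth_at z (lift_vf M (Y a))" if "a < N" for a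
      using smooth_at_carr[OF P.CcD(1)[OF k[OF that]] True] smooth_at_carr[OF lift_F_Cinf[OF Y[OF that]] True] .
    have "?b g z = (\<Sum>a<N. ?b (\<lambda>z. k a z * lift_vf M (Y a) z) z)"
      unfolding g_eq by (rule canonical_bracket_sum[OF P.smooth_near_mult[OF k_at Y_at] X_at]) auto
    also have "\<dots> = (\<Sum>a<N. ?b (k a) z * lift_vf M (Y a) z + k a z * lift_vf M (lie_bracket M X (Y a)) z)"
      by (intro sum.cong refl) (simp add: canonical_bracket_mult[OF k_at Y_at X_at] canonical_bracket_lift_F[OF X Y True])
    finally show ?thesis by (simp add: sum_distrib_left algebra_simps)
  next
    case False
    then show ?thesis using P.Cinf_outside[OF P.CcD(1)[OF u]] by simp
  qed
  ultimately show ?thesis by presburger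
qed

text \<open>The Leibniz rule in the first argument, obtained from the second by skew symmetry,
  leaves brackets of a lift with \<open>g\<close>; there \<open>u * h a\<close> takes the role of
  \<open>u\<close> in \<open>J_bracket_lift\<close>.\<close>

lemma J_bracket:
  assumes f: "f \<in> J" and g: "g \<in> J" and u: "u \<in> Cc PM (carr PM)"
  shows "(\<lambda>z. u z * canonical_bracket M f g z) \<in> J"
proof -
  obtain N :: nat and h X where h: "\<forall>a<N. h a \<in> Cc PM (carr PM)" and X: "\<forall>a<N. X a \<in> F"
    and f_eq: "f = (\<lambda>z. \<Sum>a<N. h a z * lift_vf M (X a) z)"
    by (rule J_memE[OF f])
  note h = h[rule_format] and X = X[rule_format]
  note g_Cinf = J_Cinf[OF g] and f_Cinf = J_Cinf[OF f]
  let ?b = "canonical_bracket M"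
  have "(\<lambda>z. \<Sum>a<N. (u z * ?b (h a) g z) * lift_vf M (X a) z + (u z * h a z) * ?b (lift_vf M (X a)) g z) \<in> J"
    by (intro J_sum J_add lift_in_J J_bracket_lift[OF _ g] Cc_mult_Cinf[OF u P.openin_carr] canonical_bracket_Cinf
        g_Cinf X P.CcD(1)[OF h]) auto
  moreover have "u z * ?b f g z = (\<Sum>a<N. (u z * ?b (h a) g z) * lift_vf M (X a) z + (u z * h a z) * ?b (lift_vf M (X a)) g z)"
    for z
  proof (cases "z \<in> carr PM")
    case True
    note g_at = smooth_at_carr[OF g_Cinf True]
    have h_at: "smooth_at z (h a)" and X_at: "smooth_at z (lift_vf M (X a))" if "a < N" for a
      using smooth_at_carr[OF P.CcD(1)[OF h[OF that]] True] smooth_at_carr[OF lift_F_Cinf[OF X[OF that]] True] .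
    have "?b f g z = - ?b g f z"
      by (rule canonical_bracket_skew[OF g_at smooth_at_carr[OF f_Cinf True]])
    also have "?b g f z = (\<Sum>a<N. ?b g (\<lambda>z. h a z * lift_vf M (X a) z) z)"
      unfolding f_eq by (rule canonical_bracket_sum[OF P.smooth_near_mult[OF h_at X_at] g_at]) auto
    also have "- \<dots> = (\<Sum>a<N. ?b (h a) g z * lift_vf M (X a) z + h a z * ?b (lift_vf M (X a)) g z)"
      unfolding sum_negf[symmetric]
      by (intro sum.cong refl)
         (simp add: canonical_bracket_mult[OF h_at X_at g_at] canonical_bracket_skew[OF h_at g_at]
           canonical_bracket_skew[OF X_at g_at])
    finally show ?thesis by (simp add: sum_distrib_left algebra_simps)
  next
    case False
    then show ?thesis using P.Cinf_outside[OF P.CcD(1)[OF u]] by simp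
  qed
  ultimately show ?thesis by presburger
qed

subsection \<open>The sheaf\<close>

lemma I_memD:
  assumes "f \<in> I W"
  shows "f \<in> Cinf PM W" "\<rho> \<in> Cc PM W \<Longrightarrow> (\<lambda>z. \<rho> z * f z) \<in> J"
  using assms by (auto simp: I_foliation_def)

lemma I_memI: "f \<in> Cinf PM W \<Longrightarrow> (\<And>\<rho>. \<rho> \<in> Cc PM W \<Longrightarrow> (\<lambda>z. \<rho> z * f z) \<in> J) \<Longrightarrow> f \<in> I W"
  by (simp add: I_foliation_def)

lemma zero_in_I: "openin (mtop PM) W \<Longrightarrow> (\<lambda>_. 0) \<in> I W"
  by (rule I_memI) (simp_all add: P.zero_in_Cinf zero_in_J)

lemma is_submodule_I:
  assumes W: "openin (mtop PM) W"
  shows "is_submodule PM W (I W)"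
  unfolding is_submodule_def
proof (intro conjI ballI)
  show "I W \<subseteq> Cinf PM W" using I_memD(1) by blast
  show "(\<lambda>_. 0) \<in> I W" by (rule zero_in_I[OF W])
  show "(\<lambda>x. f x + g x) \<in> I W" if "f \<in> I W" "g \<in> I W" for f g
    using J_add[OF I_memD(2)[OF that(1)] I_memD(2)[OF that(2)]]
    by (intro I_memI P.Cinf_add[OF W] I_memD(1)[OF that(1)] I_memD(1)[OF that(2)]) (simp add: distrib_left)
  show "(\<lambda>x. h x * f x) \<in> I W" if "h \<in> Cinf PM W" "f \<in> I W" for h f
    using I_memD(2)[OF that(2) Cc_mult_Cinf[OF _ W that(1)]]
    by (intro I_memI P.Cinf_mult[OF W that(1)] I_memD(1)[OF that(2)]) (simp add: mult.assoc)
qed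

lemma restr_in_I:
  assumes U: "openin (mtop PM) U" and V: "openin (mtop PM) V" "V \<subseteq> U" and f: "f \<in> I U"
  shows "restr V f \<in> I V"
proof (rule I_memI)
  show "restr V f \<in> Cinf PM V"
    by (rule P.restr_in_Cinf[OF V(1) P.smooth_on_subset[OF P.Cinf_smooth_on[OF I_memD(1)[OF f]] U V]])
  fix \<rho> assume \<rho>: "\<rho> \<in> Cc PM V"
  then have "(\<lambda>z. \<rho> z * f z) \<in> J"
    using I_memD(2)[OF f] P.Cc_mono[OF V(2)] by blast
  moreover have "(\<lambda>z. \<rho> z * f z) = (\<lambda>z. \<rho> z * restr V f z)"
    using P.CcD(5)[OF \<rho>] by (auto simp: restr_def)
  ultimately show "(\<lambda>z. \<rho> z * restr V f z) \<in> J" by simp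
qed

text \<open>Membership is tested on compactly supported multiples only, so finitely many of the
  given neighbourhoods, covering the support, decide it.\<close>

lemma I_locally:
  assumes W: "openin (mtop PM) W" and f: "f \<in> Cinf PM W"
    and loc: "\<And>z. z \<in> W \<Longrightarrow> \<exists>V. openin (mtop PM) V \<and> z \<in> V \<and> V \<subseteq> W \<and> restr V f \<in> I V"
  shows "f \<in> I W"
proof (rule I_memI[OF f])
  fix \<rho> assume \<rho>: "\<rho> \<in> Cc PM W"
  \<comment> \<open>The quantifier over \<open>\<sigma>\<close> makes the property survive the
    combination of two bumps, where \<open>\<sigma>\<close> is replaced by
    \<open>\<sigma> * (1 - \<eta>)\<close>.\<close>
  let ?Q = "\<lambda>\<eta>. \<forall>\<sigma>\<in>Cc PM W. (\<lambda>z. \<eta> z * \<sigma> z * f z) \<in> J"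
  obtain \<eta> B where \<eta>: "?Q \<eta>" "supp PM \<rho> \<subseteq> B" "\<forall>z\<in>B. \<eta> z = 1"
  proof (rule P.compact_bump_induct[OF P.CcD(2,3)[OF \<rho>], of ?Q])
    show "?Q (\<lambda>_. 0)" by (simp add: zero_in_J)
    show "?Q (\<lambda>z. \<eta> z + (1 - \<eta> z) * \<eta>' z)" if "\<eta> \<in> Cc PM W" "\<eta>' \<in> Cc PM W" "?Q \<eta>" "?Q \<eta>'" for \<eta> \<eta>'
    proof
      fix \<sigma> assume \<sigma>: "\<sigma> \<in> Cc PM W"
      have "smooth_on PM W \<eta>"
        using P.smooth_on_subset[OF P.Cinf_smooth_on[OF P.CcD(1)[OF that(1)]] P.openin_carr W] openin_subset[OF W] by blast
      then have "(\<lambda>z. \<sigma> z * (1 - \<eta> z)) \<in> Cc PM W"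
        by (intro P.Cc_mult[OF \<sigma> W] P.smooth_on_diff[OF W] P.smooth_on_const[OF W])
      then have "(\<lambda>z. \<eta> z * \<sigma> z * f z + \<eta>' z * (\<sigma> z * (1 - \<eta> z)) * f z) \<in> J"
        using that(3,4) \<sigma> by (intro J_add) auto
      then show "(\<lambda>z. (\<eta> z + (1 - \<eta> z) * \<eta>' z) * \<sigma> z * f z) \<in> J"
        by (simp add: algebra_simps)
    qed
    show "\<exists>\<eta> B. \<eta> \<in> Cc PM W \<and> ?Q \<eta> \<and> openin (mtop PM) B \<and> z \<in> B \<and> (\<forall>y\<in>B. \<eta> y = 1)" if "z \<in> W" for z
    proof -
      obtain V where V: "openin (mtop PM) V" "z \<in> V" "V \<subseteq> W" "restr V f \<in> I V"
        using loc[OF \<open>z \<in> W\<close>] by blast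
      obtain b B where b: "b \<in> Cc PM V" "openin (mtop PM) B" "z \<in> B" "\<forall>y\<in>B. b y = 1"
        using P.bump_at[OF V(1,2)] by metis
      have "(\<lambda>z. b z * \<sigma> z * f z) \<in> J" if \<sigma>: "\<sigma> \<in> Cc PM W" for \<sigma>
      proof -
        have "smooth_on PM V \<sigma>"
          using P.smooth_on_subset[OF P.Cinf_smooth_on[OF P.CcD(1)[OF \<sigma>]] P.openin_carr V(1)] openin_subset[OF V(1)] by blast
        then have "(\<lambda>z. b z * \<sigma> z * restr V f z) \<in> J"
          by (rule I_memD(2)[OF V(4) P.Cc_mult[OF b(1) V(1)]])
        moreover have "(\<lambda>z. b z * \<sigma> z * restr V f z) = (\<lambda>z. b z * \<sigma> z * f z)"
          using P.CcD(5)[OF b(1)] by (auto simp: restr_def)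
        ultimately show ?thesis by simp
      qed
      then show ?thesis
        using b P.Cc_mono[OF V(3)] by (intro exI[of _ b] exI[of _ B]) auto
    qed
  qed blast
  have "(\<lambda>z. \<eta> z * \<rho> z * f z) \<in> J" using \<eta>(1) \<rho> by blast
  moreover have "\<eta> z * \<rho> z * f z = \<rho> z * f z" for z
  proof (cases "z \<in> supp PM \<rho>")
    case True
    then have "\<eta> z = 1" using \<eta>(2,3) by blast
    then show ?thesis by simp
  next
    case False
    then show ?thesis using P.CcD(4)[OF \<rho>] by simp
  qed
  ultimately show "(\<lambda>z. \<rho> z * f z) \<in> J" by simp
qed

text \<open>Functions glue pointwise, and membership of the result in the sheaf is a local question
  by \<open>I_locally\<close>.\<close>

lemma I_glue:
  assumes s: "\<And>U. U \<in> \<U> \<Longrightarrow> openin (mtop PM) U \<and> s U \<in> I U"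
    and compat: "\<And>U V. U \<in> \<U> \<Longrightarrow> V \<in> \<U> \<Longrightarrow> restr (U \<inter> V) (s U) = restr (U \<inter> V) (s V)"
  shows "\<exists>!f. f \<in> I (\<Union>\<U>) \<and> (\<forall>U\<in>\<U>. restr U f = s U)"
proof
  define f where "f z = (if z \<in> \<Union>\<U> then s (SOME U. U \<in> \<U> \<and> z \<in> U) z else 0)" for z
  have f_eq: "f z = s U z" if "U \<in> \<U>" "z \<in> U" for U z
  proof -
    define V where "V = (SOME U. U \<in> \<U> \<and> z \<in> U)"
    have V: "V \<in> \<U> \<and> z \<in> V" unfolding V_def by (rule someI[of _ U]) (use that in blast)
    have "restr (V \<inter> U) (s V) z = restr (V \<inter> U) (s U) z"
      using compat[OF conjunct1[OF V] that(1)] by (rule fun_cong)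
    then have "s V z = s U z" using V that(2) by (simp add: restr_def)
    moreover have "f z = s V z" unfolding f_def V_def using that by auto
    ultimately show ?thesis by simp
  qed
  have rf: "restr U f = s U" if "U \<in> \<U>" for U
  proof
    fix z show "restr U f z = s U z"
      using f_eq[OF that] P.Cinf_outside[OF I_memD(1)[OF conjunct2[OF s[OF that]]]] by (simp add: restr_def)
  qed
  have W: "openin (mtop PM) (\<Union>\<U>)" using s by blast
  have "smooth_on PM (\<Union>\<U>) f"
  proof (rule P.smooth_on_locally[OF W])
    fix z assume "z \<in> \<Union>\<U>"
    then obtain U where U: "U \<in> \<U>" "z \<in> U" by blast
    have oU: "openin (mtop PM) U" using s[OF U(1)] by blast
    have "smooth_on PM U f"
      by (rule P.smooth_on_cong[OF P.Cinf_smooth_on[OF I_memD(1)[of "s U"]] oU]) (use s[OF U(1)] f_eq[OF U(1)] in auto)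
    then show "\<exists>V. openin (mtop PM) V \<and> z \<in> V \<and> V \<subseteq> \<Union>\<U> \<and> smooth_on PM V f"
      using U oU by blast
  qed
  then have fC: "f \<in> Cinf PM (\<Union>\<U>)" by (rule P.CinfI) (simp add: f_def)
  have "f \<in> I (\<Union>\<U>)"
  proof (rule I_locally[OF W fC])
    fix z assume "z \<in> \<Union>\<U>"
    then obtain U where "U \<in> \<U>" "z \<in> U" by blast
    then show "\<exists>V. openin (mtop PM) V \<and> z \<in> V \<and> V \<subseteq> \<Union>\<U> \<and> restr V f \<in> I V"
      using s[of U] rf[of U] by (intro exI[of _ U]) auto
  qed
  then show "f \<in> I (\<Union>\<U>) \<and> (\<forall>U\<in>\<U>. restr U f = s U)" using rf by blast
  fix g assume g: "g \<in> I (\<Union>\<U>) \<and> (\<forall>U\<in>\<U>. restr U g = s U)"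
  show "g = f"
  proof
    fix z show "g z = f z"
    proof (cases "z \<in> \<Union>\<U>")
      case True
      then obtain U where U: "U \<in> \<U>" "z \<in> U" by blast
      then have "restr U g z = s U z" using g by simp
      then show ?thesis using U f_eq by (simp add: restr_def)
    next
      case False
      then show ?thesis using P.Cinf_outside[OF I_memD(1)[OF conjunct1[OF g]]] by (simp add: f_def)
    qed
  qed
qed

lemma subsheaf_I: "subsheaf PM I"
  unfolding subsheaf_def
proof (intro conjI allI impI)
  show "I U \<subseteq> Cinf PM U" for U using I_memD(1) by blast
  show "restr V ` I U \<subseteq> I V" if "openin (mtop PM) U \<and> openin (mtop PM) V \<and> V \<subseteq> U" for U V
    using that restr_in_I by blast
  show "\<exists>!f. f \<in> I (\<Union>\<U>) \<and> (\<forall>U\<in>\<U>. restr U f = s U)"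
    if "(\<forall>U\<in>\<U>. openin (mtop PM) U \<and> s U \<in> I U) \<and> (\<forall>U\<in>\<U>. \<forall>V\<in>\<U>. restr (U \<inter> V) (s U) = restr (U \<inter> V) (s V))" for \<U> s
    using that by (intro I_glue) auto
qed

lemma I_bracket:
  assumes W: "openin (mtop PM) W" and f: "f \<in> I W" and g: "g \<in> I W"
  shows "local_bracket PM (canonical_bracket M) W f g \<in> I W"
proof (rule I_memI)
  note fC = I_memD(1)[OF f] and gC = I_memD(1)[OF g]
  show "local_bracket PM (canonical_bracket M) W f g \<in> Cinf PM W"
    by (rule local_bracket_Cinf[OF W fC gC])
  fix \<rho> assume \<rho>: "\<rho> \<in> Cc PM W"
  obtain \<eta> B where \<eta>: "\<eta> \<in> Cc PM W" "openin (mtop PM) B" "supp PM \<rho> \<subseteq> B" "\<forall>z\<in>B. \<eta> z = 1"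
    by (rule P.compact_bump[OF P.CcD(2,3)[OF \<rho>] W])
  have "(\<lambda>z. \<rho> z * canonical_bracket M (\<lambda>z. \<eta> z * f z) (\<lambda>z. \<eta> z * g z) z) \<in> J"
    by (rule J_bracket[OF I_memD(2)[OF f \<eta>(1)] I_memD(2)[OF g \<eta>(1)] Cc_into_carr[OF W \<rho>]])
  moreover have "\<rho> z * canonical_bracket M (\<lambda>z. \<eta> z * f z) (\<lambda>z. \<eta> z * g z) z =
      \<rho> z * local_bracket PM (canonical_bracket M) W f g z" for z
  proof (cases "z \<in> supp PM \<rho>")
    case True
    then have z: "z \<in> W" "z \<in> B" using P.CcD(3)[OF \<rho>] \<eta>(3) by auto
    note at = smooth_at_Cinf[OF fC W z(1)] smooth_at_Cinf[OF gC W z(1)]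
    have "canonical_bracket M f g z = canonical_bracket M (\<lambda>z. \<eta> z * f z) (\<lambda>z. \<eta> z * g z) z"
      by (rule canonical_bracket_cong[OF \<eta>(2) z(2) _ _ at]) (simp_all add: \<eta>(4))
    then show ?thesis by (simp add: local_bracket_eq[OF z(1) at])
  next
    case False
    then show ?thesis using P.CcD(4)[OF \<rho>] by simp
  qed
  ultimately show "(\<lambda>z. \<rho> z * local_bracket PM (canonical_bracket M) W f g z) \<in> J" by simp
qed

end

subsection \<open>Local finite generation\<close>

context foliated
begin

text \<open>Provides the compact set on the base near which the cut-off \<open>\<psi>\<close> is
  chosen to be 1.\<close>

lemma compactin_fst_supp:
  assumes "f \<in> Cc PM (cdom M U)"
  shows "compactin (mtop M) (fst ` supp PM f)" "fst ` supp PM f \<subseteq> U"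
  using image_compactin[OF P.CcD(2)[OF assms] continuous_map_fst] P.CcD(3)[OF assms] by (auto simp: cdom_def)

lemma vsupp_mult_subset:
  assumes \<psi>: "\<psi> \<in> Cc M U"
  shows "vsupp M (\<lambda>q f. \<psi> q * X q f) \<subseteq> U"
proof -
  have "vsupp M (\<lambda>q f. \<psi> q * X q f) \<subseteq> supp M \<psi>"
    unfolding vsupp_def supp_def by (rule closure_of_mono) auto
  then show ?thesis using CcD(3)[OF \<psi>] by blast
qed

context
  fixes U :: "'a set" and N :: nat and X :: "nat \<Rightarrow> 'a vfield"
  assumes U: "openin (mtop M) U" and X_all: "\<forall>a<N. X a \<in> vector_fields M U"
    and gen: "{Y \<in> F. vsupp M Y \<subseteq> U} = {(\<lambda>r f. \<Sum>a<N. h a r * X a r f) | h. \<forall>a<N. h a \<in> Cc M U}"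
begin

private lemma X: "a < N \<Longrightarrow> X a \<in> vector_fields M U"
  using X_all by blast

text \<open>\<open>X a\<close> lives over \<open>U\<close> only and need not belong to
  \<open>F\<close>; its cut-off does, as a generated field with at most one nonzero
  coefficient.\<close>

lemma generator_in_F:
  assumes \<psi>: "\<psi> \<in> Cc M U" and a: "a < N"
  shows "(\<lambda>r f. \<psi> r * X a r f) \<in> F"
proof -
  let ?h = "\<lambda>b. if b = a then \<psi> else (\<lambda>_. 0)"
  have "(\<lambda>r f. \<Sum>b<N. ?h b r * X b r f) \<in> {Y \<in> F. vsupp M Y \<subseteq> U}"
    unfolding gen using \<psi> zero_in_Cc by (intro CollectI exI[of _ ?h]) auto
  moreover have "(\<Sum>b<N. ?h b r * X b r f) = \<psi> r * X a r f" for r f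
  proof -
    have "(\<Sum>b<N. ?h b r * X b r f) = (\<Sum>b<N. if b = a then \<psi> r * X a r f else 0)"
      by (rule sum.cong) auto
    then show ?thesis using a by simp
  qed
  ultimately show ?thesis by simp
qed

text \<open>\<open>Y\<close> may have support outside \<open>U\<close>, but \<open>\<psi>\<close>
  times \<open>Y\<close> stays in \<open>F\<close> by the module property and is supported in
  \<open>U\<close>.\<close>

lemma cutoff_generated:
  assumes \<psi>: "\<psi> \<in> Cc M U" and Y: "Y \<in> F"
  obtains c where "\<forall>a<N. c a \<in> Cc M U" "\<And>r f. \<psi> r * Y r f = (\<Sum>a<N. c a r * X a r f)"
proof -
  have "(\<lambda>r f. \<psi> r * Y r f) \<in> {Y \<in> F. vsupp M Y \<subseteq> U}"
    using F_mult[OF CcD(1)[OF \<psi>] Y] vsupp_mult_subset[OF \<psi>] by blast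
  then have "\<exists>h. (\<lambda>r f. \<psi> r * Y r f) = (\<lambda>r f. \<Sum>a<N. h a r * X a r f) \<and> (\<forall>a<N. h a \<in> Cc M U)"
    unfolding gen by (rule CollectD)
  then obtain h where h: "(\<lambda>r f. \<psi> r * Y r f) = (\<lambda>r f. \<Sum>a<N. h a r * X a r f)" "\<forall>a<N. h a \<in> Cc M U"
    by (elim exE conjE)
  have "\<psi> r * Y r f = (\<Sum>a<N. h a r * X a r f)" for r f
    using fun_cong[OF fun_cong[OF h(1), of r], of f] .
  then show thesis using h(2) that by blast
qed

lemma generators_Cinf: "a < N \<Longrightarrow> lift_vf M (X a) \<in> Cinf PM (cdom M U)"
  by (rule lift_vf_Cinf[OF X U])

text \<open>After multiplication by \<open>\<rho>\<close> it makes no difference whether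
  \<open>X a\<close> is replaced by \<open>\<psi>\<close> times \<open>X a\<close>, which is a
  member of \<open>F\<close>; the compactly supported coefficients are \<open>\<rho>\<close> times
  \<open>h a\<close>.\<close>

lemma generated_in_I:
  assumes V: "openin (mtop PM) V" "V \<subseteq> cdom M U" and h: "\<And>a. a < N \<Longrightarrow> h a \<in> Cinf PM V"
  shows "(\<lambda>z. \<Sum>a<N. h a z * restr V (lift_vf M (X a)) z) \<in> I V"
proof (rule I_memI)
  show "(\<lambda>z. \<Sum>a<N. h a z * restr V (lift_vf M (X a)) z) \<in> Cinf PM V"
  proof (intro P.Cinf_sum[OF V(1)] P.Cinf_mult[OF V(1)])
    fix a assume "a \<in> {..<N}"
    then have a: "a < N" by simp
    show "h a \<in> Cinf PM V" by (rule h[OF a])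
    show "restr V (lift_vf M (X a)) \<in> Cinf PM V"
      by (rule P.restr_in_Cinf[OF V(1) P.smooth_on_subset[OF P.Cinf_smooth_on[OF generators_Cinf[OF a]]
              cotangent_open_preimage_fst[OF U] V]])
  qed
  fix \<rho> assume \<rho>: "\<rho> \<in> Cc PM V"
  then have \<rho>U: "\<rho> \<in> Cc PM (cdom M U)" using P.Cc_mono[OF V(2)] by blast
  obtain \<psi> B where \<psi>: "\<psi> \<in> Cc M U" "openin (mtop M) B" "fst ` supp PM \<rho> \<subseteq> B" "\<forall>q\<in>B. \<psi> q = 1"
    by (rule compact_bump[OF compactin_fst_supp[OF \<rho>U] U])
  show "(\<lambda>z. \<rho> z * (\<Sum>a<N. h a z * restr V (lift_vf M (X a)) z)) \<in> J"
  proof (rule J_memI)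
    show "(\<lambda>z. \<rho> z * h a z) \<in> Cc PM (carr PM)" if "a < N" for a
      by (rule Cc_into_carr[OF V(1) Cc_mult_Cinf[OF \<rho> V(1) h[OF that]]])
    show "(\<lambda>r f. \<psi> r * X a r f) \<in> F" if "a < N" for a
      by (rule generator_in_F[OF \<psi>(1) that])
    fix z
    show "\<rho> z * (\<Sum>a<N. h a z * restr V (lift_vf M (X a)) z) =
        (\<Sum>a<N. \<rho> z * h a z * lift_vf M (\<lambda>r f. \<psi> r * X a r f) z)"
    proof (cases "z \<in> supp PM \<rho>")
      case True
      then have z: "z \<in> V" "fst z \<in> B" using P.CcD(3)[OF \<rho>] \<psi>(3) by auto
      then have zc: "z \<in> cotangent_carrier M" using V(2) by (auto simp: cdom_def)
      have "restr V (lift_vf M (X a)) z = lift_vf M (\<lambda>r f. \<psi> r * X a r f) z" if "a < N" for a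
        using z \<psi>(4) by (simp add: restr_def lift_vf_scale[OF X[OF that] zc])
      then show ?thesis by (simp add: sum_distrib_left mult.assoc)
    next
      case False
      then show ?thesis using P.CcD(4)[OF \<rho>] by simp
    qed
  qed
qed

text \<open>\<open>f\<close> is a combination of lifts of fields \<open>Y b\<close> that may extend
  beyond \<open>U\<close>. Multiplication by \<open>\<psi>\<close> does not change \<open>f\<close>
  but makes each \<open>Y b\<close> a combination of the \<open>X a\<close>; the resulting
  coefficients are smooth on the whole bundle.\<close>

lemma J_generated:
  assumes f: "f \<in> J" "f \<in> Cc PM (cdom M U)"
  shows "\<exists>m. (\<forall>a<N. m a \<in> Cinf PM (carr PM)) \<and> (\<forall>z. f z = (\<Sum>a<N. m a z * lift_vf M (X a) z))"
proof -
  obtain K :: nat and k Y where k: "\<forall>b<K. k b \<in> Cc PM (carr PM)" and Y: "\<forall>b<K. Y b \<in> F"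
    and f_eq: "f = (\<lambda>z. \<Sum>b<K. k b z * lift_vf M (Y b) z)"
    by (rule J_memE[OF f(1)])
  obtain \<psi> B where \<psi>: "\<psi> \<in> Cc M U" "openin (mtop M) B" "fst ` supp PM f \<subseteq> B" "\<forall>q\<in>B. \<psi> q = 1"
    by (rule compact_bump[OF compactin_fst_supp[OF f(2)] U])
  have "\<exists>c. (\<forall>a<N. c a \<in> Cc M U) \<and> (\<forall>r f. \<psi> r * Y b r f = (\<Sum>a<N. c a r * X a r f))" if b: "b < K" for b
  proof -
    obtain c where "\<forall>a<N. c a \<in> Cc M U" "\<And>r f. \<psi> r * Y b r f = (\<Sum>a<N. c a r * X a r f)"
      using cutoff_generated[OF \<psi>(1) Y[rule_format, OF b]] by blast
    then show ?thesis by blast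
  qed
  then obtain c where c: "\<And>b. b < K \<Longrightarrow> \<forall>a<N. c b a \<in> Cc M U"
    and c_eq: "\<And>b. b < K \<Longrightarrow> \<forall>r f. \<psi> r * Y b r f = (\<Sum>a<N. c b a r * X a r f)"
    by metis
  \<comment> \<open>The coefficients of the two expansions are multiplied, those from the base being
    pulled back along the projection.\<close>
  define m where "m a z = (\<Sum>b<K. k b z * c b a (fst z))" for a z
  have "m a \<in> Cinf PM (carr PM)" if a: "a < N" for a
  proof (rule P.CinfI)
    have "smooth_on PM (carr PM) (\<lambda>z. c b a (fst z))" if "b < K" for b
      using pullback_smooth[OF openin_carr Cinf_smooth_on[OF CcD(1)]] c[OF that] a unfolding cdom_carr by blast
    moreover have "smooth_on PM (carr PM) (k b)" if "b < K" for b
      by (rule P.Cinf_smooth_on[OF P.CcD(1)[OF k[rule_format, OF that]]])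
    ultimately show "smooth_on PM (carr PM) (m a)"
      unfolding m_def[abs_def]
      by (intro P.smooth_on_sum[OF P.openin_carr] P.smooth_on_mult[OF P.openin_carr]) auto
    show "m a z = 0" if "z \<notin> carr PM" for z
      unfolding m_def using P.Cinf_outside[OF P.CcD(1) that] k by (intro sum.neutral) auto
  qed
  moreover have "f z = (\<Sum>a<N. m a z * lift_vf M (X a) z)" for z
  proof (cases "z \<in> cotangent_carrier M")
    case z: True
    have "f z = \<psi> (fst z) * f z"
    proof (cases "z \<in> supp PM f")
      case True
      then show ?thesis using \<psi>(3,4) by auto
    next
      case False
      then show ?thesis using P.CcD(4)[OF f(2)] by simp
    qed
    also have "\<dots> = (\<Sum>b<K. k b z * (\<psi> (fst z) * lift_vf M (Y b) z))"
      by (simp add: f_eq sum_distrib_left algebra_simps)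
    also have "\<dots> = (\<Sum>b<K. k b z * (\<Sum>a<N. c b a (fst z) * lift_vf M (X a) z))"
    proof (intro sum.cong refl arg_cong2[where f="(*)"])
      fix b assume "b \<in> {..<K}"
      then have b: "b < K" by simp
      have "\<psi> (fst z) * lift_vf M (Y b) z = lift_vf M (\<lambda>r f. \<psi> r * Y b r f) z"
        by (rule lift_vf_scale[OF F_vector_field z, symmetric]) (use Y b in auto)
      also have "\<dots> = lift_vf M (\<lambda>r f. \<Sum>a<N. c b a r * X a r f) z"
        using c_eq[OF b] by simp
      also have "\<dots> = (\<Sum>a<N. c b a (fst z) * lift_vf M (X a) z)"
        by (rule lift_vf_sum[OF X z]) simp
      finally show "\<psi> (fst z) * lift_vf M (Y b) z = (\<Sum>a<N. c b a (fst z) * lift_vf M (X a) z)" .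
    qed
    also have "\<dots> = (\<Sum>b<K. \<Sum>a<N. k b z * c b a (fst z) * lift_vf M (X a) z)"
      by (simp add: sum_distrib_left mult.assoc)
    also have "\<dots> = (\<Sum>a<N. \<Sum>b<K. k b z * c b a (fst z) * lift_vf M (X a) z)"
      by (rule sum.swap)
    also have "\<dots> = (\<Sum>a<N. m a z * lift_vf M (X a) z)"
      by (simp add: m_def sum_distrib_right)
    finally show ?thesis .
  next
    case False
    then show ?thesis by (simp add: f_eq lift_vf_outside)
  qed
  ultimately show ?thesis by blast
qed

text \<open>With bumps \<open>b\<^sub>k\<close> equal to 1 on open sets \<open>B\<^sub>k\<close> covering \<open>V\<close>, the functions
  \<open>b\<^sub>k * (1 - b\<^sub>0) * \<dots> * (1 - b\<^bsub>k-1\<^esub>)\<close> sum to 1, and on \<open>B\<^sub>j\<close> those with \<open>k > j\<close> vanish: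
  this replaces a locally finite partition of unity.\<close>

lemma I_generated:
  assumes V: "openin (mtop PM) V" "V \<subseteq> cdom M U" and f: "f \<in> I V"
  obtains h where "\<forall>a<N. h a \<in> Cinf PM V" "f = (\<lambda>z. \<Sum>a<N. h a z * restr V (lift_vf M (X a)) z)"
proof -
  obtain b :: "nat \<Rightarrow> 'a \<times> 'a cvec \<Rightarrow> real" and B where b: "\<And>k. b k \<in> Cc PM V"
    and B: "\<And>k. openin (mtop PM) (B k)" and bB: "\<And>k x. x \<in> B k \<Longrightarrow> b k x = 1" and VB: "V = (\<Union>k. B k)"
    using P.bump_sequence[OF V(1)] by blast
  have "\<exists>m. (\<forall>a<N. m a \<in> Cinf PM (carr PM)) \<and> (\<forall>z. b k z * f z = (\<Sum>a<N. m a z * lift_vf M (X a) z))" for k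
    by (rule J_generated[OF I_memD(2)[OF f b]]) (use P.Cc_mono[OF V(2)] Cc_mult_Cinf[OF b V(1) I_memD(1)[OF f]] in blast)
  then have "\<forall>k. \<exists>m. (\<forall>a<N. m a \<in> Cinf PM (carr PM)) \<and> (\<forall>z. b k z * f z = (\<Sum>a<N. m a z * lift_vf M (X a) z))"
    by (rule allI)
  from choice[OF this] obtain m where m': "\<forall>k. (\<forall>a<N. m k a \<in> Cinf PM (carr PM)) \<and>
      (\<forall>z. b k z * f z = (\<Sum>a<N. m k a z * lift_vf M (X a) z))"
    by (rule exE)
  have m: "\<forall>a<N. m k a \<in> Cinf PM (carr PM)" and m_eq: "\<forall>z. b k z * f z = (\<Sum>a<N. m k a z * lift_vf M (X a) z)" for k
    using spec[OF m', of k] by (rule conjunct1, rule conjunct2)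
  define t where "t a k z = (\<Prod>j<k. 1 - b j z) * m k a z" for a k z
  \<comment> \<open>The first set containing \<open>z\<close> cuts off the formally infinite sum. By
    \<open>h_eq\<close> any other set containing \<open>z\<close> may be used instead, which makes
    \<open>h a\<close> smooth near \<open>z\<close>.\<close>
  define h where "h a z = (if z \<in> V then \<Sum>k\<le>(LEAST k. z \<in> B k). t a k z else 0)" for a z
  have t_0: "t a k z = 0" if "z \<in> B j" "j < k" for a j k z
  proof -
    have "(\<Prod>j<k. 1 - b j z) = 0"
      using bB[OF that(1)] that(2) by (intro prod_zero bexI[of _ j]) auto
    then show ?thesis by (simp add: t_def)
  qed
  have h_eq: "h a z = (\<Sum>k\<le>j. t a k z)" if z: "z \<in> B j" for a j z
  proof -
    let ?i = "LEAST k. z \<in> B k"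
    have i: "z \<in> B ?i" "?i \<le> j" using z by (auto intro: LeastI Least_le)
    have "(\<Sum>k\<le>j. t a k z) = (\<Sum>k\<le>?i. t a k z)"
      by (rule sum.mono_neutral_right) (use i(2) t_0[OF i(1)] in auto)
    moreover have "z \<in> V" using z VB by blast
    ultimately show ?thesis by (simp add: h_def)
  qed
  have sub: "smooth_on PM W g" if "g \<in> Cinf PM (carr PM)" "openin (mtop PM) W" for g W
    using P.smooth_on_subset[OF P.Cinf_smooth_on[OF that(1)] P.openin_carr that(2)] openin_subset[OF that(2)] by blast
  have "h a \<in> Cinf PM V" if a: "a < N" for a
  proof (rule P.CinfI)
    show "smooth_on PM V (h a)"
    proof (rule P.smooth_on_locally[OF V(1)])
      fix z assume "z \<in> V"
      then obtain j where j: "z \<in> B j" using VB by blast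
      have "smooth_on PM (B j) (\<lambda>z. \<Sum>k\<le>j. t a k z)"
        unfolding t_def
        by (intro P.smooth_on_sum[OF B] P.smooth_on_mult[OF B] P.smooth_on_prod[OF B] P.smooth_on_diff[OF B]
            P.smooth_on_const[OF B] sub[OF _ B] P.CcD(1)[OF b]) (use m a in blast)
      then have "smooth_on PM (B j) (h a)"
        by (rule P.smooth_on_cong[OF _ B]) (simp add: h_eq)
      then show "\<exists>W. openin (mtop PM) W \<and> z \<in> W \<and> W \<subseteq> V \<and> smooth_on PM W (h a)"
        using B j VB by blast
    qed
  qed (simp add: h_def)
  moreover have "f z = (\<Sum>a<N. h a z * restr V (lift_vf M (X a)) z)" for z
  proof (cases "z \<in> V")
    case True
    then obtain j where j: "z \<in> B j" using VB by blast
    \<comment> \<open>The weights are successive differences of the products of the factors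
      \<open>1 - b i z\<close>; at a point of \<open>B j\<close> the last of these products contains
      a zero factor.\<close>
    have telescope: "(\<Sum>k\<le>j. (\<Prod>i<k. 1 - b i z) * b k z) = 1 - (\<Prod>i\<le>j. 1 - b i z)" for j
      by (induction j) (simp_all add: lessThan_Suc_atMost algebra_simps)
    have "(\<Prod>i\<le>j. 1 - b i z) = 0" using bB[OF j] by (intro prod_zero bexI[of _ j]) auto
    then have "f z = (\<Sum>k\<le>j. (\<Prod>i<k. 1 - b i z) * b k z) * f z"
      by (simp add: telescope)
    also have "\<dots> = (\<Sum>k\<le>j. (\<Prod>i<k. 1 - b i z) * (b k z * f z))"
      by (simp add: sum_distrib_right mult.assoc)
    also have "\<dots> = (\<Sum>k\<le>j. \<Sum>a<N. t a k z * lift_vf M (X a) z)"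
      by (intro sum.cong refl) (simp add: m_eq t_def sum_distrib_left mult.assoc)
    also have "\<dots> = (\<Sum>a<N. \<Sum>k\<le>j. t a k z * lift_vf M (X a) z)"
      by (rule sum.swap)
    also have "\<dots> = (\<Sum>a<N. h a z * restr V (lift_vf M (X a)) z)"
      using True by (simp add: h_eq[OF j] sum_distrib_right restr_def)
    finally show ?thesis .
  next
    case False
    then show ?thesis using P.Cinf_outside[OF I_memD(1)[OF f]] by (simp add: h_def)
  qed
  then have "f = (\<lambda>z. \<Sum>a<N. h a z * restr V (lift_vf M (X a)) z)" by (rule ext)
  ultimately show thesis by (intro that) auto
qed

end

lemma locally_finitely_generated_I: "locally_finitely_generated PM I"
  unfolding locally_finitely_generated_def
proof
  fix z assume z: "z \<in> carr PM"
  then have zc: "z \<in> cotangent_carrier M" by (simp add: carr_cotangent)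
  obtain U and N :: nat and X where U: "openin (mtop M) U" "fst z \<in> U" and X: "\<forall>a<N. X a \<in> vector_fields M U"
    and gen: "{Y \<in> F. vsupp M Y \<subseteq> U} = {(\<lambda>r f. \<Sum>a<N. h a r * X a r f) | h. \<forall>a<N. h a \<in> Cc M U}"
    by (rule F_locally_generated[OF cotangent_carrierD(1)[OF zc]])
  have eq: "I V = {(\<lambda>y. \<Sum>a<N. h a y * restr V (lift_vf M (X a)) y) | h. \<forall>a<N. h a \<in> Cinf PM V}"
    if V: "openin (mtop PM) V" "V \<subseteq> cdom M U" for V
  proof (intro set_eqI iffI)
    fix f assume "f \<in> I V"
    then obtain h where "\<forall>a<N. h a \<in> Cinf PM V" "f = (\<lambda>z. \<Sum>a<N. h a z * restr V (lift_vf M (X a)) z)"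
      by (rule I_generated[OF U(1) X gen V])
    then show "f \<in> {(\<lambda>y. \<Sum>a<N. h a y * restr V (lift_vf M (X a)) y) | h. \<forall>a<N. h a \<in> Cinf PM V}"
      by (intro CollectI exI[of _ h] conjI)
  next
    fix f assume "f \<in> {(\<lambda>y. \<Sum>a<N. h a y * restr V (lift_vf M (X a)) y) | h. \<forall>a<N. h a \<in> Cinf PM V}"
    then have "\<exists>h. f = (\<lambda>y. \<Sum>a<N. h a y * restr V (lift_vf M (X a)) y) \<and> (\<forall>a<N. h a \<in> Cinf PM V)"
      by (rule CollectD)
    then obtain h where h: "f = (\<lambda>y. \<Sum>a<N. h a y * restr V (lift_vf M (X a)) y)" "\<forall>a<N. h a \<in> Cinf PM V"
      by (elim exE conjE)
    show "f \<in> I V"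
      unfolding h(1) by (rule generated_in_I[OF U(1) X gen V]) (use h(2) in auto)
  qed
  show "\<exists>W (N::nat) g. openin (mtop PM) W \<and> z \<in> W \<and> (\<forall>a<N. g a \<in> Cinf PM W) \<and>
        (\<forall>V. openin (mtop PM) V \<and> V \<subseteq> W \<longrightarrow>
           I V = {(\<lambda>y. \<Sum>a<N. h a y * restr V (g a) y) | h. \<forall>a<N. h a \<in> Cinf PM V})"
  proof (intro exI[of _ "cdom M U"] exI[of _ N] exI[of _ "\<lambda>a. lift_vf M (X a)"] conjI allI impI)
    show "openin (mtop PM) (cdom M U)" by (rule cotangent_open_preimage_fst[OF U(1)])
    show "z \<in> cdom M U" using zc U(2) by (simp add: cdom_def)
    show "lift_vf M (X a) \<in> Cinf PM (cdom M U)" if "a < N" for a by (rule lift_vf_Cinf[OF X[rule_format, OF that] U(1)])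
    show "I V = {(\<lambda>y. \<Sum>a<N. h a y * restr V (lift_vf M (X a)) y) | h. \<forall>a<N. h a \<in> Cinf PM V}"
      if "openin (mtop PM) V \<and> V \<subseteq> cdom M U" for V
      using that by (intro eq) auto
  qed
qed

lemma I_Poisson_manifold_cotangent: "I_Poisson_manifold PM (canonical_bracket M) I"
  unfolding I_Poisson_manifold_def
proof (intro conjI allI impI ballI)
  show "smooth_manifold PM" by (rule smooth_manifold_cotangent)
  show "biderivation PM (canonical_bracket M)" by (rule biderivation_canonical_bracket)
  show "subsheaf PM I" by (rule subsheaf_I)
  show "locally_finitely_generated PM I" by (rule locally_finitely_generated_I)
  show "is_submodule PM W (I W)" if "openin (mtop PM) W" for W by (rule is_submodule_I[OF that])
  show "local_bracket PM (canonical_bracket M) W f g \<in> I W"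
    if "openin (mtop PM) W" "f \<in> I W" "g \<in> I W" for W f g
    by (rule I_bracket[OF that])
  fix f g h assume "f \<in> normalizer PM (canonical_bracket M) I" "g \<in> normalizer PM (canonical_bracket M) I"
    "h \<in> normalizer PM (canonical_bracket M) I"
  then have "f \<in> Cinf PM (carr PM)" "g \<in> Cinf PM (carr PM)" "h \<in> Cinf PM (carr PM)"
    by (simp_all add: normalizer_def)
  then have s: "smooth_on PM (carr PM) f" "smooth_on PM (carr PM) g" "smooth_on PM (carr PM) h"
    by (simp_all add: P.Cinf_smooth_on)
  \<comment> \<open>Off the bundle the bracket is 0 by convention, so the identity holds at all
    points of the type and the cyclic sum is the zero section as a total function.\<close>
  have "canonical_bracket M (canonical_bracket M f g) h z + canonical_bracket M (canonical_bracket M g h) f z +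
      canonical_bracket M (canonical_bracket M h f) g z = 0" for z
  proof (cases "z \<in> carr PM")
    case True
    then show ?thesis by (rule canonical_bracket_Jacobi[OF P.openin_carr _ s])
  next
    case False
    then show ?thesis by (simp add: carr_cotangent canonical_bracket_outside)
  qed
  then show "(\<lambda>z. canonical_bracket M (canonical_bracket M f g) h z + canonical_bracket M (canonical_bracket M g h) f z +
      canonical_bracket M (canonical_bracket M h f) g z) \<in> I (carr PM)"
    using zero_in_I[OF P.openin_carr] by simp
qed

end

theorem corollary5p6:
  fixes M :: "'a manifold" and F :: "'a vfield set"
  assumes "smooth_manifold M" and "singular_foliation M F"
  shows "I_Poisson_manifold (cotangent_bundle M) (canonical_bracket M) (I_foliation M F)"
proof -
  interpret foliated M F
    by unfold_locales (rule assms)+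
  show ?thesis
    by (rule I_Poisson_manifold_cotangent)
qed

end
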